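(* Fix a prime $p$, $b\in(0,\infty)$ and $D>0$. For $h\in(0,1)$ let $\sigma(h,1)$ and $\sigma(h,2)$ be the diffusion coefficients of the scaling limits of the first and second coordinate processes of the anisotropic random walk on $(\mathbb Q_p/\mathbb Z_p)^2$ with parameter $h$, and let $\sigma(\max)$ be the diffusion coefficient of the scaling limit of either coordinate process of the isotropic random walk on $(\mathbb Q_p/\mathbb Z_p)^2$. Then there is a constant $\delta>0$, depending only on $p$, $b$ and $D$, such that for all $h\in(0,1)$, $$|\sigma(h,1)-\sigma(\max)|\ge\delta\quad\text{and}\quad|\sigma(h,2)-\sigma(\max)|\ge\delta.$$
   Context: Let $G=\mathbb Q_p/\mathbb Z_p$. In $G^2$ put $\mathbb B^{(0)}_2(2k+\varepsilon)=(p^{-k}\mathbb Z_p/\mathbb Z_p)\times(p^{-k-\varepsilon}\mathbb Z_p/\mathbb Z_p)$ for $k\ge0$, $\varepsilon\in\{0,1\}$; fine shells $\mathbb S^{(0)}_{\rm f}(j)=\mathbb B^{(0)}_2(j)\smallsetminus\mathbb B^{(0)}_2(j-1)$ for $j\ge1$; coarse shells $\mathbb S^{(0)}_{\rm c}(2k)=\mathbb B^{(0)}_2(2k)\smallsetminus\mathbb B^{(0)}_2(2k-2)$ for $k\ge1$. Anisotropic walk with parameter $h\in(0,1)$: its increment $\mathbf X=(X^{(1)},X^{(2)})$ is uniformly distributed within each fine shell, with $\mathrm{Prob}(\mathbf X\in\mathbb S^{(0)}_{\rm f}(j))=C(h)r_j^{-b}$ for $j\ge1$ and $\mathrm{Prob}(\mathbf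 X=[\mathbf 0])=0$, where $r_{2k+1}=p^{k+h}$, $r_{2k+2}=p^{k+1}$ ($k\ge0$) and $C(h)=(p^{-hb}+p^{-b})^{-1}\frac{p^b-1}{p^b}$. Isotropic walk: its increment $\mathbf X=(X^{(1)},X^{(2)})$ is uniformly distributed within each coarse shell, with $\mathrm{Prob}(\mathbf X\in\mathbb S^{(0)}_{\rm c}(2k))=(p^b-1)p^{-kb}$ for $k\ge1$ and $\mathrm{Prob}(\mathbf X=[\mathbf 0])=0$. The $i$-th coordinate process is the random walk $S_n$ on $G$ started at $[0]$ with i.i.d. increments distributed as $X^{(i)}$. Its scaling limit is the weak limit, as $m\to\infty$, in $D([0,\infty)\colon\mathbb Q_p)$ (with the $J_1$ topology) of the laws of $t\mapsto\Gamma_m(S_{\lfloor\lambda(m)t\rfloor})$, with $\lambda(m)=Dp^{mb}$ and $\Gamma_m([x])=\sum_{k<m}a_{p^mx}(k)p^k$, where $x=\sum_ka_x(k)p^k$ with digits $a_x(k)\in\{0,\dots,p-1\}$. In each case the limit is the process started at $0$ with stationary independent increments whose increment density over time $t>0$ is $\rho(t,x)=\int_{\mathbb Q_p}\chi(xy)e^{-\sigma t|y|_p^b}dy$ for some $\sigma>0$; this $\sigma$ is the diffusion coefficient. Here $\chi(x)=\exp(2\pi\sqrt{-1}\{x\}_p)$ with $\{x\}_p$ the $p$-adic fractional part, and $dy$ is the Haar measure with $\mathbb Z_p$ of mass $1$. *)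

theory Defs
  imports "HOL-Probability.Probability"
begin

section \<open>The field of p-adic numbers\<close>

text \<open>The prime \<open>p\<close> is carried by a type parameter: \<open>p = CARD('p)\<close>. A statement about an arbitrary
  type of this class is a statement about an arbitrary prime.\<close>

class prime_card =
  assumes prime_card [simp]: "prime CARD('a)"

instance bool :: prime_card
  by standard simp

definition padic_abs :: "nat \<Rightarrow> rat \<Rightarrow> real" where
  "padic_abs p r = (if r = 0 then 0 else
     real p powi (int (multiplicity (int p) (snd (quotient_of r)))
                  - int (multiplicity (int p) (fst (quotient_of r)))))"

lemma padic_abs_0 [simp]: "padic_abs p 0 = 0"
  by (simp add: padic_abs_def)

lemma padic_abs_Fract:
  assumes p: "prime p" and "a \<noteq> 0" "b \<noteq> 0"
  shows "padic_abs p (of_int a / of_int b)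
           = real p powi (int (multiplicity (int p) b) - int (multiplicity (int p) a))"
proof -
  define r :: rat where "r = of_int a / of_int b"
  obtain c d where cd: "quotient_of r = (c, d)" by (cases "quotient_of r")
  have d: "d > 0" using quotient_of_denom_pos[OF cd] .
  have r: "r = of_int c / of_int d" using quotient_of_div[OF cd] .
  have "r \<noteq> 0" using assms by (simp add: r_def)
  then have c: "c \<noteq> 0" using r by auto
  have "of_int (a * d) = (of_int (c * b) :: rat)"
    using r assms d unfolding r_def by (simp add: field_simps)
  then have eq: "a * d = c * b" by (simp only: of_int_eq_iff)
  have pe: "prime_elem (int p)" using p by simp
  have "multiplicity (int p) a + multiplicity (int p) d
          = multiplicity (int p) c + multiplicity (int p) b"
    using arg_cong[OF eq, of "multiplicity (int p)"] assms c d
    by (simp add: prime_elem_multiplicity_mult_distrib[OF pe])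
  then have "int (multiplicity (int p) d) - int (multiplicity (int p) c)
      = int (multiplicity (int p) b) - int (multiplicity (int p) a)" by linarith
  then show ?thesis using \<open>r \<noteq> 0\<close> cd unfolding padic_abs_def r_def[symmetric]
    by simp
qed

lemma rat_eq_frac: obtains a b :: int where "b > 0" "(r::rat) = of_int a / of_int b" "coprime a b"
proof -
  obtain c d where cd: "quotient_of r = (c, d)" by (cases "quotient_of r")
  show thesis using that[OF quotient_of_denom_pos[OF cd] quotient_of_div[OF cd] quotient_of_coprime[OF cd]] .
qed

lemma padic_abs_pos: "prime p \<Longrightarrow> r \<noteq> 0 \<Longrightarrow> padic_abs p r > 0"
  by (simp add: padic_abs_def prime_gt_0_nat)

lemma padic_abs_nonneg [simp]: "padic_abs p r \<ge> 0"
  by (simp add: padic_abs_def)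

lemma padic_abs_eq_0 [simp]: "prime p \<Longrightarrow> padic_abs p r = 0 \<longleftrightarrow> r = 0"
  using padic_abs_pos[of p r] by (cases "r = 0") auto

lemma padic_abs_powi: "prime p \<Longrightarrow> r \<noteq> 0 \<Longrightarrow> \<exists>k. padic_abs p r = real p powi k"
  by (auto simp: padic_abs_def)

lemma padic_abs_mult:
  assumes p: "prime p"
  shows "padic_abs p (r * s) = padic_abs p r * padic_abs p s"
proof (cases "r = 0 \<or> s = 0")
  case False
  obtain a b where ab: "b > 0" "r = of_int a / of_int b" by (rule rat_eq_frac)
  obtain c d where cd: "d > 0" "s = of_int c / of_int d" by (rule rat_eq_frac)
  have nz: "a \<noteq> 0" "c \<noteq> 0" using False ab cd by auto
  have pe: "prime_elem (int p)" using p by simp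
  have "r * s = of_int (a * c) / of_int (b * d)" using ab cd by simp
  then have "padic_abs p (r * s) = real p powi (int (multiplicity (int p) (b*d)) - int (multiplicity (int p) (a*c)))"
    using padic_abs_Fract[OF p, of "a*c" "b*d"] nz ab cd by simp
  also have "\<dots> = real p powi ((int (multiplicity (int p) b) - int (multiplicity (int p) a))
                     + (int (multiplicity (int p) d) - int (multiplicity (int p) c)))"
    using nz ab cd by (simp add: prime_elem_multiplicity_mult_distrib[OF pe] algebra_simps)
  also have "\<dots> = padic_abs p r * padic_abs p s"
    using padic_abs_Fract[OF p, of a b] padic_abs_Fract[OF p, of c d] nz ab cd p
    by (subst power_int_add) (auto simp: prime_gt_0_nat)
  finally show ?thesis .
qed auto

lemma padic_abs_of_int_le_1: "prime p \<Longrightarrow> padic_abs p (of_int n) \<le> 1"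
proof (cases "n = 0")
  case False
  assume p: "prime p"
  have "padic_abs p (of_int n) = real p powi (- int (multiplicity (int p) n))"
    using padic_abs_Fract[OF p, of n 1] False by simp
  also have "\<dots> \<le> 1" using p prime_gt_1_nat[OF p]
    by (simp add: power_int_minus power_int_of_nat inverse_le_1_iff)
  finally show ?thesis .
qed auto

lemma padic_abs_minus [simp]: "padic_abs p (- r) = padic_abs p r"
proof -
  have "multiplicity (int p) (- a) = multiplicity (int p) a" for a
    by (rule multiplicity_cong) simp
  then show ?thesis by (auto simp: padic_abs_def rat_uminus_code split: prod.splits)
qed

lemma padic_abs_minus_commute: "padic_abs p (r - s) = padic_abs p (s - r)"
  using padic_abs_minus[of p "r - s"] by simp

lemma padic_abs_add_le_max:
  assumes p: "prime p"
  shows "padic_abs p (r + s) \<le> max (padic_abs p r) (padic_abs p s)"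
proof (cases "r = 0 \<or> s = 0 \<or> r + s = 0")
  case False
  obtain a b where ab: "b > 0" "r = of_int a / of_int b" by (rule rat_eq_frac)
  obtain c d where cd: "d > 0" "s = of_int c / of_int d" by (rule rat_eq_frac)
  let ?m = "multiplicity (int p)"
  have nz: "a \<noteq> 0" "c \<noteq> 0" using False ab cd by auto
  have pe: "prime_elem (int p)" using p by simp
  have nu: "\<not> is_unit (int p)" using prime_gt_1_nat[OF p] by simp
  have rs: "r + s = of_int (a * d + c * b) / of_int (b * d)"
    using ab cd by (simp add: field_simps)
  have nz': "a * d + c * b \<noteq> 0"
  proof
    assume "a * d + c * b = 0"
    then have "r + s = 0" unfolding rs by (simp only: of_int_0 div_0)
    then show False using False by simp
  qed
  have "int p ^ min (?m (a*d)) (?m (c*b)) dvd a * d + c * b"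
    by (intro dvd_add; rule dvd_trans[OF le_imp_power_dvd multiplicity_dvd]) simp_all
  then have "min (?m (a*d)) (?m (c*b)) \<le> ?m (a * d + c * b)"
    using nz' nu by (intro multiplicity_geI) auto
  then have *: "?m (a*d) \<le> ?m (a * d + c * b) \<or> ?m (c*b) \<le> ?m (a * d + c * b)" by linarith
  have P: "real p \<ge> 1" using p prime_ge_1_nat by simp
  have "padic_abs p (r + s) = real p powi (int (?m (b*d)) - int (?m (a * d + c * b)))"
    unfolding rs using padic_abs_Fract[OF p nz', of "b*d"] ab cd by simp
  moreover have "padic_abs p r = real p powi (int (?m (b*d)) - int (?m (a * d)))"
    using padic_abs_Fract[OF p, of "a*d" "b*d"] ab cd nz by simp
  moreover have "padic_abs p s = real p powi (int (?m (b*d)) - int (?m (c * b)))"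
    using padic_abs_Fract[OF p, of "c*b" "b*d"] ab cd nz by (simp add: mult.commute)
  ultimately show ?thesis
    using * P by (auto simp: le_max_iff_disj intro!: power_int_increasing)
qed (auto simp: le_max_iff_disj)

lemma padic_abs_1 [simp]: "padic_abs p 1 = 1"
  by (simp add: padic_abs_def)

lemma padic_abs_inverse: 
  assumes p: "prime p" shows "padic_abs p (inverse r) = inverse (padic_abs p r)"
proof (cases "r = 0")
  case False
  then show ?thesis using padic_abs_mult[OF p, of r "inverse r"]
    by (simp add: field_simps padic_abs_pos p)
qed auto

lemma padic_abs_triangle: "prime p \<Longrightarrow> padic_abs p (r + s) \<le> padic_abs p r + padic_abs p s"
  using padic_abs_add_le_max[of p r s] padic_abs_nonneg[of p r] padic_abs_nonneg[of p s] by linarith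

lemma padic_abs_diff_abs:
  "prime p \<Longrightarrow> \<bar>padic_abs p r - padic_abs p s\<bar> \<le> padic_abs p (r - s)"
  using padic_abs_triangle[of p "r - s" s] padic_abs_triangle[of p "s - r" r]
    padic_abs_minus_commute[of p r s] by simp

lemma padic_abs_p: "prime p \<Longrightarrow> padic_abs p (of_nat p) = 1 / real p"
proof -
  assume p: "prime p"
  then have "multiplicity (int p) (int p) = 1" by (simp add: prime_gt_1_nat)
  then show ?thesis
    using padic_abs_Fract[OF p, of "int p" 1] p
    by (simp add: prime_gt_0_nat power_int_minus inverse_eq_divide del: of_nat_0_less_iff)
qed

definition padic_Cauchy :: "nat \<Rightarrow> (nat \<Rightarrow> rat) \<Rightarrow> bool" where
  "padic_Cauchy p X \<longleftrightarrow> (\<forall>e>0. \<exists>k. \<forall>m\<ge>k. \<forall>n\<ge>k. padic_abs p (X m - X n) < e)"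

definition padic_null :: "nat \<Rightarrow> (nat \<Rightarrow> rat) \<Rightarrow> bool" where
  "padic_null p X \<longleftrightarrow> (\<lambda>n. padic_abs p (X n)) \<longlonglongrightarrow> 0"

lemma padic_CauchyD:
  "padic_Cauchy p X \<Longrightarrow> e > 0 \<Longrightarrow> \<exists>k. \<forall>m\<ge>k. \<forall>n\<ge>k. padic_abs p (X m - X n) < e"
  by (auto simp: padic_Cauchy_def)

lemma padic_Cauchy_const: "padic_Cauchy p (\<lambda>n. r)"
  by (simp add: padic_Cauchy_def)

lemma padic_Cauchy_add:
  assumes p: "prime p" and X: "padic_Cauchy p X" and Y: "padic_Cauchy p Y"
  shows "padic_Cauchy p (\<lambda>n. X n + Y n)"
  unfolding padic_Cauchy_def
proof (intro allI impI)
  fix e :: real assume e: "e > 0"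
  obtain i where i: "\<forall>m\<ge>i. \<forall>n\<ge>i. padic_abs p (X m - X n) < e"
    using padic_CauchyD[OF X e] by blast
  obtain j where j: "\<forall>m\<ge>j. \<forall>n\<ge>j. padic_abs p (Y m - Y n) < e"
    using padic_CauchyD[OF Y e] by blast
  have "padic_abs p ((X m + Y m) - (X n + Y n)) < e" if "m \<ge> max i j" "n \<ge> max i j" for m n
    using padic_abs_add_le_max[OF p, of "X m - X n" "Y m - Y n"] i[rule_format, of m n] j[rule_format, of m n] that
    by (simp add: add_diff_add)
  then show "\<exists>k. \<forall>m\<ge>k. \<forall>n\<ge>k. padic_abs p ((X m + Y m) - (X n + Y n)) < e" by blast
qed

lemma padic_Cauchy_minus: "padic_Cauchy p X \<Longrightarrow> padic_Cauchy p (\<lambda>n. - X n)"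
  unfolding padic_Cauchy_def minus_diff_minus padic_abs_minus .

lemma padic_Cauchy_bounded:
  assumes p: "prime p" and X: "padic_Cauchy p X"
  shows "\<exists>b>0. \<forall>n. padic_abs p (X n) < b"
proof -
  obtain k where k: "\<forall>m\<ge>k. \<forall>n\<ge>k. padic_abs p (X m - X n) < 1"
    using padic_CauchyD[OF X, of 1] by auto
  define M where "M = Max ((\<lambda>n. padic_abs p (X n)) ` {..k})"
  have M: "padic_abs p (X n) \<le> M" if "n \<le> k" for n
    unfolding M_def using that by (intro Max_ge) auto
  have "padic_abs p (X n) < M + 1" for n
  proof (cases "n \<le> k")
    case False
    then have "padic_abs p (X n - X k) < 1" using k by auto
    then show ?thesis using padic_abs_triangle[OF p, of "X n - X k" "X k"] M[of k] by simp
  qed (use M[of n] in simp)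
  moreover have "M + 1 > 0" using M[of k] padic_abs_nonneg[of p "X k"] by linarith
  ultimately show ?thesis by blast
qed

lemma padic_Cauchy_mult:
  assumes p: "prime p" and X: "padic_Cauchy p X" and Y: "padic_Cauchy p Y"
  shows "padic_Cauchy p (\<lambda>n. X n * Y n)"
  unfolding padic_Cauchy_def
proof (intro allI impI)
  fix e :: real assume e: "e > 0"
  obtain a where a: "0 < a" "\<forall>n. padic_abs p (X n) < a" using padic_Cauchy_bounded[OF p X] by blast
  obtain b where b: "0 < b" "\<forall>n. padic_abs p (Y n) < b" using padic_Cauchy_bounded[OF p Y] by blast
  obtain i where i: "\<forall>m\<ge>i. \<forall>n\<ge>i. padic_abs p (X m - X n) < e / b"
    using padic_CauchyD[OF X, of "e / b"] e b by auto
  obtain j where j: "\<forall>m\<ge>j. \<forall>n\<ge>j. padic_abs p (Y m - Y n) < e / a"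
    using padic_CauchyD[OF Y, of "e / a"] e a by auto
  have "padic_abs p (X m * Y m - X n * Y n) < e" if "m \<ge> max i j" "n \<ge> max i j" for m n
  proof -
    have "padic_abs p (X m * (Y m - Y n)) < a * (e / a)"
      unfolding padic_abs_mult[OF p] using a j that by (intro mult_strict_mono) auto
    moreover have "padic_abs p ((X m - X n) * Y n) < (e / b) * b"
      unfolding padic_abs_mult[OF p] using b i that e by (intro mult_strict_mono) auto
    moreover have "X m * Y m - X n * Y n = X m * (Y m - Y n) + (X m - X n) * Y n"
      by (simp add: algebra_simps)
    ultimately show ?thesis
      using padic_abs_add_le_max[OF p, of "X m * (Y m - Y n)" "(X m - X n) * Y n"] a b by auto
  qed
  then show "\<exists>k. \<forall>m\<ge>k. \<forall>n\<ge>k. padic_abs p (X m * Y m - X n * Y n) < e" by blast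
qed

lemma padic_Cauchy_convergent_abs:
  assumes p: "prime p" and X: "padic_Cauchy p X"
  shows "convergent (\<lambda>n. padic_abs p (X n))"
proof -
  have "Cauchy (\<lambda>n. padic_abs p (X n))"
  proof (rule CauchyI)
    fix e :: real assume "e > 0"
    from padic_CauchyD[OF X this] obtain k where k: "\<forall>m\<ge>k. \<forall>n\<ge>k. padic_abs p (X m - X n) < e" by blast
    have "norm (padic_abs p (X m) - padic_abs p (X n)) < e" if "m \<ge> k" "n \<ge> k" for m n
      using padic_abs_diff_abs[OF p, of "X m" "X n"] k[rule_format, of m n] that by simp
    then show "\<exists>M. \<forall>m\<ge>M. \<forall>n\<ge>M. norm (padic_abs p (X m) - padic_abs p (X n)) < e" by blast
  qed
  then show ?thesis by (simp add: Cauchy_convergent_iff)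
qed

text \<open>A Cauchy sequence that is not null has eventually constant absolute value.\<close>

lemma padic_Cauchy_not_null:
  assumes p: "prime p" and X: "padic_Cauchy p X" and nz: "\<not> padic_null p X"
  shows "\<exists>b>0. \<exists>k. (\<forall>n\<ge>k. padic_abs p (X n) = b) \<and> (\<forall>m\<ge>k. \<forall>n\<ge>k. padic_abs p (X m - X n) < b)"
proof -
  obtain L where L: "(\<lambda>n. padic_abs p (X n)) \<longlonglongrightarrow> L"
    using padic_Cauchy_convergent_abs[OF p X] by (auto simp: convergent_def)
  have "L \<ge> 0" by (rule LIMSEQ_le_const[OF L]) auto
  moreover have "L \<noteq> 0" using nz L unfolding padic_null_def by auto
  ultimately have "L > 0" by simp
  then have "eventually (\<lambda>n. padic_abs p (X n) > L / 2) sequentially"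
    using L by (intro order_tendstoD) auto
  then obtain k where k: "\<forall>n\<ge>k. padic_abs p (X n) > L / 2" by (auto simp: eventually_sequentially)
  obtain i where i: "\<forall>m\<ge>i. \<forall>n\<ge>i. padic_abs p (X m - X n) < L / 2"
    using padic_CauchyD[OF X, of "L/2"] \<open>L > 0\<close> by auto
  let ?k = "max i k"
  have "padic_abs p (X n) = padic_abs p (X ?k)" if "n \<ge> ?k" for n
  proof -
    have "padic_abs p (X n - X ?k) < L / 2" "padic_abs p (X n) > L / 2" "padic_abs p (X ?k) > L / 2"
      using i k that by auto
    then show ?thesis
      using padic_abs_add_le_max[OF p, of "X n - X ?k" "X ?k"] padic_abs_add_le_max[OF p, of "X ?k - X n" "X n"]
        padic_abs_minus_commute[of p "X n" "X ?k"] by auto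
  qed
  moreover have "padic_abs p (X m - X n) < padic_abs p (X ?k)" if "m \<ge> ?k" "n \<ge> ?k" for m n
  proof -
    have "padic_abs p (X m - X n) < L / 2" "padic_abs p (X ?k) > L / 2" using i k that by auto
    then show ?thesis by linarith
  qed
  moreover have "padic_abs p (X ?k) > 0"
    using k[rule_format, of ?k] \<open>L > 0\<close> by simp
  ultimately show ?thesis by blast
qed

lemma padic_Cauchy_inverse:
  assumes p: "prime p" and X: "padic_Cauchy p X" and nz: "\<not> padic_null p X"
  shows "padic_Cauchy p (\<lambda>n. inverse (X n))"
  unfolding padic_Cauchy_def
proof (intro allI impI)
  fix e :: real assume e: "e > 0"
  obtain b k where b: "b > 0" and k: "\<forall>n\<ge>k. padic_abs p (X n) = b"
    using padic_Cauchy_not_null[OF assms] by blast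
  obtain i where i: "\<forall>m\<ge>i. \<forall>n\<ge>i. padic_abs p (X m - X n) < e * b * b"
    using padic_CauchyD[OF X, of "e * b * b"] e b by auto
  have "padic_abs p (inverse (X m) - inverse (X n)) < e" if mn: "m \<ge> max i k" "n \<ge> max i k" for m n
  proof -
    have nz: "X m \<noteq> 0" "X n \<noteq> 0" using k b mn by (auto dest: spec[of _ m] spec[of _ n])
    have eq: "inverse (X m) - inverse (X n) = (X n - X m) * inverse (X m) * inverse (X n)"
      using nz by (simp add: field_simps)
    have "padic_abs p (inverse (X m) - inverse (X n)) = padic_abs p (X n - X m) * inverse b * inverse b"
      using k mn by (simp add: eq padic_abs_mult[OF p] padic_abs_inverse[OF p])
    also have "\<dots> < e * b * b * inverse b * inverse b"
      using i b mn by (intro mult_strict_right_mono) auto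
    finally show ?thesis using b by (simp add: field_simps)
  qed
  then show "\<exists>k. \<forall>m\<ge>k. \<forall>n\<ge>k. padic_abs p (inverse (X m) - inverse (X n)) < e" by blast
qed

lemma padic_null_add:
  assumes p: "prime p" and "padic_null p X" "padic_null p Y"
  shows "padic_null p (\<lambda>n. X n + Y n)"
proof -
  have "(\<lambda>n. padic_abs p (X n) + padic_abs p (Y n)) \<longlonglongrightarrow> 0 + 0"
    using assms(2,3) unfolding padic_null_def by (intro tendsto_add)
  then have "(\<lambda>n. padic_abs p (X n) + padic_abs p (Y n)) \<longlonglongrightarrow> 0" by simp
  then show ?thesis unfolding padic_null_def
    by (rule Lim_null_comparison[rotated]) (simp add: padic_abs_triangle p)
qed

lemma padic_null_minus: "padic_null p (\<lambda>n. - X n) \<longleftrightarrow> padic_null p X"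
  by (simp add: padic_null_def)

lemma padic_null_mult:
  assumes p: "prime p" and X: "padic_null p X" and Y: "padic_Cauchy p Y"
  shows "padic_null p (\<lambda>n. X n * Y n)"
proof -
  obtain b where b: "0 < b" "\<forall>n. padic_abs p (Y n) < b" using padic_Cauchy_bounded[OF p Y] by blast
  have "(\<lambda>n. padic_abs p (X n) * b) \<longlonglongrightarrow> 0 * b"
    using X unfolding padic_null_def by (intro tendsto_mult tendsto_const)
  then have lim: "(\<lambda>n. padic_abs p (X n) * b) \<longlonglongrightarrow> 0" by simp
  have "norm (padic_abs p (X n * Y n)) \<le> padic_abs p (X n) * b" for n
    using b(2) by (simp add: padic_abs_mult[OF p] mult_left_mono less_imp_le)
  then show ?thesis unfolding padic_null_def
    by (intro Lim_null_comparison[OF _ lim] always_eventually allI)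
qed

text \<open>\<open>\<rat>\<^sub>p\<close> is the completion of the rationals: the ring of Cauchy sequences for the p-adic absolute value
  modulo the ideal of null sequences.\<close>

typedef 'p padic_seq = "{X. padic_Cauchy CARD('p::prime_card) X}"
  morphisms seq_nth Padic_seq
  using padic_Cauchy_const by blast

setup_lifting type_definition_padic_seq

lemma seq_nth_Cauchy: "padic_Cauchy CARD('p) (seq_nth (X :: 'p::prime_card padic_seq))"
  using seq_nth by auto

instantiation padic_seq :: (prime_card) comm_ring_1
begin
lift_definition zero_padic_seq :: "'a padic_seq" is "\<lambda>n. 0" by (rule padic_Cauchy_const)
lift_definition one_padic_seq :: "'a padic_seq" is "\<lambda>n. 1" by (rule padic_Cauchy_const)
lift_definition plus_padic_seq :: "'a padic_seq \<Rightarrow> 'a padic_seq \<Rightarrow> 'a padic_seq" is "\<lambda>X Y n. X n + Y n"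
  by (rule padic_Cauchy_add[OF prime_card])
lift_definition uminus_padic_seq :: "'a padic_seq \<Rightarrow> 'a padic_seq" is "\<lambda>X n. - X n"
  by (rule padic_Cauchy_minus)
lift_definition minus_padic_seq :: "'a padic_seq \<Rightarrow> 'a padic_seq \<Rightarrow> 'a padic_seq" is "\<lambda>X Y n. X n - Y n"
  using padic_Cauchy_add[OF prime_card _ padic_Cauchy_minus] by fastforce
lift_definition times_padic_seq :: "'a padic_seq \<Rightarrow> 'a padic_seq \<Rightarrow> 'a padic_seq" is "\<lambda>X Y n. X n * Y n"
  by (rule padic_Cauchy_mult[OF prime_card])
instance
  by standard (transfer; force simp: algebra_simps fun_eq_iff)+
end

lift_definition null_seq :: "'p::prime_card padic_seq \<Rightarrow> bool" is "padic_null CARD('p)" .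

lift_definition inv_seq :: "'p::prime_card padic_seq \<Rightarrow> 'p padic_seq" is
  "\<lambda>X. if padic_null CARD('p) X then (\<lambda>n. 0) else (\<lambda>n. inverse (X n))"
  by (auto simp: padic_Cauchy_const padic_Cauchy_inverse)

lemma null_seq_0: "null_seq 0" by transfer (simp add: padic_null_def)
lemma null_seq_add: "null_seq X \<Longrightarrow> null_seq Y \<Longrightarrow> null_seq (X + Y)"
  by transfer (rule padic_null_add[OF prime_card])
lemma null_seq_minus: "null_seq (- X) \<longleftrightarrow> null_seq X"
  by transfer (rule padic_null_minus)
lemma null_seq_mult: "null_seq X \<Longrightarrow> null_seq (X * Y)"
  by transfer (rule padic_null_mult[OF prime_card])
lemma null_seq_mult': "null_seq X \<Longrightarrow> null_seq (Y * X)"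
  using null_seq_mult[of X Y] by (simp add: mult.commute)

lemma inv_seq: "null_seq (inv_seq X * X - 1)" if "\<not> null_seq X"
  using that
proof transfer
  fix X assume X: "padic_Cauchy CARD('a) X" "\<not> padic_null CARD('a) X"
  then obtain b k where "b > 0" and k: "\<forall>n\<ge>k. padic_abs CARD('a) (X n) = b"
    using padic_Cauchy_not_null[OF prime_card X] by blast
  then have "\<forall>n\<ge>k. X n \<noteq> 0" by auto
  then have "eventually (\<lambda>n. padic_abs CARD('a) (inverse (X n) * X n - 1) = 0) sequentially"
    unfolding eventually_sequentially by (intro exI[of _ k]) auto
  then show "padic_null CARD('a) (\<lambda>n. (if padic_null CARD('a) X then \<lambda>n. 0 else (\<lambda>n. inverse (X n))) n * X n - 1)"
    using X by (auto simp: padic_null_def intro: tendsto_eventually)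
qed

definition padic_rel :: "'p::prime_card padic_seq \<Rightarrow> 'p padic_seq \<Rightarrow> bool" where
  "padic_rel X Y \<longleftrightarrow> null_seq (X - Y)"

lemma equivp_padic_rel: "equivp padic_rel"
proof (rule equivpI)
  show "reflp padic_rel" by (simp add: reflp_def padic_rel_def null_seq_0)
  show "symp padic_rel" unfolding symp_def padic_rel_def
    by (metis minus_diff_eq null_seq_minus)
  show "transp padic_rel" unfolding transp_def padic_rel_def
    by (metis diff_add_cancel add_diff_eq null_seq_add)
qed

quotient_type 'p padic = "'p::prime_card padic_seq" / padic_rel
  by (rule equivp_padic_rel)

instantiation padic :: (prime_card) field
begin
lift_definition zero_padic :: "'a padic" is 0 .
lift_definition one_padic :: "'a padic" is 1 .
lift_definition plus_padic :: "'a padic \<Rightarrow> 'a padic \<Rightarrow> 'a padic" is "(+)"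
  unfolding padic_rel_def by (metis add_diff_add null_seq_add)
lift_definition uminus_padic :: "'a padic \<Rightarrow> 'a padic" is uminus
  unfolding padic_rel_def by (metis minus_diff_minus null_seq_minus)
lift_definition minus_padic :: "'a padic \<Rightarrow> 'a padic \<Rightarrow> 'a padic" is "(-)"
proof -
  fix A B C E :: "'a padic_seq"
  assume "padic_rel A B" "padic_rel C E"
  then have "null_seq ((A - B) + - (C - E))"
    unfolding padic_rel_def by (intro null_seq_add) (simp_all only: null_seq_minus)
  then show "padic_rel (A - C) (B - E)" by (simp add: padic_rel_def algebra_simps)
qed
lift_definition times_padic :: "'a padic \<Rightarrow> 'a padic \<Rightarrow> 'a padic" is "(*)"
  unfolding padic_rel_def by (metis mult_diff_mult null_seq_add null_seq_mult null_seq_mult')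
lift_definition inverse_padic :: "'a padic \<Rightarrow> 'a padic" is inv_seq
proof -
  fix X Y :: "'a padic_seq" assume XY: "padic_rel X Y"
  then have XY': "null_seq (X - Y)" by (simp add: padic_rel_def)
  have iff: "null_seq X \<longleftrightarrow> null_seq Y"
    using null_seq_add[of "X - Y" Y] null_seq_add[of "- (X - Y)" X] XY' null_seq_minus[of "X - Y"] by auto
  show "padic_rel (inv_seq X) (inv_seq Y)"
  proof (cases "null_seq X")
    case True
    then have "inv_seq X = 0" "inv_seq Y = 0" using iff by (transfer; simp)+
    then show ?thesis by (simp add: padic_rel_def null_seq_0)
  next
    case False
    have 1: "null_seq (inv_seq X * X - 1)" "null_seq (inv_seq Y * Y - 1)" using False iff by (auto intro: inv_seq)
    have "null_seq ((inv_seq Y * Y - 1) * - inv_seq X + (inv_seq X * X - 1) * inv_seq Y + (X - Y) * (- (inv_seq X * inv_seq Y)))"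
      using 1 XY' by (intro null_seq_add null_seq_mult)
    then show ?thesis by (simp add: padic_rel_def algebra_simps)
  qed
qed
definition "divide_padic (x :: 'a padic) y = x * inverse y"
instance
proof
  fix a b c :: "'a padic"
  show "a + b + c = a + (b + c)" by transfer (simp add: padic_rel_def null_seq_0 algebra_simps)
  show "a + b = b + a" by transfer (simp add: padic_rel_def null_seq_0 algebra_simps)
  show "0 + a = a" by transfer (simp add: padic_rel_def null_seq_0 algebra_simps)
  show "- a + a = 0" by transfer (simp add: padic_rel_def null_seq_0 algebra_simps)
  show "a - b = a + - b" by transfer (simp add: padic_rel_def null_seq_0 algebra_simps)
  show "a * b * c = a * (b * c)" by transfer (simp add: padic_rel_def null_seq_0 algebra_simps)
  show "a * b = b * a" by transfer (simp add: padic_rel_def null_seq_0 algebra_simps)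
  show "1 * a = a" by transfer (simp add: padic_rel_def null_seq_0 algebra_simps)
  show "(a + b) * c = a * c + b * c" by transfer (simp add: padic_rel_def null_seq_0 algebra_simps)
  show "(0 :: 'a padic) \<noteq> 1"
    by (transfer, simp add: padic_rel_def, transfer, simp add: padic_null_def LIMSEQ_const_iff)
  show "a \<noteq> 0 \<Longrightarrow> inverse a * a = 1" by transfer (simp add: padic_rel_def inv_seq)
  show "a div b = a * inverse b" by (rule divide_padic_def)
  show "inverse (0 :: 'a padic) = 0"
    by (transfer, simp add: padic_rel_def, transfer, simp add: padic_null_def)
qed
end

lift_definition seq_abs :: "'p::prime_card padic_seq \<Rightarrow> real" is
  "\<lambda>X. lim (\<lambda>n. padic_abs CARD('p) (X n))" .

lemma seq_abs_LIMSEQ: "(\<lambda>n. padic_abs CARD('p) (seq_nth X n)) \<longlonglongrightarrow> seq_abs (X :: 'p::prime_card padic_seq)"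
  using padic_Cauchy_convergent_abs[OF prime_card seq_nth_Cauchy[of X]]
  by (simp add: seq_abs.rep_eq convergent_LIMSEQ_iff)

text \<open>The p-adic absolute value on \<open>\<rat>\<^sub>p\<close>. It is not an instance of the constant \<open>norm\<close>, whose type
  is restricted to real normed vector spaces.\<close>

lift_definition padic_norm :: "'p::prime_card padic \<Rightarrow> real" is seq_abs
proof -
  fix X Y :: "'p padic_seq" assume XY: "padic_rel X Y"
  then have lim: "(\<lambda>n. padic_abs CARD('p) (seq_nth X n - seq_nth Y n)) \<longlonglongrightarrow> 0"
    unfolding padic_rel_def by transfer (simp add: padic_null_def)
  have "(\<lambda>n. padic_abs CARD('p) (seq_nth X n) - padic_abs CARD('p) (seq_nth Y n)) \<longlonglongrightarrow> 0"
    by (rule Lim_null_comparison[OF _ lim]) (simp add: padic_abs_diff_abs)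
  moreover have "(\<lambda>n. padic_abs CARD('p) (seq_nth X n) - padic_abs CARD('p) (seq_nth Y n)) \<longlonglongrightarrow> seq_abs X - seq_abs Y"
    by (intro tendsto_diff seq_abs_LIMSEQ)
  ultimately have "seq_abs X - seq_abs Y = 0" using LIMSEQ_unique by blast
  then show "seq_abs X = seq_abs Y" by simp
qed

instantiation padic :: (prime_card) metric_space
begin
definition "dist_padic x y = padic_norm (x - y :: 'a padic)"
definition "uniformity_padic = (INF e\<in>{0 <..}. principal {(x, y :: 'a padic). dist x y < e})"
definition "open_padic (U :: 'a padic set) \<longleftrightarrow> (\<forall>x\<in>U. eventually (\<lambda>(x', y). x' = x \<longrightarrow> y \<in> U) uniformity)"

lemma norm_padic_mult: "padic_norm (x * y) = padic_norm x * padic_norm (y :: 'a padic)"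
proof transfer
  fix X Y :: "'a padic_seq"
  have "(\<lambda>n. padic_abs CARD('a) (seq_nth (X * Y) n)) \<longlonglongrightarrow> seq_abs X * seq_abs Y"
    by (simp add: times_padic_seq.rep_eq padic_abs_mult tendsto_mult seq_abs_LIMSEQ)
  then show "seq_abs (X * Y) = seq_abs X * seq_abs Y"
    using LIMSEQ_unique seq_abs_LIMSEQ by blast
qed

lemma norm_padic_add_le_max: "padic_norm (x + y) \<le> max (padic_norm x) (padic_norm (y :: 'a padic))"
proof transfer
  fix X Y :: "'a padic_seq"
  have lim: "(\<lambda>n. max (padic_abs CARD('a) (seq_nth X n)) (padic_abs CARD('a) (seq_nth Y n))) \<longlonglongrightarrow> max (seq_abs X) (seq_abs Y)"
    by (intro tendsto_max seq_abs_LIMSEQ)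
  show "seq_abs (X + Y) \<le> max (seq_abs X) (seq_abs Y)"
    by (rule LIMSEQ_le[OF seq_abs_LIMSEQ lim]) (simp add: plus_padic_seq.rep_eq padic_abs_add_le_max)
qed

lemma norm_padic_eq_0: "padic_norm x = 0 \<longleftrightarrow> (x :: 'a padic) = 0"
proof transfer
  fix X :: "'a padic_seq"
  have "seq_abs X = 0 \<longleftrightarrow> null_seq X"
    using seq_abs_LIMSEQ[of X] LIMSEQ_unique unfolding null_seq.rep_eq padic_null_def by metis
  then show "(seq_abs X = 0) = padic_rel X 0" by (simp add: padic_rel_def)
qed

lemma norm_padic_minus: "padic_norm (- x) = padic_norm (x :: 'a padic)"
  by (transfer, transfer, simp)

lemma norm_padic_nonneg: "padic_norm (x :: 'a padic) \<ge> 0"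
proof transfer
  fix X :: "'a padic_seq"
  show "seq_abs X \<ge> 0" by (rule LIMSEQ_le_const[OF seq_abs_LIMSEQ]) auto
qed

instance
proof
  fix x y z :: "'a padic"
  show "dist x y = 0 \<longleftrightarrow> x = y" by (simp add: dist_padic_def norm_padic_eq_0)
  have "dist x y \<le> max (padic_norm (x - z)) (padic_norm (- (y - z)))"
    using norm_padic_add_le_max[of "x - z" "- (y - z)"] by (simp add: dist_padic_def)
  then show "dist x y \<le> dist x z + dist y z"
    unfolding norm_padic_minus dist_padic_def
    using norm_padic_nonneg[of "x - z"] norm_padic_nonneg[of "y - z"] by linarith
qed (simp_all add: uniformity_padic_def open_padic_def)
end

declare norm_padic_eq_0 [simp] norm_padic_minus [simp] norm_padic_nonneg [simp]

lemma norm_padic_0 [simp]: "padic_norm (0 :: 'p::prime_card padic) = 0" by simp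

lemma norm_padic_1 [simp]: "padic_norm (1 :: 'p::prime_card padic) = 1"
proof -
  have "padic_norm (1 :: 'p padic) * padic_norm (1 :: 'p padic) = padic_norm (1 :: 'p padic)"
    by (simp flip: norm_padic_mult)
  then show ?thesis by simp
qed

lemma norm_padic_diff_le_max: "padic_norm (x - y) \<le> max (padic_norm x) (padic_norm (y :: 'p::prime_card padic))"
  using norm_padic_add_le_max[of x "- y"] by simp

lemma norm_padic_minus_commute: "padic_norm (x - y) = padic_norm (y - x :: 'p::prime_card padic)"
  using norm_padic_minus[of "x - y"] by simp

lemma norm_padic_inverse: "padic_norm (inverse x) = inverse (padic_norm (x :: 'p::prime_card padic))"
proof (cases "x = 0")
  case False
  then show ?thesis using norm_padic_mult[of x "inverse x"] by (simp add: field_simps)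
qed simp

lemma norm_padic_divide: "padic_norm (x / y) = padic_norm x / padic_norm (y :: 'p::prime_card padic)"
  by (simp add: divide_inverse norm_padic_mult norm_padic_inverse)

lemma norm_padic_power: "padic_norm (x ^ n) = padic_norm (x :: 'p::prime_card padic) ^ n"
  by (induction n) (simp_all add: norm_padic_mult)

lemma norm_padic_powi: "padic_norm (x powi n) = padic_norm (x :: 'p::prime_card padic) powi n"
  by (simp add: power_int_def norm_padic_power norm_padic_inverse)

lemma norm_padic_sum_le:
  assumes "finite A" "\<And>i. i \<in> A \<Longrightarrow> padic_norm (f i :: 'p::prime_card padic) \<le> B" "B \<ge> 0"
  shows "padic_norm (sum f A) \<le> B"
  using assms(1,2)
proof (induction A rule: finite_induct)
  case (insert a A)
  then show ?case using norm_padic_add_le_max[of "f a" "sum f A"] by force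
qed (use assms(3) in simp)

lemma norm_padic_add_eq:
  assumes "padic_norm (y :: 'p::prime_card padic) < padic_norm x" shows "padic_norm (x + y) = padic_norm x"
  using norm_padic_add_le_max[of x y] norm_padic_diff_le_max[of "x + y" y] assms by auto

lift_definition const_seq :: "rat \<Rightarrow> 'p::prime_card padic_seq" is "\<lambda>r n. r"
  by (rule padic_Cauchy_const)

lemma seq_abs_const: "seq_abs (const_seq r :: 'p::prime_card padic_seq) = padic_abs CARD('p) r"
  by transfer simp

lift_definition const_padic :: "rat \<Rightarrow> 'p::prime_card padic" is const_seq .

lemma const_seq_hom:
  "const_seq (r + s) = const_seq r + const_seq s"
  "const_seq (r * s) = const_seq r * const_seq s"
  "const_seq 0 = 0" "const_seq 1 = 1" "const_seq (- r) = - const_seq r"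
  by (transfer; simp)+

lemma const_padic_hom:
  "const_padic (r + s) = const_padic r + const_padic s"
  "const_padic (r * s) = const_padic r * const_padic s"
  "const_padic 0 = 0" "const_padic 1 = 1" "const_padic (- r) = - const_padic r"
  unfolding const_padic.abs_eq const_seq_hom plus_padic.abs_eq times_padic.abs_eq
    zero_padic.abs_eq one_padic.abs_eq uminus_padic.abs_eq
  by (simp_all add: zero_padic_def one_padic_def)

lemma norm_const_padic: "padic_norm (const_padic r :: 'p::prime_card padic) = padic_abs CARD('p) r"
  by transfer (rule seq_abs_const)

lemma of_nat_padic: "of_nat n = (const_padic (of_nat n) :: 'p::prime_card padic)"
  by (induction n) (simp_all add: const_padic_hom)

instance padic :: (prime_card) field_char_0
proof
  show "inj (of_nat :: nat \<Rightarrow> 'a padic)"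
  proof (rule injI)
    fix m n :: nat assume "(of_nat m :: 'a padic) = of_nat n"
    then have "const_padic (of_nat m + - of_nat n) = (0 :: 'a padic)"
      by (simp only: const_padic_hom of_nat_padic) simp
    then have "padic_norm (const_padic (of_nat m + - of_nat n) :: 'a padic) = 0" by simp
    then have "(of_nat m + - of_nat n :: rat) = 0"
      by (simp only: norm_const_padic padic_abs_eq_0[OF prime_card])
    then show "m = n" by simp
  qed
qed

lemma of_int_padic: "of_int n = (const_padic (of_int n) :: 'p::prime_card padic)"
proof (cases n rule: int_cases2)
  case (nonneg m)
  then show ?thesis by (simp add: of_nat_padic)
next
  case (nonpos m)
  then show ?thesis by (simp add: of_nat_padic const_padic_hom)
qed

lemma of_rat_padic: "of_rat r = (const_padic r :: 'p::prime_card padic)"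
proof -
  obtain a b where ab: "b > 0" "r = of_int a / of_int b" by (rule rat_eq_frac)
  then have "r * of_int b = of_int a" by simp
  then have "const_padic r * of_int b = (of_int a :: 'p padic)"
    by (simp add: of_int_padic flip: const_padic_hom)
  moreover have "(of_int b :: 'p padic) \<noteq> 0" using ab by simp
  ultimately have "const_padic r = (of_int a / of_int b :: 'p padic)" by (simp add: eq_divide_eq)
  then show ?thesis using ab by (simp add: of_rat_divide)
qed

lemma norm_of_rat_padic: "padic_norm (of_rat r :: 'p::prime_card padic) = padic_abs CARD('p) r"
  by (simp add: of_rat_padic norm_const_padic)

lemma norm_of_int_padic_le_1: "padic_norm (of_int n :: 'p::prime_card padic) \<le> 1"
  using norm_of_rat_padic[of "of_int n", where 'p='p] padic_abs_of_int_le_1[of "CARD('p)" n] by simp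

lemma norm_of_nat_padic_le_1: "padic_norm (of_nat n :: 'p::prime_card padic) \<le> 1"
  using norm_of_int_padic_le_1[of "int n"] by simp


lemma norm_padic_p: "padic_norm (of_nat CARD('p) :: 'p::prime_card padic) = 1 / real CARD('p)"
  using norm_of_rat_padic[of "of_nat CARD('p)", where 'p='p] padic_abs_p[of "CARD('p)"] by simp

lemma card_gt_1 [simp]: "CARD('p::prime_card) > 1"
  by (rule prime_gt_1_nat) simp

lemma card_pos [simp]: "CARD('p::prime_card) > 0"
  using card_gt_1[where 'p='p] by linarith

lemma norm_padic_p_powi: "padic_norm (of_nat CARD('p) powi k :: 'p::prime_card padic) = real CARD('p) powi (- k)"
  by (simp add: norm_padic_powi norm_padic_p power_int_divide_distrib power_int_minus inverse_eq_divide
           del: One_nat_def)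

lemma abs_padic_LIMSEQ:
  "(\<lambda>n. of_rat (seq_nth X n)) \<longlonglongrightarrow> (abs_padic X :: 'p::prime_card padic)"
  unfolding LIMSEQ_def
proof (intro allI impI)
  fix e :: real assume e: "e > 0"
  obtain k where k: "\<forall>m\<ge>k. \<forall>n\<ge>k. padic_abs CARD('p) (seq_nth X m - seq_nth X n) < e / 2"
    using padic_CauchyD[OF seq_nth_Cauchy[of X], of "e / 2"] e by auto
  have "dist (of_rat (seq_nth X n)) (abs_padic X) < e" if n: "n \<ge> k" for n
  proof -
    have "(\<lambda>m. padic_abs CARD('p) (seq_nth (const_seq (seq_nth X n) - X) m)) \<longlonglongrightarrow> seq_abs (const_seq (seq_nth X n) - X)"
      by (rule seq_abs_LIMSEQ)
    then have "seq_abs (const_seq (seq_nth X n) - X) \<le> e / 2"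
      by (rule LIMSEQ_le_const2)
         (use k n in \<open>auto intro!: exI[of _ k] simp: minus_padic_seq.rep_eq const_seq.rep_eq less_imp_le\<close>)
    then have "padic_norm (of_rat (seq_nth X n) - abs_padic X) \<le> e / 2"
      by (simp add: of_rat_padic const_padic.abs_eq minus_padic.abs_eq padic_norm.abs_eq)
    then show ?thesis using e by (simp add: dist_padic_def)
  qed
  then show "\<exists>no. \<forall>n\<ge>no. dist (of_rat (seq_nth X n)) (abs_padic X) < e" by blast
qed

lemma padic_rat_approx:
  assumes "e > 0" shows "\<exists>r. padic_norm (x - of_rat r :: 'p::prime_card padic) < e"
proof -
  obtain X where X: "x = abs_padic X" using padic.abs_induct[of "\<lambda>x. \<exists>X. x = abs_padic X" x] by blast
  from abs_padic_LIMSEQ[of X] assms have "\<exists>n. dist (of_rat (seq_nth X n)) x < e"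
    unfolding LIMSEQ_def X by blast
  then show ?thesis by (metis dist_padic_def norm_padic_minus_commute)
qed

instance padic :: (prime_card) complete_space
proof
  fix x :: "nat \<Rightarrow> 'a padic" assume "Cauchy x"
  have "\<exists>r. \<forall>n. padic_norm (x n - of_rat (r n)) < inverse (real (Suc n))"
    by (intro choice allI padic_rat_approx) simp
  then obtain r where r: "\<And>n. padic_norm (x n - of_rat (r n)) < inverse (real (Suc n))" by blast
  have lim: "(\<lambda>n. x n - of_rat (r n)) \<longlonglongrightarrow> 0"
  proof (rule metric_LIMSEQ_I)
    fix e :: real assume "e > 0"
    then obtain N where N: "inverse (real (Suc N)) < e" using reals_Archimedean by blast
    have "dist (x n - of_rat (r n)) 0 < e" if "n \<ge> N" for n
    proof -
      have "inverse (real (Suc n)) \<le> inverse (real (Suc N))" using that by simp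
      then have "padic_norm (x n - of_rat (r n)) < e" using r[of n] N by linarith
      then show ?thesis by (simp add: dist_padic_def)
    qed
    then show "\<exists>no. \<forall>n\<ge>no. dist (x n - of_rat (r n)) 0 < e" by blast
  qed
  have "padic_Cauchy CARD('a) r"
    unfolding padic_Cauchy_def
  proof (intro allI impI)
    fix e :: real assume e: "e > 0"
    obtain M where M: "\<forall>m\<ge>M. \<forall>n\<ge>M. padic_norm (x m - x n) < e"
      using \<open>Cauchy x\<close> e unfolding Cauchy_def dist_padic_def by blast
    obtain N where N: "\<forall>n\<ge>N. padic_norm (x n - of_rat (r n)) < e"
      using lim e unfolding LIMSEQ_def dist_padic_def by auto
    have "padic_abs CARD('a) (r m - r n) < e" if mn: "m \<ge> max M N" "n \<ge> max M N" for m n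
    proof -
      have "(of_rat (r m - r n) :: 'a padic) = (x m - x n) + ((x n - of_rat (r n)) - (x m - of_rat (r m)))"
        by (simp add: of_rat_diff)
      then have "padic_norm (of_rat (r m - r n) :: 'a padic) \<le> max (padic_norm (x m - x n)) (max (padic_norm (x n - of_rat (r n))) (padic_norm (x m - of_rat (r m))))"
        by (simp only:) (rule order.trans[OF norm_padic_add_le_max max.mono[OF order.refl norm_padic_diff_le_max]])
      moreover have "padic_norm (x m - x n) < e" "padic_norm (x n - of_rat (r n)) < e" "padic_norm (x m - of_rat (r m)) < e"
        using M N mn by auto
      ultimately show ?thesis by (simp add: norm_of_rat_padic)
    qed
    then show "\<exists>k. \<forall>m\<ge>k. \<forall>n\<ge>k. padic_abs CARD('a) (r m - r n) < e" by blast
  qed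
  then obtain X :: "'a padic_seq" where X: "seq_nth X = r" by (metis Padic_seq_inverse mem_Collect_eq)
  have L: "(\<lambda>n. of_rat (r n)) \<longlonglongrightarrow> abs_padic X" using abs_padic_LIMSEQ[of X] X by simp
  have "x \<longlonglongrightarrow> abs_padic X"
  proof (rule metric_LIMSEQ_I)
    fix e :: real assume e: "e > 0"
    obtain N where N: "\<forall>n\<ge>N. padic_norm (x n - of_rat (r n)) < e"
      using lim e unfolding LIMSEQ_def dist_padic_def by auto
    obtain M where M: "\<forall>n\<ge>M. padic_norm (of_rat (r n) - abs_padic X) < e"
      using L e unfolding LIMSEQ_def dist_padic_def by blast
    have "dist (x n) (abs_padic X) < e" if "n \<ge> max M N" for n
      using norm_padic_add_le_max[of "x n - of_rat (r n)" "of_rat (r n) - abs_padic X"]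
        M[rule_format, of n] N[rule_format, of n] that
      by (simp add: dist_padic_def)
    then show "\<exists>no. \<forall>n\<ge>no. dist (x n) (abs_padic X) < e" by blast
  qed
  then show "convergent x" by (auto simp: convergent_def)
qed

instance padic :: (prime_card) topological_group_add
proof
  fix a b :: "'a padic"
  show "((\<lambda>x. fst x + snd x) \<longlongrightarrow> a + b) (nhds a \<times>\<^sub>F nhds b)"
    unfolding tendsto_iff
  proof (intro allI impI)
    fix e :: real assume "e > 0"
    have "eventually (\<lambda>x. dist x a < e) (nhds a)" "eventually (\<lambda>x. dist x b < e) (nhds b)"
      using \<open>e > 0\<close> eventually_nhds_metric by blast+
    then have "eventually (\<lambda>x. dist (fst x) a < e \<and> dist (snd x) b < e) (nhds a \<times>\<^sub>F nhds b)"
      using eventually_prodI by fastforce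
    then show "\<forall>\<^sub>F x in nhds a \<times>\<^sub>F nhds b. dist (fst x + snd x) (a + b) < e"
    proof eventually_elim
      case (elim x)
      then show ?case using norm_padic_add_le_max[of "fst x - a" "snd x - b"]
        by (auto simp: dist_padic_def add_diff_add)
    qed
  qed
  show "(uminus \<longlongrightarrow> - a) (nhds a)"
    unfolding tendsto_iff
  proof (intro allI impI)
    fix e :: real assume "e > 0"
    have "dist (- x) (- a) = dist x a" for x by (simp add: dist_padic_def norm_padic_minus_commute[of a x])
    then show "\<forall>\<^sub>F x in nhds a. dist (- x) (- a) < e"
      using \<open>e > 0\<close> by (auto simp: eventually_nhds_metric)
  qed
qed

lemma norm_padic_discrete: "(x :: 'p::prime_card padic) \<noteq> 0 \<Longrightarrow> \<exists>k. padic_norm x = real CARD('p) powi k"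
proof -
  assume x: "x \<noteq> 0"
  then obtain r where r: "padic_norm (x - of_rat r) < padic_norm x" using padic_rat_approx[of "padic_norm x" x]
    by (metis norm_padic_eq_0 norm_padic_nonneg order_le_imp_less_or_eq)
  have "padic_norm (of_rat r :: 'p padic) = padic_norm x"
    using norm_padic_add_eq[of "of_rat r - x" x] r norm_padic_minus_commute[of x "of_rat r"] by simp
  then have "padic_abs CARD('p) r = padic_norm x" by (simp add: norm_of_rat_padic)
  moreover have "r \<noteq> 0" using r by auto
  ultimately show ?thesis using padic_abs_powi[of "CARD('p)" r] by auto
qed


lemma powi_less_iff: "(a::real) > 1 \<Longrightarrow> a powi m < a powi n \<longleftrightarrow> m < n"
  using power_int_strict_increasing[of m n a] power_int_increasing[of n m a] by (smt (verit))

lemma powi_le_iff: "(a::real) > 1 \<Longrightarrow> a powi m \<le> a powi n \<longleftrightarrow> m \<le> n"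
  using powi_less_iff[of a n m] by linarith

lemma real_card_gt_1 [simp]: "1 < real CARD('p::prime_card)"
  using card_gt_1[where 'p='p] by linarith

lemma norm_padic_less_iff:
  "padic_norm (x :: 'p::prime_card padic) < real CARD('p) powi k \<longleftrightarrow> padic_norm x \<le> real CARD('p) powi (k - 1)"
proof (cases "x = 0")
  case False
  then obtain j where j: "padic_norm x = real CARD('p) powi j" using norm_padic_discrete by blast
  then show ?thesis by (simp only: powi_less_iff[OF real_card_gt_1] powi_le_iff[OF real_card_gt_1]) linarith
qed simp

instance padic :: (prime_card) second_countable_topology
proof
  define B :: "'a padic set set" where
    "B = (\<lambda>(r, n). ball (of_rat r) (inverse (real (Suc n)))) ` (UNIV :: (rat \<times> nat) set)"
  have "topological_basis B"
  proof (rule topological_basisI)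
    fix U :: "'a padic set" and x assume U: "open U" "x \<in> U"
    then obtain e where e: "e > 0" "ball x e \<subseteq> U" by (auto simp: open_contains_ball)
    obtain n where n: "inverse (real (Suc n)) < e / 2" using reals_Archimedean[of "e / 2"] e by auto
    obtain r where r: "padic_norm (x - of_rat r) < inverse (real (Suc n))"
      using padic_rat_approx[of "inverse (real (Suc n))" x] by auto
    have "ball (of_rat r :: 'a padic) (inverse (real (Suc n))) \<subseteq> ball x e"
    proof
      fix y :: "'a padic" assume "y \<in> ball (of_rat r) (inverse (real (Suc n)))"
      then have "dist x y < e"
        using dist_triangle[of x y "of_rat r"] r n by (simp add: dist_padic_def)
      then show "y \<in> ball x e" by simp
    qed
    moreover have "x \<in> ball (of_rat r) (inverse (real (Suc n)))"
      using r by (simp add: dist_padic_def norm_padic_minus_commute)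
    ultimately show "\<exists>V\<in>B. x \<in> V \<and> V \<subseteq> U" using e unfolding B_def by blast
  qed (auto simp: B_def)
  then show "\<exists>B :: 'a padic set set. countable B \<and> open = generate_topology B"
    by (intro exI[of _ B]) (auto simp: B_def topological_basis_imp_subbasis)
qed

abbreviation padic_p :: "'p::prime_card padic" where
  "padic_p \<equiv> of_nat CARD('p)"

lemma norm_padic_of_int_eq_1:
  assumes "\<not> int CARD('p) dvd c" shows "padic_norm (of_int c :: 'p::prime_card padic) = 1"
proof -
  have "c \<noteq> 0" using assms by auto
  then have "padic_abs CARD('p) (of_int c) = 1"
    using padic_abs_Fract[of "CARD('p)" c 1] assms by (simp add: not_dvd_imp_multiplicity_0)
  then show ?thesis using norm_of_rat_padic[of "of_int c", where 'p='p] by simp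
qed

lemma norm_padic_of_int_dvd:
  assumes "int CARD('p) dvd c" shows "padic_norm (of_int c :: 'p::prime_card padic) \<le> 1 / real CARD('p)"
proof -
  obtain d where d: "c = int CARD('p) * d" using assms by blast
  have "padic_norm (of_int c :: 'p padic) = padic_norm (padic_p :: 'p padic) * padic_norm (of_int d :: 'p padic)"
    by (simp add: d norm_padic_mult)
  also have "\<dots> \<le> 1 / real CARD('p) * 1"
    unfolding norm_padic_p by (intro mult_left_mono norm_of_int_padic_le_1) simp
  finally show ?thesis by simp
qed

lemma padic_first_digit:
  assumes x: "padic_norm (x :: 'p::prime_card padic) \<le> 1"
  shows "\<exists>c<CARD('p). padic_norm (x - of_nat c) \<le> 1 / real CARD('p)"
proof -
  let ?p = "CARD('p)"
  obtain r where r: "padic_norm (x - of_rat r) < 1" using padic_rat_approx[of 1 x] by auto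
  obtain a b where ab: "b > 0" "r = of_int a / of_int b" "coprime a b" by (rule rat_eq_frac)
  have nr: "padic_norm (of_rat r :: 'p padic) \<le> 1"
    using norm_padic_diff_le_max[of x "x - of_rat r"] x r by auto
  have P: "real ?p > 1" by (rule real_card_gt_1)
  have b: "\<not> int ?p dvd b"
  proof
    assume d: "int ?p dvd b"
    then have "\<not> int ?p dvd a"
      using ab(3) by (metis coprime_common_divisor not_prime_unit prime_card prime_nat_int_transfer)
    then have a: "padic_norm (of_int a :: 'p padic) = 1" by (rule norm_padic_of_int_eq_1)
    have bb: "padic_norm (of_int b :: 'p padic) < 1"
      using norm_padic_of_int_dvd[OF d] P by (smt (verit) divide_less_eq_1)
    have "of_rat r * of_int b = (of_int a :: 'p padic)" using ab by (simp add: of_rat_divide)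
    then have "padic_norm (of_rat r :: 'p padic) * padic_norm (of_int b :: 'p padic) = 1"
      using a by (simp flip: norm_padic_mult)
    moreover have "padic_norm (of_rat r :: 'p padic) * padic_norm (of_int b :: 'p padic) \<le> 1 * padic_norm (of_int b :: 'p padic)"
      using nr by (intro mult_right_mono) auto
    ultimately show False using bb by linarith
  qed
  have "coprime b (int ?p)"
    using b by (metis coprime_commute prime_card prime_imp_coprime prime_nat_int_transfer)
  then obtain u v where uv: "u * b + v * int ?p = 1"
    using bezout_int[of b "int ?p"] by auto
  define c where "c = nat ((a * u) mod int ?p)"
  have c: "int c = (a * u) mod int ?p" by (simp add: c_def)
  have "c < ?p" using c by (metis card_pos of_nat_0_less_iff of_nat_less_iff pos_mod_bound)
  have "int ?p dvd a * u - int c" unfolding c by (simp add: dvd_minus_mod)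
  then have "int ?p dvd (a * u - int c) * b + a * v * int ?p" by simp
  moreover have "(a * u - int c) * b + a * v * int ?p = a * (u * b + v * int ?p) - int c * b"
    by (simp add: algebra_simps)
  ultimately have "int ?p dvd a - int c * b" by (simp add: uv)
  then have 1: "padic_norm (of_int (a - int c * b) :: 'p padic) \<le> 1 / real ?p" by (rule norm_padic_of_int_dvd)
  have "(of_rat r - of_nat c) * of_int b = (of_int (a - int c * b) :: 'p padic)"
    using ab by (simp add: of_rat_divide algebra_simps)
  then have "padic_norm (of_rat r - of_nat c :: 'p padic) = padic_norm (of_int (a - int c * b) :: 'p padic)"
    using norm_padic_of_int_eq_1[OF b] by (metis mult.right_neutral norm_padic_mult)
  then have 2: "padic_norm (of_rat r - of_nat c :: 'p padic) \<le> 1 / real ?p" using 1 by simp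
  have 3: "padic_norm (x - of_rat r) \<le> 1 / real ?p"
    using norm_padic_less_iff[of "x - of_rat r" 0] r by (simp add: inverse_eq_divide)
  have "padic_norm (x - of_nat c) \<le> 1 / real ?p"
    using norm_padic_add_le_max[of "x - of_rat r" "of_rat r - of_nat c"] 2 3 by simp
  then show ?thesis using \<open>c < ?p\<close> by blast
qed

lemma padic_p_neq_0 [simp]: "(padic_p :: 'p::prime_card padic) \<noteq> 0"
  by simp

lemma padic_next_digit:
  assumes x: "padic_norm (x :: 'p::prime_card padic) \<le> real CARD('p) powi (- k)"
  shows "\<exists>c<CARD('p). padic_norm (x - of_nat c * padic_p powi k) \<le> real CARD('p) powi (- (k + 1))"
proof -
  have pos: "real CARD('p) powi (- k) > 0" by (simp add: power_int_def)
  have "padic_norm (x / padic_p powi k) \<le> 1"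
    using x pos by (simp add: norm_padic_divide norm_padic_p_powi)
  then obtain c where c: "c < CARD('p)" "padic_norm (x / padic_p powi k - of_nat c) \<le> 1 / real CARD('p)"
    using padic_first_digit by blast
  have "padic_norm (x - of_nat c * padic_p powi k) = padic_norm ((x / padic_p powi k - of_nat c) * padic_p powi k)"
    by (simp add: left_diff_distrib)
  also have "\<dots> \<le> 1 / real CARD('p) * real CARD('p) powi (- k)"
    unfolding norm_padic_mult norm_padic_p_powi using c pos by (intro mult_right_mono) auto
  also have "\<dots> = real CARD('p) powi (- 1 + - k)"
    by (subst power_int_add) (simp_all add: inverse_eq_divide)
  also have "- 1 + - k = - (k + 1)" by simp
  finally show ?thesis using c by blast
qed

section \<open>Digits, the additive character, and the quotient by the p-adic integers\<close>

definition padic_expansion :: "(int \<Rightarrow> nat) \<Rightarrow> 'p::prime_card padic \<Rightarrow> bool" where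
  "padic_expansion a x \<longleftrightarrow> (\<forall>k. a k < CARD('p)) \<and> (\<exists>N. \<forall>k<N. a k = 0) \<and>
     (\<lambda>n. \<Sum>k\<in>{- int n..int n}. of_nat (a k) * padic_p powi k) \<longlonglongrightarrow> x"

definition trunc_sum :: "(int \<Rightarrow> nat) \<Rightarrow> int \<Rightarrow> 'p::prime_card padic" where
  "trunc_sum a n = (\<Sum>k\<in>{k. k < n \<and> a k \<noteq> 0}. of_nat (a k) * padic_p powi k)"

lemma finite_digits_below:
  assumes "\<exists>N. \<forall>k<N. a k = (0::nat)" shows "finite {k::int. k < n \<and> a k \<noteq> 0}"
proof -
  obtain N where "\<forall>k<N. a k = 0" using assms by blast
  then have "{k. k < n \<and> a k \<noteq> 0} \<subseteq> {N..n}" by (auto simp: not_less[symmetric])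
  then show ?thesis by (rule finite_subset) simp
qed

lemma trunc_sum_interval:
  assumes "\<forall>k<N. a k = 0"
  shows "trunc_sum a n = (\<Sum>k\<in>{N..<n}. of_nat (a k) * padic_p powi k :: 'p::prime_card padic)"
  unfolding trunc_sum_def
  by (rule sum.mono_neutral_left) (use assms in \<open>auto simp: not_less[symmetric]\<close>)

lemma norm_digit_term_le: "padic_norm (of_nat c * padic_p powi k :: 'p::prime_card padic) \<le> real CARD('p) powi (- k)"
  using mult_right_mono[OF norm_of_nat_padic_le_1, of "real CARD('p) powi (- k)" c]
  by (simp only: norm_padic_mult norm_padic_p_powi) simp

lemma LIMSEQ_norm_padic_le:
  assumes "f \<longlonglongrightarrow> (x :: 'p::prime_card padic)" "eventually (\<lambda>n. padic_norm (f n - t) \<le> B) sequentially"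
  shows "padic_norm (x - t) \<le> B"
proof -
  have "(\<lambda>n. dist (f n) t) \<longlonglongrightarrow> dist x t" using assms(1) by (intro tendsto_intros)
  then show ?thesis using assms(2) unfolding dist_padic_def by (rule tendsto_upperbound) simp
qed

lemma padic_expansion_trunc:
  assumes "padic_expansion a (x :: 'p::prime_card padic)"
  shows "padic_norm (x - trunc_sum a n) \<le> real CARD('p) powi (- n)"
proof (rule LIMSEQ_norm_padic_le)
  show "(\<lambda>n. \<Sum>k\<in>{- int n..int n}. of_nat (a k) * padic_p powi k) \<longlonglongrightarrow> x"
    using assms by (simp add: padic_expansion_def)
  obtain N where N: "\<forall>k<N. a k = 0" using assms unfolding padic_expansion_def by blast
  have "padic_norm ((\<Sum>k\<in>{- int m..int m}. of_nat (a k) * padic_p powi k) - trunc_sum a n :: 'p padic)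
          \<le> real CARD('p) powi (- n)"
    if m: "m \<ge> nat (max \<bar>N\<bar> \<bar>n\<bar>)" for m
  proof -
    have N': "\<forall>k<(- int m). a k = 0" using N m by auto
    have "(\<Sum>k\<in>{- int m..int m}. of_nat (a k) * padic_p powi k)
        = (\<Sum>k\<in>{- int m..<n}. of_nat (a k) * padic_p powi k) + (\<Sum>k\<in>{n..int m}. of_nat (a k) * padic_p powi k :: 'p padic)"
      by (subst sum.union_disjoint[symmetric]) (use m in \<open>auto intro!: sum.cong\<close>)
    moreover have "padic_norm (\<Sum>k\<in>{n..int m}. of_nat (a k) * padic_p powi k :: 'p padic) \<le> real CARD('p) powi (- n)"
    proof (rule norm_padic_sum_le)
      fix i assume "i \<in> {n..int m}"
      then have "real CARD('p) powi (- i) \<le> real CARD('p) powi (- n)"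
        by (simp only: powi_le_iff[OF real_card_gt_1]) simp
      then show "padic_norm (of_nat (a i) * padic_p powi i :: 'p padic) \<le> real CARD('p) powi (- n)"
        by (rule order.trans[OF norm_digit_term_le])
    qed simp_all
    ultimately show ?thesis
      unfolding trunc_sum_interval[OF N'] by (simp only: add_diff_cancel_left')
  qed
  note bound = this
  show "\<forall>\<^sub>F m in sequentially. padic_norm ((\<Sum>k\<in>{- int m..int m}. of_nat (a k) * padic_p powi k) - trunc_sum a n :: 'p padic)
          \<le> real CARD('p) powi (- n)"
    unfolding eventually_sequentially by (intro exI allI impI) (rule bound)
qed

lemma powi_LIMSEQ_0: "(\<lambda>n. real CARD('p::prime_card) powi (- int n)) \<longlonglongrightarrow> 0"
proof -
  have "(\<lambda>n. inverse (real CARD('p) ^ n)) \<longlonglongrightarrow> 0" by (rule LIMSEQ_inverse_realpow_zero) (rule real_card_gt_1)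
  then show ?thesis by (simp add: power_int_minus)
qed

lemma padic_expansionI:
  assumes "\<And>k. a k < CARD('p)" "\<forall>k<N. a k = 0"
    and trunc: "\<And>n. n \<ge> N \<Longrightarrow> padic_norm (x - trunc_sum a n) \<le> real CARD('p) powi (- n)"
  shows "padic_expansion a (x :: 'p::prime_card padic)"
proof -
  have "(\<lambda>n. \<Sum>k\<in>{- int n..int n}. of_nat (a k) * padic_p powi k) \<longlonglongrightarrow> x"
    unfolding tendsto_dist_iff[of _ x]
  proof (rule Lim_null_comparison[OF _ powi_LIMSEQ_0])
    have "dist (\<Sum>k\<in>{- int m..int m}. of_nat (a k) * padic_p powi k) x \<le> real CARD('p) powi (- int m)"
      if m: "m \<ge> nat \<bar>N\<bar>" for m
    proof -
      have N': "\<forall>k<(- int m). a k = 0" using assms(2) m by auto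
      have "{- int m..int m} = {- int m..<int m + 1}" by auto
      then have "dist (\<Sum>k\<in>{- int m..int m}. of_nat (a k) * padic_p powi k) x \<le> real CARD('p) powi (- (int m + 1))"
        using trunc[of "int m + 1"] m by (simp add: dist_padic_def norm_padic_minus_commute[of x] trunc_sum_interval[OF N'])
      also have "\<dots> \<le> real CARD('p) powi (- int m)"
        by (intro power_int_increasing less_imp_le[OF real_card_gt_1]) simp
      finally show ?thesis .
    qed
    then show "\<forall>\<^sub>F n in sequentially. norm (dist (\<Sum>k\<in>{- int n..int n}. of_nat (a k) * padic_p powi k) x)
        \<le> real CARD('p) powi (- int n)"
      unfolding eventually_sequentially by auto
  qed
  then show ?thesis using assms(1,2) unfolding padic_expansion_def by blast
qed

lemma padic_expansion_ex: "\<exists>a. padic_expansion a (x :: 'p::prime_card padic)"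
proof -
  let ?P = "real CARD('p)"
  obtain M where M: "padic_norm x \<le> ?P powi (- M)"
  proof (cases "x = 0")
    case False
    then obtain k where "padic_norm x = ?P powi k" using norm_padic_discrete by blast
    then show thesis using that[of "- k"] by simp
  qed (use that[of 0] in simp)
  define c where "c n y = (SOME c.  c < CARD('p) \<and>
      padic_norm (y - of_nat c * padic_p powi (M + int n)) \<le> ?P powi (- (M + int n + 1)))" for n and y :: "'p padic"
  define R where "R = rec_nat x (\<lambda>n y. y - of_nat (c n y) * padic_p powi (M + int n))"
  have R0: "R 0 = x" and RS: "R (Suc n) = R n - of_nat (c n (R n)) * padic_p powi (M + int n)" for n
    by (simp_all add: R_def)
  have c: "c n y < CARD('p)" "padic_norm (y - of_nat (c n y) * padic_p powi (M + int n)) \<le> ?P powi (- (M + int n + 1))"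
    if "padic_norm y \<le> ?P powi (- (M + int n))" for n y
    using someI_ex[OF padic_next_digit[OF that]] unfolding c_def by auto
  have R: "padic_norm (R n) \<le> ?P powi (- (M + int n))" for n
  proof (induction n)
    case (Suc n)
    then show ?case using c(2)[OF Suc] by (simp add: RS add_ac)
  qed (use M in \<open>simp add: R0\<close>)
  define a where "a k = (if k < M then 0 else c (nat (k - M)) (R (nat (k - M))))" for k
  have sumR: "x - R n = (\<Sum>k\<in>{M..<M + int n}. of_nat (a k) * padic_p powi k)" for n
  proof (induction n)
    case (Suc n)
    have "{M..<M + int (Suc n)} = insert (M + int n) {M..<M + int n}" by auto
    then show ?case using Suc by (simp add: RS a_def algebra_simps)
  qed (simp add: R0)
  have "padic_expansion a x"
  proof (rule padic_expansionI)
    show "a k < CARD('p)" for k using c(1)[OF R] by (simp add: a_def)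
    show a0: "\<forall>k<M. a k = 0" by (simp add: a_def)
    fix n assume "n \<ge> M"
    then have n: "n = M + int (nat (n - M))" by simp
    show "padic_norm (x - trunc_sum a n) \<le> ?P powi (- n)"
      using R[of "nat (n - M)"] sumR[of "nat (n - M)"] n
      unfolding trunc_sum_interval[OF a0] by (metis diff_diff_eq2 add_diff_cancel_left' diff_add_cancel)
  qed
  then show ?thesis by blast
qed

lemma padic_expansion_agree:
  assumes a: "padic_expansion a (x :: 'p::prime_card padic)" and b: "padic_expansion b y"
  shows "padic_norm (x - y) \<le> real CARD('p) powi (- n) \<longleftrightarrow> (\<forall>k<n. a k = b k)"
proof
  assume eq: "\<forall>k<n. a k = b k"
  then have "{k. k < n \<and> a k \<noteq> 0} = {k. k < n \<and> b k \<noteq> 0}" by auto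
  then have "trunc_sum a n = (trunc_sum b n :: 'p padic)"
    unfolding trunc_sum_def using eq by (intro sum.cong) auto
  then show "padic_norm (x - y) \<le> real CARD('p) powi (- n)"
    using norm_padic_diff_le_max[of "x - trunc_sum a n" "y - trunc_sum b n"]
      padic_expansion_trunc[OF a, of n] padic_expansion_trunc[OF b, of n] by simp
next
  let ?P = "real CARD('p)"
  assume le: "padic_norm (x - y) \<le> ?P powi (- n)"
  show "\<forall>k<n. a k = b k"
  proof (rule ccontr)
    assume "\<not> ?thesis"
    then obtain k0 where k0: "k0 < n" "a k0 \<noteq> b k0" by blast
    obtain N1 N2 where "\<forall>k<N1. a k = 0" "\<forall>k<N2. b k = 0" using a b unfolding padic_expansion_def by blast
    then have Na: "\<forall>k<min N1 N2. a k = 0" and Nb: "\<forall>k<min N1 N2. b k = 0" by auto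
    define N where "N = min N1 N2"
    define j where "j = (LEAST j. a (N + int j) \<noteq> b (N + int j))"
    have "N \<le> k0" using Na Nb k0 unfolding N_def by (metis linorder_not_le)
    then have k0': "a (N + int (nat (k0 - N))) \<noteq> b (N + int (nat (k0 - N)))" using k0 by simp
    define k where "k = N + int j"
    have ne: "a k \<noteq> b k" unfolding k_def j_def by (rule LeastI[of _ "nat (k0 - N)"]) (rule k0')
    have "j \<le> nat (k0 - N)" unfolding j_def by (rule Least_le) (rule k0')
    then have kn: "k < n" using k0 \<open>N \<le> k0\<close> by (simp add: k_def)
    have eq: "a i = b i" if "i < k" for i
    proof (cases "i < N")
      case False
      then have "nat (i - N) < j" using that by (simp add: k_def)
      then show ?thesis using not_less_Least[of "nat (i - N)" "\<lambda>j. a (N + int j) \<noteq> b (N + int j)"] False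
        by (simp add: j_def)
    qed (use Na Nb N_def in auto)
    have ins: "{N..<k + 1} = insert k {N..<k}" using k_def by auto
    have "trunc_sum a (k + 1) - trunc_sum b (k + 1) = (of_nat (a k) * padic_p powi k - of_nat (b k) * padic_p powi k :: 'p padic)"
      using eq trunc_sum_interval[OF Na[folded N_def], of "k + 1", where 'p='p]
        trunc_sum_interval[OF Nb[folded N_def], of "k + 1", where 'p='p]
      by (simp add: ins)
    also have "\<dots> = of_int (int (a k) - int (b k)) * padic_p powi k" by (simp add: left_diff_distrib)
    finally have t: "trunc_sum a (k + 1) - trunc_sum b (k + 1) = (of_int (int (a k) - int (b k)) * padic_p powi k :: 'p padic)" .
    have "\<bar>int (a k) - int (b k)\<bar> < int CARD('p)" "int (a k) - int (b k) \<noteq> 0"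
      using a b ne unfolding padic_expansion_def by (auto simp: abs_if) (smt (verit) of_nat_0_le_iff of_nat_less_iff)+
    then have "\<not> int CARD('p) dvd (int (a k) - int (b k))" by (metis dvd_imp_le_int abs_of_nat linorder_not_le)
    then have "padic_norm (of_int (int (a k) - int (b k)) * padic_p powi k :: 'p padic) = ?P powi (- k)"
      unfolding norm_padic_mult norm_padic_p_powi by (subst norm_padic_of_int_eq_1) simp_all
    then have nt: "padic_norm (trunc_sum a (k + 1) - trunc_sum b (k + 1) :: 'p padic) = ?P powi (- k)" by (simp only: t)
    have "padic_norm ((x - trunc_sum a (k + 1)) - (y - trunc_sum b (k + 1))) \<le> ?P powi (- (k + 1))"
      using norm_padic_diff_le_max[of "x - trunc_sum a (k + 1)" "y - trunc_sum b (k + 1)"]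
        padic_expansion_trunc[OF a, of "k + 1"] padic_expansion_trunc[OF b, of "k + 1"] by simp
    also have "\<dots> < ?P powi (- k)" by (simp only: powi_less_iff[OF real_card_gt_1])
    finally have "padic_norm ((trunc_sum a (k + 1) - trunc_sum b (k + 1)) + ((x - trunc_sum a (k + 1)) - (y - trunc_sum b (k + 1))))
        = ?P powi (- k)"
      using norm_padic_add_eq[of "(x - trunc_sum a (k + 1)) - (y - trunc_sum b (k + 1))" "trunc_sum a (k + 1) - trunc_sum b (k + 1)"]
      unfolding nt by simp
    then have "padic_norm (x - y) = ?P powi (- k)" by (simp add: algebra_simps)
    then have "- k \<le> - n" using le by (simp only: powi_le_iff[OF real_card_gt_1])
    then show False using kn by simp
  qed
qed

lemma padic_expansion_unique:
  assumes "padic_expansion a (x :: 'p::prime_card padic)" "padic_expansion b x"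
  shows "a = b"
proof
  fix k
  have "padic_norm (x - x) \<le> real CARD('p) powi (- (k + 1))" by (simp add: power_int_def)
  then show "a k = b k" unfolding padic_expansion_agree[OF assms] by simp
qed

definition padic_digit :: "'p::prime_card padic \<Rightarrow> int \<Rightarrow> nat" where
  "padic_digit x = (THE a. padic_expansion a x)"

lemma padic_expansion_digit: "padic_expansion (padic_digit x) (x :: 'p::prime_card padic)"
proof -
  obtain a where a: "padic_expansion a x" using padic_expansion_ex by blast
  then have "padic_digit x = a"
    unfolding padic_digit_def by (intro the_equality padic_expansion_unique[OF _ a])
  then show ?thesis using a by simp
qed

lemma padic_digit_less: "padic_digit (x :: 'p::prime_card padic) k < CARD('p)"
  using padic_expansion_digit[of x] by (simp add: padic_expansion_def)

lemma padic_digit_agree: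
  "padic_norm (x - y :: 'p::prime_card padic) \<le> real CARD('p) powi (- n) \<longleftrightarrow> (\<forall>k<n. padic_digit x k = padic_digit y k)"
  by (rule padic_expansion_agree[OF padic_expansion_digit padic_expansion_digit])

text \<open>The sum is over the nonzero digits with negative index, hence finite.\<close>

definition padic_frac :: "'p::prime_card padic \<Rightarrow> real" where
  "padic_frac x = (\<Sum>k\<in>{k. k < 0 \<and> padic_digit x k \<noteq> 0}. real (padic_digit x k) * real CARD('p) powi k)"

definition padic_char :: "'p::prime_card padic \<Rightarrow> complex" where
  "padic_char x = exp (2 * of_real pi * \<i> * of_real (padic_frac x))"

definition padic_ints :: "'p::prime_card padic set" where
  "padic_ints = {x. padic_norm x \<le> 1}"

definition mod_zp_rel :: "'p::prime_card padic \<Rightarrow> 'p padic \<Rightarrow> bool" where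
  "mod_zp_rel x y \<longleftrightarrow> x - y \<in> padic_ints"

lemma padic_ints_0: "0 \<in> padic_ints" by (simp add: padic_ints_def)
lemma padic_ints_add: "x \<in> padic_ints \<Longrightarrow> y \<in> padic_ints \<Longrightarrow> x + y \<in> padic_ints"
  unfolding padic_ints_def using norm_padic_add_le_max[of x y] by simp
lemma padic_ints_minus: "- x \<in> padic_ints \<longleftrightarrow> x \<in> padic_ints"
  by (simp add: padic_ints_def)

quotient_type 'p qp_mod_zp = "'p::prime_card padic" / mod_zp_rel
proof (rule equivpI)
  show "reflp (mod_zp_rel :: 'p padic \<Rightarrow> _)" by (simp add: reflp_def mod_zp_rel_def padic_ints_0)
  show "symp (mod_zp_rel :: 'p padic \<Rightarrow> _)" unfolding symp_def mod_zp_rel_def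
    by (metis minus_diff_eq padic_ints_minus)
  show "transp (mod_zp_rel :: 'p padic \<Rightarrow> _)" unfolding transp_def mod_zp_rel_def
    by (metis diff_add_cancel add_diff_eq padic_ints_add)
qed

instantiation qp_mod_zp :: (prime_card) ab_group_add
begin
lift_definition zero_qp_mod_zp :: "'a qp_mod_zp" is 0 .
lift_definition plus_qp_mod_zp :: "'a qp_mod_zp \<Rightarrow> 'a qp_mod_zp \<Rightarrow> 'a qp_mod_zp" is "(+)"
  unfolding mod_zp_rel_def by (metis add_diff_add padic_ints_add)
lift_definition uminus_qp_mod_zp :: "'a qp_mod_zp \<Rightarrow> 'a qp_mod_zp" is uminus
  unfolding mod_zp_rel_def by (metis minus_diff_minus padic_ints_minus)
lift_definition minus_qp_mod_zp :: "'a qp_mod_zp \<Rightarrow> 'a qp_mod_zp \<Rightarrow> 'a qp_mod_zp" is "(-)"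
proof -
  fix a b c d :: "'a padic"
  assume "mod_zp_rel a b" "mod_zp_rel c d"
  then have "(a - b) + - (c - d) \<in> padic_ints"
    unfolding mod_zp_rel_def by (intro padic_ints_add) (simp_all only: padic_ints_minus)
  then show "mod_zp_rel (a - c) (b - d)" by (simp add: mod_zp_rel_def algebra_simps)
qed
instance
proof
  fix a b c :: "'a qp_mod_zp"
  show "a + b + c = a + (b + c)" by transfer (simp add: mod_zp_rel_def padic_ints_0 algebra_simps)
  show "a + b = b + a" by transfer (simp add: mod_zp_rel_def padic_ints_0 algebra_simps)
  show "0 + a = a" by transfer (simp add: mod_zp_rel_def padic_ints_0)
  show "- a + a = 0" by transfer (simp add: mod_zp_rel_def padic_ints_0)
  show "a - b = a + - b" by transfer (simp add: mod_zp_rel_def padic_ints_0)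
qed
end

instance qp_mod_zp :: (prime_card) countable
proof
  have ex: "\<exists>r. abs_qp_mod_zp (of_rat r) = g" for g :: "'a qp_mod_zp"
  proof transfer
    fix x :: "'a padic"
    obtain r where "padic_norm (x - of_rat r) < 1" using padic_rat_approx[of 1 x] by auto
    then show "\<exists>r. mod_zp_rel (of_rat r) x"
      unfolding mod_zp_rel_def padic_ints_def by (intro exI[of _ r]) (simp add: norm_padic_minus_commute[of x])
  qed
  then obtain f where "\<And>g :: 'a qp_mod_zp. abs_qp_mod_zp (of_rat (f g)) = g" by metis
  then have "inj f" by (metis injI)
  then show "\<exists>f :: 'a qp_mod_zp \<Rightarrow> nat. inj f"
    by (intro exI[of _ "to_nat \<circ> f"] inj_compose inj_to_nat)
qed

text \<open>The map \<open>\<Gamma>\<^sub>m\<close>. The index set is finite because the digits vanish for sufficiently negative index.\<close>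

lift_definition scaling_map :: "nat \<Rightarrow> 'p::prime_card qp_mod_zp \<Rightarrow> 'p padic" is
  "\<lambda>m x. \<Sum>k\<in>{k. k < int m \<and> padic_digit (padic_p ^ m * x) k \<noteq> 0}.
           of_nat (padic_digit (padic_p ^ m * x) k) * padic_p powi k"
proof -
  fix m and x y :: "'p padic" assume "mod_zp_rel x y"
  then have "padic_norm (padic_p ^ m :: 'p padic) * padic_norm (x - y) \<le> real CARD('p) powi (- int m) * 1"
    unfolding mod_zp_rel_def padic_ints_def
    by (intro mult_mono) (simp_all add: norm_padic_power norm_padic_p power_int_minus power_one_over inverse_eq_divide)
  then have "padic_norm (padic_p ^ m * x - padic_p ^ m * y) \<le> real CARD('p) powi (- int m)"
    by (simp flip: norm_padic_mult right_diff_distrib)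
  then have eq: "padic_digit (padic_p ^ m * x) k = padic_digit (padic_p ^ m * y) k" if "k < int m" for k
    using that by (simp add: padic_digit_agree)
  then have "{k. k < int m \<and> padic_digit (padic_p ^ m * x) k \<noteq> 0} = {k. k < int m \<and> padic_digit (padic_p ^ m * y) k \<noteq> 0}"
    by auto
  then show "(\<Sum>k\<in>{k. k < int m \<and> padic_digit (padic_p ^ m * x) k \<noteq> 0}. of_nat (padic_digit (padic_p ^ m * x) k) * padic_p powi k) =
     (\<Sum>k\<in>{k. k < int m \<and> padic_digit (padic_p ^ m * y) k \<noteq> 0}. of_nat (padic_digit (padic_p ^ m * y) k) * padic_p powi k)"
    using eq by (intro sum.cong) auto
qed

section \<open>Haar measure\<close>

definition pball :: "'p::prime_card padic \<Rightarrow> int \<Rightarrow> 'p padic set" where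
  "pball x n = {y. padic_norm (y - x) \<le> real CARD('p) powi (- n)}"

lemma pball_self: "x \<in> pball x n" by (simp add: pball_def)

lemma pball_sub: "z \<in> pball x n \<Longrightarrow> n \<le> m \<Longrightarrow> pball z m \<subseteq> pball (x :: 'p::prime_card padic) n"
proof
  fix y assume z: "z \<in> pball x n" and nm: "n \<le> m" and y: "y \<in> pball z m"
  have "real CARD('p) powi (- m) \<le> real CARD('p) powi (- n)"
    using nm by (simp only: powi_le_iff[OF real_card_gt_1])
  then have "padic_norm ((y - z) + (z - x)) \<le> real CARD('p) powi (- n)"
    using z y norm_padic_add_le_max[of "y - z" "z - x"] unfolding pball_def by simp
  then show "y \<in> pball x n" by (simp add: pball_def)
qed

lemma pball_eq: "z \<in> pball x n \<Longrightarrow> pball z n = pball x n"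
  using pball_sub[of z x n n] pball_sub[of x z n n]
  by (auto simp: pball_def norm_padic_minus_commute)

lemma pball_in_ball:
  assumes "e > 0" shows "\<exists>n. pball (x :: 'p::prime_card padic) n \<subseteq> ball x e"
proof -
  obtain n where "real CARD('p) powi (- int n) < e"
    using order_tendstoD(2)[OF powi_LIMSEQ_0[where 'p='p] assms] by (auto simp: eventually_sequentially)
  then have "pball x (int n) \<subseteq> ball x e"
    by (auto simp: pball_def dist_padic_def norm_padic_minus_commute[of x])
  then show ?thesis by blast
qed

lemma open_pball: "open (pball (x :: 'p::prime_card padic) n)"
  unfolding open_contains_ball
proof
  fix z assume z: "z \<in> pball x n"
  have "ball z (real CARD('p) powi (- n)) \<subseteq> pball z n"
    by (auto simp: pball_def dist_padic_def norm_padic_minus_commute[of z])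
  then show "\<exists>e>0. ball z e \<subseteq> pball x n"
    unfolding pball_eq[OF z] by (intro exI[of _ "real CARD('p) powi (- n)"]) simp
qed

lemma topological_basis_pball:
  "topological_basis (range (\<lambda>(r, n). pball (of_rat r :: 'p::prime_card padic) n))"
proof (rule topological_basisI)
  fix U :: "'p padic set" and x assume U: "open U" "x \<in> U"
  then obtain e where e: "e > 0" "ball x e \<subseteq> U" by (auto simp: open_contains_ball)
  obtain n where n: "pball x n \<subseteq> ball x e" using pball_in_ball[OF e(1)] by blast
  obtain r where r: "padic_norm (x - of_rat r) < real CARD('p) powi (- n)"
    using padic_rat_approx[of "real CARD('p) powi (- n)" x] by auto
  then have x: "x \<in> pball (of_rat r) n" by (simp add: pball_def)
  show "\<exists>V\<in>range (\<lambda>(r, n). pball (of_rat r :: 'p padic) n). x \<in> V \<and> V \<subseteq> U"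
  proof (rule bexI[of _ "pball (of_rat r) n"])
    show "x \<in> pball (of_rat r) n \<and> pball (of_rat r) n \<subseteq> U"
      using pball_eq[OF x] x n e by blast
  qed auto
qed (auto intro: open_pball)

lemma borel_pball: "(borel :: 'p::prime_card padic measure) = sigma UNIV (insert {} (range (\<lambda>(x, n). pball x n)))"
proof -
  have "(borel :: 'p padic measure) = sigma UNIV (range (\<lambda>(r, n). pball (of_rat r) n))"
    by (rule borel_eq_countable_basis[OF _ topological_basis_pball]) simp
  also have "\<dots> = sigma UNIV (insert {} (range (\<lambda>(x, n). pball x n)))"
  proof (rule sigma_eqI)
    let ?A = "range (\<lambda>(r, n). pball (of_rat r :: 'p padic) n)" and ?B = "insert {} (range (\<lambda>(x :: 'p padic, n). pball x n))"
    have "sigma_sets UNIV ?B \<subseteq> sets (borel :: 'p padic measure)"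
      by (intro sets.sigma_sets_subset[where M=borel, simplified]) (auto intro: open_pball borel_open)
    also have "\<dots> = sigma_sets UNIV ?A"
      using arg_cong[OF borel_eq_countable_basis[OF _ topological_basis_pball[where 'p='p]], of sets] by simp
    finally have "sigma_sets UNIV ?B \<subseteq> sigma_sets UNIV ?A" .
    moreover have "sigma_sets UNIV ?A \<subseteq> sigma_sets UNIV ?B"
      by (rule sigma_sets_mono') auto
    ultimately show "sigma_sets UNIV ?A = sigma_sets UNIV ?B" by (rule antisym[rotated])
  qed auto
  finally show ?thesis .
qed

lemma Int_stable_pball: "Int_stable (insert {} (range (\<lambda>(x, n). pball (x :: 'p::prime_card padic) n)))"
proof (rule Int_stableI)
  have int: "pball x n \<inter> pball y m \<in> insert {} (range (\<lambda>(x, n). pball (x :: 'p padic) n))" for x y n m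
  proof (cases "pball x n \<inter> pball y m = {}")
    case False
    then obtain z where z: "z \<in> pball x n" "z \<in> pball y m" by blast
    then have eq: "pball x n = pball z n" "pball y m = pball z m" by (simp_all only: pball_eq)
    have "pball z n \<inter> pball z m = pball z (max n m)"
    proof (cases "n \<le> m")
      case True
      then show ?thesis using pball_sub[OF pball_self True, of z] by (simp add: max_def Int_absorb1)
    next
      case False
      then have mn: "m \<le> n" by simp
      show ?thesis using pball_sub[OF pball_self mn, of z] False by (simp add: max_def Int_absorb2)
    qed
    then show ?thesis unfolding eq by (intro insertI2) (auto intro!: image_eqI[of _ _ "(z, max n m)"])
  qed auto
  fix A B assume "A \<in> insert {} (range (\<lambda>(x, n). pball (x :: 'p padic) n))" "B \<in> insert {} (range (\<lambda>(x, n). pball (x :: 'p padic) n))"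
  then consider "A \<inter> B = {}" | x n y m where "A = pball x n" "B = pball y m" by auto
  then show "A \<inter> B \<in> insert {} (range (\<lambda>(x, n). pball (x :: 'p padic) n))"
    by cases (simp, simp only: int)
qed

lemma padic_expansion_exists_sum:
  assumes a: "\<And>k. a k < CARD('p)" "\<forall>k<N. a k = 0"
  shows "\<exists>x :: 'p::prime_card padic. padic_expansion a x"
proof -
  define S where "S n = (\<Sum>k\<in>{N..<N + int n}. of_nat (a k) * padic_p powi k :: 'p padic)" for n
  have diff: "padic_norm (S m - S n) \<le> real CARD('p) powi (- (N + int n))" if "m \<ge> n" for m n
  proof -
    have "{N..<N + int m} = {N..<N + int n} \<union> {N + int n..<N + int m}" using that by auto
    then have "S m = S n + (\<Sum>k\<in>{N + int n..<N + int m}. of_nat (a k) * padic_p powi k)"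
      unfolding S_def by (simp only: sum.union_disjoint[OF finite_atLeastLessThan_int finite_atLeastLessThan_int] ivl_disj_int)
    then have "S m - S n = (\<Sum>k\<in>{N + int n..<N + int m}. of_nat (a k) * padic_p powi k)" by simp
    also have "padic_norm \<dots> \<le> real CARD('p) powi (- (N + int n))"
    proof (rule norm_padic_sum_le)
      fix i assume "i \<in> {N + int n..<N + int m}"
      then have "real CARD('p) powi (- i) \<le> real CARD('p) powi (- (N + int n))"
        by (simp only: powi_le_iff[OF real_card_gt_1]) simp
      then show "padic_norm (of_nat (a i) * padic_p powi i :: 'p padic) \<le> real CARD('p) powi (- (N + int n))"
        by (rule order.trans[OF norm_digit_term_le])
    qed simp_all
    finally show ?thesis .
  qed
  have lim: "(\<lambda>n. real CARD('p) powi (- (N + int n))) \<longlonglongrightarrow> 0"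
    using tendsto_mult[OF tendsto_const[of "real CARD('p) powi (- N)"] powi_LIMSEQ_0[where 'p='p]]
    by (simp add: power_int_diff power_int_minus field_simps)
  have "Cauchy S"
  proof (rule metric_CauchyI)
    fix e :: real assume "e > 0"
    then obtain M where M: "real CARD('p) powi (- (N + int M)) < e"
      using order_tendstoD(2)[OF lim] by (auto simp: eventually_sequentially)
    have "dist (S m) (S n) < e" if "m \<ge> M" "n \<ge> M" for m n
      using diff[OF that(1)] diff[OF that(2)] M norm_padic_diff_le_max[of "S m - S M" "S n - S M"]
      by (simp add: dist_padic_def)
    then show "\<exists>M. \<forall>m\<ge>M. \<forall>n\<ge>M. dist (S m) (S n) < e" by blast
  qed
  then obtain x where x: "S \<longlonglongrightarrow> x" using Cauchy_convergent convergent_def by blast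
  have "padic_expansion a x"
  proof (rule padic_expansionI[OF a])
    fix n assume n: "n \<ge> N"
    have "padic_norm (x - S (nat (n - N))) \<le> real CARD('p) powi (- (N + int (nat (n - N))))"
      by (rule LIMSEQ_norm_padic_le[OF x eventually_sequentiallyI[of "nat (n - N)"]]) (rule diff)
    then show "padic_norm (x - trunc_sum a n) \<le> real CARD('p) powi (- n)"
      using n unfolding trunc_sum_interval[OF a(2)] S_def by simp
  qed
  then show ?thesis by blast
qed

definition real_digit :: "nat \<Rightarrow> real \<Rightarrow> int \<Rightarrow> nat" where
  "real_digit p u k = nat (\<lfloor>u * real p powi (k + 1)\<rfloor> mod int p)"

lemma floor_real_digit:
  assumes "p > 0"
  shows "\<lfloor>u * real p powi (k + 1)\<rfloor> = int p * \<lfloor>u * real p powi k\<rfloor> + int (real_digit p u k)"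
proof -
  have "u * real p powi k = u * real p powi (k + 1) / real p"
    using assms by (simp add: power_int_add)
  then have "\<lfloor>u * real p powi k\<rfloor> = \<lfloor>u * real p powi (k + 1)\<rfloor> div int p"
    using floor_divide_real_eq_div[of "int p" "u * real p powi (k + 1)"] by simp
  then show ?thesis using assms by (simp add: real_digit_def)
qed

lemma real_digit_less: "p > 0 \<Longrightarrow> real_digit p u k < p"
  by (simp add: real_digit_def nat_less_iff)

lemma floor_powi_low:
  assumes "u \<ge> 0" "p > 1" shows "\<exists>K. \<forall>k\<le>K. \<lfloor>u * real p powi k\<rfloor> = 0"
proof -
  obtain n where n: "u < real p ^ n" using real_arch_pow[of "real p" u] assms by auto
  have "\<lfloor>u * real p powi k\<rfloor> = 0" if "k \<le> - int n" for k
  proof -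
    have "real p powi k \<le> real p powi (- int n)" using that assms by (intro power_int_increasing) auto
    then have "u * real p powi k \<le> u * real p powi (- int n)" using assms by (intro mult_left_mono) auto
    also have "\<dots> < 1" using n assms by (simp add: power_int_minus field_simps)
    finally show ?thesis using assms by (simp add: floor_eq_iff)
  qed
  then show ?thesis by blast
qed

lemma floor_zero_mono:
  assumes "u \<ge> 0" "p > 1" "\<lfloor>u * real p powi n\<rfloor> = 0" "k \<le> n" shows "\<lfloor>u * real p powi k\<rfloor> = 0"
proof -
  have "real p powi k \<le> real p powi n" using assms by (intro power_int_increasing) auto
  then have "u * real p powi k \<le> u * real p powi n" using assms by (intro mult_left_mono) auto
  moreover have "u * real p powi n < 1" using assms by (simp add: floor_eq_iff)
  ultimately show ?thesis using assms by (simp add: floor_eq_iff)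
qed

lemma real_digits_agree:
  assumes u: "u \<ge> 0" and p: "p > 1" and a: "\<And>k. a k < p" "\<forall>k<N. a k = 0"
  shows "\<exists>c\<ge>0. \<forall>u\<ge>0. (\<forall>k<N + int i. real_digit p u k = a k) \<longleftrightarrow> \<lfloor>u * real p powi (N + int i)\<rfloor> = c"
proof (induction i)
  case 0
  have "(\<forall>k<N. real_digit p u k = a k) \<longleftrightarrow> \<lfloor>u * real p powi N\<rfloor> = 0" if u: "u \<ge> 0" for u
  proof
    assume dig: "\<forall>k<N. real_digit p u k = a k"
    obtain K where K: "\<forall>k\<le>K. \<lfloor>u * real p powi k\<rfloor> = 0" using floor_powi_low[OF u p] by blast
    have "k \<le> N \<longrightarrow> \<lfloor>u * real p powi k\<rfloor> = 0" if "k \<ge> min K N" for k using that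
    proof (induction k rule: int_ge_induct)
      case (step k)
      then show ?case using floor_real_digit[of p u k] p dig a(2) by auto
    qed (use K in auto)
    then show "\<lfloor>u * real p powi N\<rfloor> = 0" by auto
  next
    assume "\<lfloor>u * real p powi N\<rfloor> = 0"
    then have "\<lfloor>u * real p powi (k + 1)\<rfloor> = 0" if "k < N" for k
      using floor_zero_mono[OF u p, of N "k + 1"] that by simp
    then show "\<forall>k<N. real_digit p u k = a k" using a(2) by (simp add: real_digit_def)
  qed
  then show ?case by (intro exI[of _ 0]) simp
next
  case (Suc i)
  then obtain c where c: "c \<ge> 0" "\<And>u. u \<ge> 0 \<Longrightarrow> (\<forall>k<N + int i. real_digit p u k = a k) \<longleftrightarrow> \<lfloor>u * real p powi (N + int i)\<rfloor> = c"
    by blast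
  have "(\<forall>k<N + int (Suc i). real_digit p u k = a k) \<longleftrightarrow>
          \<lfloor>u * real p powi (N + int (Suc i))\<rfloor> = int p * c + int (a (N + int i))" if u: "u \<ge> 0" for u
  proof -
    let ?n = "N + int i"
    have Sn: "N + int (Suc i) = ?n + 1" by simp
    have "(\<forall>k<N + int (Suc i). real_digit p u k = a k) \<longleftrightarrow> (\<forall>k<?n. real_digit p u k = a k) \<and> real_digit p u ?n = a ?n"
      unfolding Sn zless_add1_eq by blast
    also have "\<dots> \<longleftrightarrow> \<lfloor>u * real p powi ?n\<rfloor> = c \<and> real_digit p u ?n = a ?n" using c(2)[OF u] by simp
    also have "\<dots> \<longleftrightarrow> int p * \<lfloor>u * real p powi ?n\<rfloor> + int (real_digit p u ?n) = int p * c + int (a ?n)" (is "?l \<longleftrightarrow> ?r")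
    proof
      assume r: ?r
      have "real_digit p u ?n < p" "a ?n < p" using a(1) p real_digit_less[of p u] by auto
      then have "int (real_digit p u ?n) = int (a ?n)"
        using arg_cong[OF r, of "\<lambda>x. x mod int p"] by simp
      then show ?l using r p by simp
    qed simp
    also have "\<dots> \<longleftrightarrow> \<lfloor>u * real p powi (N + int (Suc i))\<rfloor> = int p * c + int (a (N + int i))"
      using floor_real_digit[of p u ?n] p by (simp add: add_ac)
    finally show ?thesis .
  qed
  then show ?case using c(1) by (intro exI[of _ "int p * c + int (a (N + int i))"]) simp
qed

definition digit_reversal :: "real \<Rightarrow> 'p::prime_card padic" where
  "digit_reversal u = (SOME x. padic_expansion (real_digit CARD('p) u) x)"

lemma digit_digit_reversal:
  assumes u: "u \<ge> 0"
  shows "padic_digit (digit_reversal u :: 'p::prime_card padic) = real_digit CARD('p) u"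
proof -
  have p: "CARD('p) > 1" by (rule card_gt_1)
  obtain K where K: "\<forall>k\<le>K. \<lfloor>u * real CARD('p) powi k\<rfloor> = 0" using floor_powi_low[OF u p] by blast
  have "\<exists>x :: 'p padic. padic_expansion (real_digit CARD('p) u) x"
    by (rule padic_expansion_exists_sum[where N=K]) (use K real_digit_less in \<open>auto simp: real_digit_def\<close>)
  then have "padic_expansion (real_digit CARD('p) u) (digit_reversal u :: 'p padic)"
    unfolding digit_reversal_def by (rule someI_ex)
  then show ?thesis using padic_expansion_unique padic_expansion_digit by blast
qed

lemma digit_reversal_vimage_pball:
  "\<exists>c::int. c \<ge> 0 \<and> {u. 0 \<le> u \<and> digit_reversal u \<in> pball (x :: 'p::prime_card padic) n}
     = {of_int c * real CARD('p) powi (- n) ..< (of_int c + 1) * real CARD('p) powi (- n)}"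
proof -
  let ?P = "real CARD('p)"
  have p: "CARD('p) > 1" by (rule card_gt_1)
  obtain N0 where N0: "\<forall>k<N0. padic_digit x k = 0" using padic_expansion_digit[of x] unfolding padic_expansion_def by blast
  define N where "N = min N0 n"
  have N: "\<forall>k<N. padic_digit x k = 0" using N0 by (simp add: N_def)
  have n: "N + int (nat (n - N)) = n" by (simp add: N_def)
  obtain c where c: "c \<ge> 0" "\<forall>u\<ge>0. (\<forall>k<n. real_digit CARD('p) u k = padic_digit x k) \<longleftrightarrow> \<lfloor>u * ?P powi n\<rfloor> = c"
    using real_digits_agree[OF _ p padic_digit_less N, of 0 "nat (n - N)"] unfolding n by auto
  have "{u. 0 \<le> u \<and> digit_reversal u \<in> pball x n} = {u. 0 \<le> u \<and> \<lfloor>u * ?P powi n\<rfloor> = c}"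
    using c(2) by (auto simp: pball_def padic_digit_agree digit_digit_reversal)
  also have "\<dots> = {of_int c * ?P powi (- n) ..< (of_int c + 1) * ?P powi (- n)}"
  proof -
    have P: "?P powi n > 0" by simp
    have "0 \<le> u \<and> \<lfloor>u * ?P powi n\<rfloor> = c \<longleftrightarrow> of_int c * ?P powi (- n) \<le> u \<and> u < (of_int c + 1) * ?P powi (- n)" for u
    proof -
      have "of_int c * ?P powi (- n) \<le> u \<longleftrightarrow> of_int c \<le> u * ?P powi n"
        "u < (of_int c + 1) * ?P powi (- n) \<longleftrightarrow> u * ?P powi n < of_int c + 1"
        using P by (simp_all add: power_int_minus field_simps)
      moreover have "0 \<le> u" if "of_int c \<le> u * ?P powi n"
        using order.trans[OF _ that, of 0] c(1) P by (simp add: zero_le_mult_iff)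
      ultimately show ?thesis unfolding floor_eq_iff by blast
    qed
    then show ?thesis by (intro set_eqI) (simp only: mem_Collect_eq atLeastLessThan_iff)
  qed
  finally show ?thesis by (intro exI[of _ c] conjI c(1))
qed

text \<open>The Haar measure of \<open>\<rat>\<^sub>p\<close>, normalised on \<open>\<int>\<^sub>p\<close>; these properties determine it.\<close>

definition is_haar :: "'p::prime_card padic measure \<Rightarrow> bool" where
  "is_haar \<mu> \<longleftrightarrow> sets \<mu> = sets borel \<and>
     (\<forall>a. \<forall>A\<in>sets borel. emeasure \<mu> ((+) a ` A) = emeasure \<mu> A) \<and>
     emeasure \<mu> padic_ints = 1"

text \<open>For existence take the image of Lebesgue measure on the half-line under reversal of digits.\<close>

lemma is_haar_exists: "\<exists>\<mu> :: 'p::prime_card padic measure. is_haar \<mu>"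
proof -
  let ?P = "real CARD('p)" and ?R = "restrict_space lborel {0::real..}"
  let ?E = "insert {} (range (\<lambda>(x :: 'p padic, n). pball x n))"
  have vim: "(digit_reversal -` pball x n \<inter> space ?R :: real set) = {u. 0 \<le> u \<and> digit_reversal u \<in> pball x n}"
    for x :: "'p padic" and n
    by (auto simp: space_restrict_space)
  have meas: "digit_reversal \<in> measurable ?R (borel :: 'p padic measure)"
    unfolding borel_pball
  proof (rule measurable_measure_of)
    fix A :: "'p padic set" assume "A \<in> ?E"
    then consider "A = {}" | x n where "A = pball x n" by auto
    then show "digit_reversal -` A \<inter> space ?R \<in> sets ?R"
    proof cases
      case 2
      obtain c where c: "c \<ge> 0" "{u. 0 \<le> u \<and> digit_reversal u \<in> pball x n}
         = {of_int c * ?P powi (- n) ..< (of_int c + 1) * ?P powi (- n)}"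
        using digit_reversal_vimage_pball by blast
      have "(0::real) \<le> of_int c * ?P powi (- n)" using c(1) by simp
      then show ?thesis unfolding 2 vim c(2) by (auto simp: sets_restrict_space_iff)
    qed auto
  qed auto
  define \<mu> :: "'p padic measure" where "\<mu> = distr ?R borel digit_reversal"
  have sets: "sets \<mu> = sets borel" by (simp add: \<mu>_def)
  have ball: "emeasure \<mu> (pball x n) = ennreal (?P powi (- n))" for x n
  proof -
    obtain c where c: "c \<ge> 0" "{u. 0 \<le> u \<and> digit_reversal u \<in> pball x n}
         = {of_int c * ?P powi (- n) ..< (of_int c + 1) * ?P powi (- n)}"
      using digit_reversal_vimage_pball by blast
    have c0: "(0::real) \<le> of_int c * ?P powi (- n)" using c(1) by simp
    have "emeasure \<mu> (pball x n) = emeasure ?R {of_int c * ?P powi (- n) ..< (of_int c + 1) * ?P powi (- n)}"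
      unfolding \<mu>_def by (subst emeasure_distr[OF meas]) (simp_all only: vim c(2) borel_open open_pball)
    also have "\<dots> = emeasure lborel {of_int c * ?P powi (- n) ..< (of_int c + 1) * ?P powi (- n)}"
      by (rule emeasure_restrict_space) (use c0 in auto)
    also have "\<dots> = ennreal (?P powi (- n))"
      by (subst emeasure_lborel_Ico) (auto simp: algebra_simps)
    finally show ?thesis .
  qed
  have inv: "emeasure \<mu> ((+) a ` A) = emeasure \<mu> A" if A: "A \<in> sets borel" for a A
  proof -
    have m: "(\<lambda>x. x - a) \<in> measurable \<mu> borel"
      unfolding measurable_cong_sets[OF sets refl]
      by (intro borel_measurable_continuous_onI continuous_intros)
    have vimage: "(\<lambda>x. x - a) -` B = (+) a ` B" for B
      by (force simp: image_iff intro: bexI[of _ "_ - a"])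
    have pb: "(+) a ` pball x n = pball (x + a) n" for x n
      unfolding vimage[symmetric] by (auto simp: pball_def algebra_simps)
    have "distr \<mu> borel (\<lambda>x. x - a) = \<mu>"
    proof (rule measure_eqI_generator_eq[OF Int_stable_pball[where 'p='p], where \<Omega>=UNIV and A="\<lambda>i. pball 0 (- int i)"])
      fix X assume "X \<in> ?E"
      then show "emeasure (distr \<mu> borel (\<lambda>x. x - a)) X = emeasure \<mu> X"
        by (auto simp: emeasure_distr[OF m] borel_open[OF open_pball] vimage pb ball
             sets_eq_imp_space_eq[OF sets])
    next
      show "(\<Union>i. pball (0 :: 'p padic) (- int i)) = UNIV"
      proof -
        have "\<exists>i. x \<in> pball 0 (- int i)" for x :: "'p padic"
        proof -
          obtain i where "padic_norm x < ?P ^ i" using real_arch_pow[OF real_card_gt_1] by blast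
          then show ?thesis by (intro exI[of _ i]) (simp add: pball_def)
        qed
        then show ?thesis by blast
      qed
    next
      fix i show "emeasure (distr \<mu> borel (\<lambda>x. x - a)) (pball 0 (- int i)) \<noteq> \<infinity>"
        by (simp add: emeasure_distr[OF m] borel_open[OF open_pball] vimage pb ball sets_eq_imp_space_eq[OF sets])
    qed (auto simp: sets borel_pball)
    then have "emeasure \<mu> A = emeasure (distr \<mu> borel (\<lambda>x. x - a)) A" by simp
    also have "\<dots> = emeasure \<mu> ((+) a ` A)"
      by (simp add: emeasure_distr[OF m A] vimage sets_eq_imp_space_eq[OF sets])
    finally show ?thesis by simp
  qed
  have "padic_ints = pball (0 :: 'p padic) 0" by (simp add: padic_ints_def pball_def)
  then have "emeasure \<mu> padic_ints = 1" using ball[of 0 0] by simp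
  then have "is_haar \<mu>" using sets inv by (simp add: is_haar_def)
  then show ?thesis by blast
qed

definition haar :: "'p::prime_card padic measure" where
  "haar = (SOME \<mu>. is_haar \<mu>)"

lemma is_haar_haar: "is_haar (haar :: 'p::prime_card padic measure)"
  unfolding haar_def by (rule someI_ex[OF is_haar_exists])

section \<open>Skorokhod space, walks and their scaling limits\<close>

definition transition_density :: "real \<Rightarrow> real \<Rightarrow> real \<Rightarrow> 'p::prime_card padic \<Rightarrow> complex" where
  "transition_density b \<sigma> t x =
     (LINT y|haar. padic_char (x * y) * of_real (exp (- \<sigma> * t * padic_norm y powr b)))"

text \<open>Paths on \<open>[0,\<infinity>)\<close> are functions on the reals that are \<open>undefined\<close> at negative times.\<close>

definition cadlag :: "(real \<Rightarrow> 'a::metric_space) set" where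
  "cadlag = {x \<in> extensional {0..}. (\<forall>t\<ge>0. (x \<longlongrightarrow> x t) (at_right t)) \<and> (\<forall>t>0. \<exists>l. (x \<longlongrightarrow> l) (at_left t))}"

definition time_changes :: "(real \<Rightarrow> real) set" where
  "time_changes = {l. strict_mono_on {0..} l \<and> l ` {0..} = {0..}}"

text \<open>A strictly increasing surjection of \<open>[0,\<infinity>)\<close> onto itself is automatically continuous and fixes \<open>0\<close>.
  The \<open>J\<^sub>1\<close> topology is given by the neighbourhoods below: a sequence \<open>y\<^sub>n\<close> converges to \<open>x\<close> iff there are
  time changes \<open>l\<^sub>n\<close> with \<open>sup\<^sub>s \<bar>l\<^sub>n s - s\<bar> \<longlonglongrightarrow> 0\<close> and \<open>sup\<^sub>s\<^sub>\<le>\<^sub>T dist (y\<^sub>n (l\<^sub>n s)) (x s) \<longlonglongrightarrow> 0\<close> for every \<open>T\<close>.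
  As the \<open>J\<^sub>1\<close> topology is metrisable with exactly this convergence, the two topologies agree.\<close>

definition J1_nbhd :: "(real \<Rightarrow> 'a::metric_space) \<Rightarrow> real \<Rightarrow> real \<Rightarrow> (real \<Rightarrow> 'a) set" where
  "J1_nbhd x T e = {y \<in> cadlag. \<exists>l\<in>time_changes.
      (\<forall>s\<ge>0. \<bar>l s - s\<bar> < e) \<and> (\<forall>s\<in>{0..T}. dist (y (l s)) (x s) < e)}"

definition skorokhod_J1 :: "(real \<Rightarrow> 'a::metric_space) topology" where
  "skorokhod_J1 = topology (\<lambda>U. U \<subseteq> cadlag \<and> (\<forall>x\<in>U. \<exists>T>0. \<exists>e>0. J1_nbhd x T e \<subseteq> U))"

lemma J1_nbhd_mono: "T \<le> T' \<Longrightarrow> e' \<le> e \<Longrightarrow> J1_nbhd x T' e' \<subseteq> J1_nbhd x T e"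
proof
  fix y assume T: "T \<le> T'" and e: "e' \<le> e" and "y \<in> J1_nbhd x T' e'"
  then obtain l where y: "y \<in> cadlag" and l: "l \<in> time_changes" "\<forall>s\<ge>0. \<bar>l s - s\<bar> < e'"
      "\<forall>s\<in>{0..T'}. dist (y (l s)) (x s) < e'"
    unfolding J1_nbhd_def by blast
  have "\<bar>l s - s\<bar> < e" if "s \<ge> 0" for s using l(2) that e by force
  moreover have "dist (y (l s)) (x s) < e" if "s \<in> {0..T}" for s using l(3) that e T by force
  ultimately show "y \<in> J1_nbhd x T e" unfolding J1_nbhd_def using y l(1) by blast
qed

lemma openin_skorokhod_J1:
  "openin skorokhod_J1 U \<longleftrightarrow>
     U \<subseteq> cadlag \<and> (\<forall>x\<in>U. \<exists>T>0. \<exists>e>0. J1_nbhd x T e \<subseteq> (U :: (real \<Rightarrow> 'a::metric_space) set))"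
proof -
  have "istopology (\<lambda>U :: (real \<Rightarrow> 'a) set. U \<subseteq> cadlag \<and> (\<forall>x\<in>U. \<exists>T>0. \<exists>e>0. J1_nbhd x T e \<subseteq> U))"
    unfolding istopology_def
  proof (intro conjI allI impI ballI)
    fix U V :: "(real \<Rightarrow> 'a) set" and x
    assume U: "U \<subseteq> cadlag \<and> (\<forall>x\<in>U. \<exists>T>0. \<exists>e>0. J1_nbhd x T e \<subseteq> U)"
      and V: "V \<subseteq> cadlag \<and> (\<forall>x\<in>V. \<exists>T>0. \<exists>e>0. J1_nbhd x T e \<subseteq> V)"
    show "U \<inter> V \<subseteq> cadlag" using U by blast
    assume x: "x \<in> U \<inter> V"
    obtain T e where 1: "T > 0" "e > 0" "J1_nbhd x T e \<subseteq> U" using U x by blast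
    obtain T' e' where 2: "T' > 0" "e' > 0" "J1_nbhd x T' e' \<subseteq> V" using V x by blast
    have "J1_nbhd x (max T T') (min e e') \<subseteq> U \<inter> V"
      using J1_nbhd_mono[of T "max T T'" "min e e'" e x] J1_nbhd_mono[of T' "max T T'" "min e e'" e' x] 1 2 by auto
    then show "\<exists>T>0. \<exists>e>0. J1_nbhd x T e \<subseteq> U \<inter> V"
      using 1 2 by (intro exI[of _ "max T T'"] exI[of _ "min e e'"] conjI) auto
  next
    fix K :: "(real \<Rightarrow> 'a) set set" and x
    assume K: "\<forall>U\<in>K. U \<subseteq> cadlag \<and> (\<forall>x\<in>U. \<exists>T>0. \<exists>e>0. J1_nbhd x T e \<subseteq> U)"
    then show "\<Union>K \<subseteq> cadlag" by blast
    assume "x \<in> \<Union>K"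
    then show "\<exists>T>0. \<exists>e>0. J1_nbhd x T e \<subseteq> \<Union>K" using K by (meson Sup_upper UnionE order.trans)
  qed
  then show ?thesis by (simp add: skorokhod_J1_def)
qed

lemma topspace_skorokhod_J1: "topspace skorokhod_J1 = (cadlag :: (real \<Rightarrow> 'a::metric_space) set)"
proof -
  have "openin skorokhod_J1 (cadlag :: (real \<Rightarrow> 'a) set)"
    unfolding openin_skorokhod_J1 by (auto simp: J1_nbhd_def intro!: exI[of _ 1])
  then have "cadlag \<subseteq> topspace (skorokhod_J1 :: (real \<Rightarrow> 'a) topology)" by (rule openin_subset)
  moreover have "topspace (skorokhod_J1 :: (real \<Rightarrow> 'a) topology) \<subseteq> cadlag"
    using openin_topspace[of "skorokhod_J1 :: (real \<Rightarrow> 'a) topology"] by (simp only: openin_skorokhod_J1)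
  ultimately show ?thesis by (rule antisym[rotated])
qed

definition borel_of :: "'a topology \<Rightarrow> 'a measure" where
  "borel_of X = sigma (topspace X) {U. openin X U}"

definition converges_weakly :: "'a topology \<Rightarrow> (nat \<Rightarrow> 'a measure) \<Rightarrow> 'a measure \<Rightarrow> bool" where
  "converges_weakly X M N \<longleftrightarrow>
     (\<forall>f :: 'a \<Rightarrow> real. continuous_map X euclideanreal f \<and> bounded (f ` topspace X) \<longrightarrow>
        (\<lambda>m. integral\<^sup>L (M m) f) \<longlonglongrightarrow> integral\<^sup>L N f)"

text \<open>\<open>limit_process_law b \<sigma> P\<close>: under \<open>P\<close> the coordinate process on path space starts at \<open>0\<close>, has independent
  increments, and increments over a time span \<open>t\<close> have density \<open>\<rho>(t, \<cdot>)\<close> with respect to Haar measure.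
  The values of \<open>\<rho>\<close> are real and nonnegative; \<open>Re\<close> and \<open>ennreal\<close> only adjust the type.\<close>

definition limit_process_law :: "real \<Rightarrow> real \<Rightarrow> (real \<Rightarrow> 'p::prime_card padic) measure \<Rightarrow> bool" where
  "limit_process_law b \<sigma> P \<longleftrightarrow>
     prob_space P \<and> sets P = sets (borel_of skorokhod_J1) \<and>
     (AE x in P. x 0 = 0) \<and>
     (\<forall>s\<ge>0. \<forall>t>s. distributed P haar (\<lambda>x. x t - x s)
        (\<lambda>z. ennreal (Re (transition_density b \<sigma> (t - s) z)))) \<and>
     (\<forall>n. \<forall>\<tau> :: nat \<Rightarrow> real. 0 \<le> \<tau> 0 \<and> strict_mono \<tau> \<longrightarrow>
        prob_space.indep_vars P (\<lambda>_. borel) (\<lambda>i x. x (\<tau> (Suc i)) - x (\<tau> i)) {..<n})"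

text \<open>The walk is realised on the infinite product of the increment law \<open>\<xi>\<close>, with \<open>S\<^sub>n = (\<Sum>i<n. \<omega> i)\<close>;
  the path below is \<open>t \<mapsto> \<Gamma>\<^sub>m (S\<^bsub>\<lfloor>\<lambda>(m) t\<rfloor>\<^esub>)\<close> with \<open>\<lambda>(m) = D p\<^bsup>mb\<^esup>\<close>.\<close>

definition walk_path ::
  "real \<Rightarrow> real \<Rightarrow> nat \<Rightarrow> (nat \<Rightarrow> 'p::prime_card qp_mod_zp) \<Rightarrow> real \<Rightarrow> 'p padic" where
  "walk_path b D m \<omega> = (\<lambda>t\<in>{0..}. scaling_map m
     (\<Sum>i<nat \<lfloor>D * real CARD('p) powr (real m * b) * t\<rfloor>. \<omega> i))"

definition walk_law ::
  "real \<Rightarrow> real \<Rightarrow> 'p::prime_card qp_mod_zp pmf \<Rightarrow> nat \<Rightarrow> (real \<Rightarrow> 'p padic) measure" where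
  "walk_law b D \<xi> m = distr (\<Pi>\<^sub>M i\<in>(UNIV :: nat set). measure_pmf \<xi>) (borel_of skorokhod_J1) (walk_path b D m)"

text \<open>\<open>\<sigma>\<close> is the diffusion coefficient of the scaling limit of the walk with increment law \<open>\<xi>\<close>.\<close>

definition diffusion_coefficient :: "real \<Rightarrow> real \<Rightarrow> 'p::prime_card qp_mod_zp pmf \<Rightarrow> real \<Rightarrow> bool" where
  "diffusion_coefficient b D \<xi> \<sigma> \<longleftrightarrow> \<sigma> > 0 \<and>
     (\<exists>P. limit_process_law b \<sigma> P \<and> converges_weakly skorokhod_J1 (walk_law b D \<xi>) P)"

section \<open>The increment laws\<close>

text \<open>\<open>qp_ball k\<close> is \<open>p\<^bsup>-k\<^esup>\<int>\<^sub>p / \<int>\<^sub>p\<close>. In \<open>ball2 j\<close> the index is decomposed as \<open>j = 2k + \<epsilon>\<close> with \<open>\<epsilon> \<in> {0, 1}\<close>.\<close>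

definition qp_ball :: "nat \<Rightarrow> 'p::prime_card qp_mod_zp set" where
  "qp_ball k = (\<lambda>z. abs_qp_mod_zp (z / padic_p ^ k)) ` padic_ints"

definition ball2 :: "nat \<Rightarrow> ('p::prime_card qp_mod_zp \<times> 'p qp_mod_zp) set" where
  "ball2 j = qp_ball (j div 2) \<times> qp_ball (j div 2 + j mod 2)"

definition fine_shell :: "nat \<Rightarrow> ('p::prime_card qp_mod_zp \<times> 'p qp_mod_zp) set" where
  "fine_shell j = ball2 j - ball2 (j - 1)"

text \<open>Indexed by \<open>k\<close>: \<open>coarse_shell k\<close> is the shell with index \<open>2k\<close>.\<close>

definition coarse_shell :: "nat \<Rightarrow> ('p::prime_card qp_mod_zp \<times> 'p qp_mod_zp) set" where
  "coarse_shell k = ball2 (2 * k) - ball2 (2 * k - 2)"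

definition fine_radius :: "nat \<Rightarrow> real \<Rightarrow> nat \<Rightarrow> real" where
  "fine_radius p h j = (if odd j then real p powr (real (j div 2) + h) else real p powr real (j div 2))"

definition aniso_const :: "nat \<Rightarrow> real \<Rightarrow> real \<Rightarrow> real" where
  "aniso_const p b h = inverse (real p powr (- h * b) + real p powr (- b)) * ((real p powr b - 1) / real p powr b)"

definition fine_shell_prob :: "nat \<Rightarrow> real \<Rightarrow> real \<Rightarrow> nat \<Rightarrow> real" where
  "fine_shell_prob p b h j = (if j = 0 then 0 else aniso_const p b h * fine_radius p h j powr (- b))"

definition coarse_shell_prob :: "nat \<Rightarrow> real \<Rightarrow> nat \<Rightarrow> real" where
  "coarse_shell_prob p b k = (if k = 0 then 0 else (real p powr b - 1) * real p powr (- real k * b))"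

definition aniso_increment :: "real \<Rightarrow> real \<Rightarrow> ('p::prime_card qp_mod_zp \<times> 'p qp_mod_zp) pmf" where
  "aniso_increment b h = bind_pmf (embed_pmf (fine_shell_prob CARD('p) b h)) (\<lambda>j. pmf_of_set (fine_shell j))"

definition iso_increment :: "real \<Rightarrow> ('p::prime_card qp_mod_zp \<times> 'p qp_mod_zp) pmf" where
  "iso_increment b = bind_pmf (embed_pmf (coarse_shell_prob CARD('p) b)) (\<lambda>k. pmf_of_set (coarse_shell k))"

lemma abs_in_qp_ball:
  "abs_qp_mod_zp x \<in> qp_ball k \<longleftrightarrow> padic_norm (x :: 'p::prime_card padic) \<le> real CARD('p) ^ k"
proof
  assume "abs_qp_mod_zp x \<in> qp_ball k"
  then obtain z where z: "z \<in> padic_ints" "mod_zp_rel x (z / padic_p ^ k)"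
    unfolding qp_ball_def by (auto simp: qp_mod_zp.abs_eq_iff)
  have 1: "1 \<le> real CARD('p) ^ k" by (rule one_le_power) (rule less_imp_le[OF real_card_gt_1])
  have "padic_norm (x - z / padic_p ^ k) \<le> real CARD('p) ^ k"
    using z(2) 1 unfolding mod_zp_rel_def padic_ints_def by simp
  moreover have "padic_norm (z / padic_p ^ k) \<le> real CARD('p) ^ k"
    using z(1) mult_right_mono[of "padic_norm z" 1 "real CARD('p) ^ k"]
    by (simp add: padic_ints_def norm_padic_divide norm_padic_power norm_padic_p power_one_over)
  ultimately show "padic_norm x \<le> real CARD('p) ^ k"
    using norm_padic_add_le_max[of "x - z / padic_p ^ k" "z / padic_p ^ k"] by simp
next
  assume x: "padic_norm x \<le> real CARD('p) ^ k"
  have "real CARD('p) ^ k > 0" by simp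
  then have "x * padic_p ^ k \<in> padic_ints"
    using x by (simp add: padic_ints_def norm_padic_mult norm_padic_power norm_padic_p power_one_over field_simps)
  moreover have "abs_qp_mod_zp x = abs_qp_mod_zp ((x * padic_p ^ k) / padic_p ^ k)" by simp
  ultimately show "abs_qp_mod_zp x \<in> qp_ball k" unfolding qp_ball_def by blast
qed

lemma qp_ball_mono: "j \<le> k \<Longrightarrow> qp_ball j \<subseteq> (qp_ball k :: 'p::prime_card qp_mod_zp set)"
proof
  fix g :: "'p qp_mod_zp" assume jk: "j \<le> k" and g: "g \<in> qp_ball j"
  obtain x where x: "g = abs_qp_mod_zp x"
    using qp_mod_zp.abs_induct[of "\<lambda>g. \<exists>x. g = abs_qp_mod_zp x" g] by blast
  have "real CARD('p) ^ j \<le> real CARD('p) ^ k"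
    by (rule power_increasing[OF jk]) (rule less_imp_le[OF real_card_gt_1])
  then show "g \<in> qp_ball k" using g unfolding x abs_in_qp_ball by linarith
qed

lemma qp_ball_strict: "abs_qp_mod_zp (1 / padic_p ^ Suc k) \<in> qp_ball (Suc k) - (qp_ball k :: 'p::prime_card qp_mod_zp set)"
proof -
  have "padic_norm (1 / padic_p ^ Suc k :: 'p padic) = real CARD('p) ^ Suc k"
    unfolding norm_padic_divide norm_padic_power norm_padic_p by (simp add: power_one_over)
  moreover have "real CARD('p) ^ k < real CARD('p) ^ Suc k"
    by (rule power_strict_increasing[OF lessI real_card_gt_1])
  ultimately show ?thesis unfolding Diff_iff abs_in_qp_ball by linarith
qed

lemma zero_in_qp_ball: "0 \<in> qp_ball k"
  unfolding zero_qp_mod_zp.abs_eq abs_in_qp_ball by simp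

lemma finite_qp_ball: "finite (qp_ball k :: 'p::prime_card qp_mod_zp set)"
proof (induction k)
  case 0
  have "qp_ball 0 \<subseteq> {0 :: 'p qp_mod_zp}"
    by (auto simp: qp_ball_def zero_qp_mod_zp.abs_eq qp_mod_zp.abs_eq_iff mod_zp_rel_def)
  then show ?case by (rule finite_subset) simp
next
  case (Suc k)
  have "qp_ball (Suc k) \<subseteq> (\<lambda>(c, g). abs_qp_mod_zp (of_nat c / padic_p ^ Suc k) + g) ` ({..<CARD('p)} \<times> qp_ball k :: (nat \<times> 'p qp_mod_zp) set)"
  proof
    fix g :: "'p qp_mod_zp" assume "g \<in> qp_ball (Suc k)"
    then obtain z where z: "z \<in> padic_ints" "g = abs_qp_mod_zp (z / padic_p ^ Suc k)"
      unfolding qp_ball_def by blast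
    then obtain c where c: "c < CARD('p)" "padic_norm (z - of_nat c) \<le> 1 / real CARD('p)"
      using padic_first_digit[of z] unfolding padic_ints_def by blast
    define w where "w = (z - of_nat c) / padic_p ^ Suc k"
    have "padic_norm w = padic_norm (z - of_nat c) * real CARD('p) ^ Suc k"
      unfolding w_def norm_padic_divide norm_padic_power norm_padic_p by (simp add: power_one_over)
    also have "\<dots> \<le> 1 / real CARD('p) * real CARD('p) ^ Suc k"
      using c(2) by (intro mult_right_mono) auto
    finally have "abs_qp_mod_zp w \<in> qp_ball k" unfolding abs_in_qp_ball by simp
    moreover have "g = abs_qp_mod_zp (of_nat c / padic_p ^ Suc k) + abs_qp_mod_zp w"
      unfolding z(2) w_def plus_qp_mod_zp.abs_eq by (simp only: add_divide_distrib[symmetric]) simp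
    ultimately show "g \<in> (\<lambda>(c, g). abs_qp_mod_zp (of_nat c / padic_p ^ Suc k) + g) ` ({..<CARD('p)} \<times> qp_ball k)"
      using c(1) by (intro image_eqI[of _ _ "(c, abs_qp_mod_zp w)"]) auto
  qed
  then show ?case by (rule finite_subset) (intro finite_imageI finite_cartesian_product Suc; simp)
qed

lemma finite_ball2: "finite (ball2 j :: ('p::prime_card qp_mod_zp \<times> 'p qp_mod_zp) set)"
  unfolding ball2_def by (intro finite_cartesian_product finite_qp_ball)

lemma ball2_mono: "i \<le> j \<Longrightarrow> ball2 i \<subseteq> (ball2 j :: ('p::prime_card qp_mod_zp \<times> 'p qp_mod_zp) set)"
  unfolding ball2_def by (intro Sigma_mono qp_ball_mono) presburger+

lemma ball2_strict: "ball2 (Suc j) - ball2 j \<noteq> ({} :: ('p::prime_card qp_mod_zp \<times> 'p qp_mod_zp) set)"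
proof (cases "even j")
  case True
  then have e: "Suc j div 2 = j div 2" "Suc j mod 2 = 1" "j mod 2 = 0" by presburger+
  have "(0, abs_qp_mod_zp (1 / padic_p ^ Suc (j div 2))) \<in> ball2 (Suc j) - (ball2 j :: ('p qp_mod_zp \<times> 'p qp_mod_zp) set)"
    using qp_ball_strict[of "j div 2", where 'p='p] zero_in_qp_ball unfolding ball2_def e by auto
  then show ?thesis by blast
next
  case False
  then have e: "Suc j div 2 = Suc (j div 2)" "Suc j mod 2 = 0" "j mod 2 = 1" by presburger+
  have "(abs_qp_mod_zp (1 / padic_p ^ Suc (j div 2)), 0) \<in> ball2 (Suc j) - (ball2 j :: ('p qp_mod_zp \<times> 'p qp_mod_zp) set)"
    using qp_ball_strict[of "j div 2", where 'p='p] zero_in_qp_ball unfolding ball2_def e by auto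
  then show ?thesis by blast
qed

lemma fine_shell_finite: "finite (fine_shell j)"
  unfolding fine_shell_def using finite_ball2 by blast

lemma fine_shell_nonempty: "j > 0 \<Longrightarrow> fine_shell j \<noteq> {}"
  unfolding fine_shell_def using ball2_strict[of "j - 1"] by simp

lemma fine_shell_disjoint: "i \<noteq> j \<Longrightarrow> fine_shell i \<inter> fine_shell j = {}"
proof (induction i j rule: linorder_wlog)
  case (le i j)
  then have "ball2 i \<subseteq> ball2 (j - 1)" by (intro ball2_mono) simp
  then show ?case unfolding fine_shell_def by blast
qed blast

lemma coarse_shell_finite: "finite (coarse_shell k)"
  unfolding coarse_shell_def using finite_ball2 by blast

lemma coarse_shell_nonempty:
  assumes "k > 0" shows "coarse_shell k \<noteq> ({} :: ('p::prime_card qp_mod_zp \<times> 'p qp_mod_zp) set)"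
proof -
  have "Suc (2 * k - 1) = 2 * k" using assms by simp
  then obtain x :: "'p qp_mod_zp \<times> 'p qp_mod_zp" where "x \<in> ball2 (2 * k)" "x \<notin> ball2 (2 * k - 1)"
    using ball2_strict[of "2 * k - 1", where 'p='p] by auto
  moreover have "ball2 (2 * k - 2) \<subseteq> (ball2 (2 * k - 1) :: ('p qp_mod_zp \<times> 'p qp_mod_zp) set)"
    by (rule ball2_mono) simp
  ultimately show ?thesis unfolding coarse_shell_def by blast
qed

lemma coarse_shell_disjoint: "i \<noteq> j \<Longrightarrow> coarse_shell i \<inter> coarse_shell j = {}"
proof (induction i j rule: linorder_wlog)
  case (le i j)
  then have "ball2 (2 * i) \<subseteq> ball2 (2 * j - 2)" by (intro ball2_mono) simp
  then show ?case unfolding coarse_shell_def by blast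
qed blast

lemma fine_shell_prob_nonneg:
  assumes "b > 0" "p > 1" shows "fine_shell_prob p b h j \<ge> 0"
proof -
  have "real p powr b \<ge> 1" using assms by (intro ge_one_powr_ge_zero) auto
  then show ?thesis unfolding fine_shell_prob_def aniso_const_def
    by (auto intro!: mult_nonneg_nonneg divide_nonneg_nonneg add_nonneg_nonneg)
qed

lemma fine_shell_prob_sums:
  assumes b: "b > 0" and p: "p > 1" shows "fine_shell_prob p b h sums 1"
proof -
  let ?q = "real p powr (- b)" and ?u = "real p powr (- h * b)" and ?C = "aniso_const p b h"
  have q: "0 < ?q" "?q < 1" using b p by (auto simp: powr_less_one)
  have u: "0 < ?u" using p by simp
  have pw: "real p powr (- (real k * b)) = ?q ^ k" for k
    using p by (simp add: powr_realpow[symmetric] powr_powr mult.commute)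
  have geo: "(\<lambda>k. ?q ^ k) sums (1 / (1 - ?q))" using q by (intro geometric_sums) auto
  have s1: "(\<lambda>k. ?C * ?u * ?q ^ k) sums (?C * ?u * (1 / (1 - ?q)))" by (intro sums_mult geo)
  have s2: "(\<lambda>k. ?C * ?q * ?q ^ k) sums (?C * ?q * (1 / (1 - ?q)))" by (intro sums_mult geo)
  have "(\<lambda>n. if even n then ?C * ?u * ?q ^ (n div 2) else ?C * ?q * ?q ^ ((n - 1) div 2)) sums
     (?C * ?q * (1 / (1 - ?q)) + ?C * ?u * (1 / (1 - ?q)))"
    by (rule sums_if[OF s2 s1])
  also have "?C * ?q * (1 / (1 - ?q)) + ?C * ?u * (1 / (1 - ?q)) = ?C * (?u + ?q) * (1 / (1 - ?q))"
    by (simp add: algebra_simps)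
  also have "\<dots> = 1"
  proof -
    have "(real p powr b - 1) / real p powr b = 1 - ?q"
      using p by (simp add: diff_divide_distrib powr_minus inverse_eq_divide)
    then have "?C * (?u + ?q) = inverse (?u + ?q) * (1 - ?q) * (?u + ?q)" unfolding aniso_const_def by simp
    moreover have "?u + ?q \<noteq> 0" using q u by linarith
    ultimately have "?C * (?u + ?q) = 1 - ?q" by simp
    then show ?thesis using q by simp
  qed
  also have "(\<lambda>n. if even n then ?C * ?u * ?q ^ (n div 2) else ?C * ?q * ?q ^ ((n - 1) div 2))
      = (\<lambda>n. fine_shell_prob p b h (Suc n))"
  proof
    fix n
    show "(if even n then ?C * ?u * ?q ^ (n div 2) else ?C * ?q * ?q ^ ((n - 1) div 2)) = fine_shell_prob p b h (Suc n)"
    proof (cases "even n")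
      case True
      then have e: "Suc n div 2 = n div 2" by presburger
      have "(real p powr (real (n div 2) + h)) powr (- b) = ?u * ?q ^ (n div 2)"
        using p by (simp add: powr_powr pw[symmetric] powr_add[symmetric] algebra_simps)
      then show ?thesis using True by (simp add: fine_shell_prob_def fine_radius_def e)
    next
      case False
      then have e: "Suc n div 2 = Suc ((n - 1) div 2)" by presburger
      have "(real p powr real (Suc ((n - 1) div 2))) powr (- b) = ?q ^ Suc ((n - 1) div 2)"
        unfolding pw[symmetric] using p by (simp add: powr_powr)
      then show ?thesis using False by (simp add: fine_shell_prob_def fine_radius_def e)
    qed
  qed
  finally have "(\<lambda>n. fine_shell_prob p b h (Suc n)) sums 1" .
  moreover have "fine_shell_prob p b h 0 = 0" by (simp add: fine_shell_prob_def)
  ultimately show ?thesis using sums_Suc[of "fine_shell_prob p b h" 1] by simp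
qed

lemma coarse_shell_prob_nonneg:
  assumes "b > 0" "p > 1" shows "coarse_shell_prob p b k \<ge> 0"
proof -
  have "real p powr b \<ge> 1" using assms by (intro ge_one_powr_ge_zero) auto
  then show ?thesis by (simp add: coarse_shell_prob_def)
qed

lemma coarse_shell_prob_sums:
  assumes b: "b > 0" and p: "p > 1" shows "coarse_shell_prob p b sums 1"
proof -
  let ?q = "real p powr (- b)"
  have q: "0 < ?q" "?q < 1" using b p by (auto simp: powr_less_one)
  have pw: "real p powr (- (real k * b)) = ?q ^ k" for k
    using p by (simp add: powr_realpow[symmetric] powr_powr mult.commute)
  have pb: "real p powr b = 1 / ?q" by (simp add: powr_minus inverse_eq_divide)
  have "(\<lambda>k. (real p powr b - 1) * ?q * ?q ^ k) sums ((real p powr b - 1) * ?q * (1 / (1 - ?q)))"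
    using q by (intro sums_mult geometric_sums) auto
  also have "(real p powr b - 1) * ?q * (1 / (1 - ?q)) = 1"
    unfolding pb using q by (simp add: field_simps)
  also have "(\<lambda>k. (real p powr b - 1) * ?q * ?q ^ k) = (\<lambda>k. coarse_shell_prob p b (Suc k))"
  proof
    fix k
    have "real p powr (- real (Suc k) * b) = ?q * ?q ^ k"
      by (simp only: mult_minus_left pw power_Suc)
    then show "(real p powr b - 1) * ?q * ?q ^ k = coarse_shell_prob p b (Suc k)"
      unfolding coarse_shell_prob_def by (simp only: mult.assoc) simp
  qed
  finally have "(\<lambda>k. coarse_shell_prob p b (Suc k)) sums 1" .
  moreover have "coarse_shell_prob p b 0 = 0" by (simp add: coarse_shell_prob_def)
  ultimately show ?thesis using sums_Suc[of "coarse_shell_prob p b" 1] by simp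
qed

lemma pmf_embed_sums:
  fixes f :: "nat \<Rightarrow> real"
  assumes "\<And>j. f j \<ge> 0" "f sums 1"
  shows "pmf (embed_pmf f) j = f j"
proof (rule pmf_embed_pmf)
  have "(\<integral>\<^sup>+ x. ennreal (f x) \<partial>count_space UNIV) = (\<Sum>j. ennreal (f j))"
    by (rule nn_integral_count_space_nat)
  also have "\<dots> = 1" using suminf_ennreal_eq[OF assms] by simp
  finally show "(\<integral>\<^sup>+ x. ennreal (f x) \<partial>count_space UNIV) = 1" .
qed (rule assms(1))

lemma pmf_shell_mixture:
  fixes f :: "nat \<Rightarrow> real"
  assumes f: "\<And>j. f j \<ge> 0" "f sums 1" "f 0 = 0"
    and S: "\<And>j. finite (S j)" "\<And>j. j > 0 \<Longrightarrow> S j \<noteq> {}" "\<And>i j. i \<noteq> j \<Longrightarrow> S i \<inter> S j = {}"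
  shows "x \<in> S j \<Longrightarrow> j > 0 \<Longrightarrow> pmf (bind_pmf (embed_pmf f) (\<lambda>j. pmf_of_set (S j))) x = f j / card (S j)"
    and "(\<And>j. j > 0 \<Longrightarrow> x \<notin> S j) \<Longrightarrow> pmf (bind_pmf (embed_pmf f) (\<lambda>j. pmf_of_set (S j))) x = 0"
proof -
  have E: "pmf (embed_pmf f) j = f j" for j by (rule pmf_embed_sums[OF f(1,2)])
  have supp: "j > 0" if "j \<in> set_pmf (embed_pmf f)" for j
    using that f(3) by (cases j) (auto simp: set_pmf_iff E)
  show "pmf (bind_pmf (embed_pmf f) (\<lambda>j. pmf_of_set (S j))) x = 0" if x: "\<And>j. j > 0 \<Longrightarrow> x \<notin> S j"
  proof -
    have "x \<notin> set_pmf (bind_pmf (embed_pmf f) (\<lambda>j. pmf_of_set (S j)))"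
      using x supp S by auto
    then show ?thesis by (simp only: set_pmf_iff not_not)
  qed
  assume x: "x \<in> S j" and j: "j > 0"
  have "pmf (bind_pmf (embed_pmf f) (\<lambda>j. pmf_of_set (S j))) x
      = measure_pmf.expectation (embed_pmf f) (\<lambda>i. pmf (pmf_of_set (S i)) x)"
    by (rule pmf_bind)
  also have "\<dots> = measure_pmf.expectation (embed_pmf f) (\<lambda>i. indicator {j} i * (1 / card (S j)))"
  proof (intro integral_cong_AE AE_pmfI)
    fix i assume "i \<in> set_pmf (embed_pmf f)"
    then have i: "i > 0" by (rule supp)
    show "pmf (pmf_of_set (S i)) x = indicator {j} i * (1 / card (S j))"
    proof (cases "i = j")
      case False
      then have "x \<notin> S i" using S(3)[of i j] x by blast
      then show ?thesis using False S(1,2) i by (simp add: pmf_of_set)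
    qed (use x j S(1,2) in \<open>simp add: pmf_of_set\<close>)
  qed auto
  also have "\<dots> = f j / card (S j)"
    by (simp add: measure_pmf_single E)
  finally show "pmf (bind_pmf (embed_pmf f) (\<lambda>j. pmf_of_set (S j))) x = f j / card (S j)" .
qed

text \<open>The lemmas below confirm that the mixtures give each shell the prescribed probability, uniformly distributed,
  and give no mass to the origin.\<close>

lemma pmf_aniso_increment:
  assumes "b > 0" "x \<in> fine_shell j" "j > 0"
  shows "pmf (aniso_increment b h :: ('p::prime_card qp_mod_zp \<times> 'p qp_mod_zp) pmf) x =
           fine_shell_prob CARD('p) b h j / card (fine_shell j :: ('p qp_mod_zp \<times> 'p qp_mod_zp) set)"
  unfolding aniso_increment_def
proof (rule pmf_shell_mixture(1)[where S=fine_shell, OF _ _ _ fine_shell_finite fine_shell_nonempty fine_shell_disjoint assms(2,3)])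
  show "fine_shell_prob CARD('p) b h j \<ge> 0" for j by (rule fine_shell_prob_nonneg[OF assms(1) card_gt_1])
  show "fine_shell_prob CARD('p) b h sums 1" by (rule fine_shell_prob_sums[OF assms(1) card_gt_1])
qed (simp add: fine_shell_prob_def)

lemma pmf_iso_increment:
  assumes "b > 0" "x \<in> coarse_shell k" "k > 0"
  shows "pmf (iso_increment b :: ('p::prime_card qp_mod_zp \<times> 'p qp_mod_zp) pmf) x =
           coarse_shell_prob CARD('p) b k / card (coarse_shell k :: ('p qp_mod_zp \<times> 'p qp_mod_zp) set)"
  unfolding iso_increment_def
proof (rule pmf_shell_mixture(1)[where S=coarse_shell, OF _ _ _ coarse_shell_finite coarse_shell_nonempty coarse_shell_disjoint assms(2,3)])
  show "coarse_shell_prob CARD('p) b k \<ge> 0" for k by (rule coarse_shell_prob_nonneg[OF assms(1) card_gt_1])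
  show "coarse_shell_prob CARD('p) b sums 1" by (rule coarse_shell_prob_sums[OF assms(1) card_gt_1])
qed (simp add: coarse_shell_prob_def)

lemma pmf_aniso_increment_0:
  assumes "b > 0"
  shows "pmf (aniso_increment b h :: ('p::prime_card qp_mod_zp \<times> 'p qp_mod_zp) pmf) (0, 0) = 0"
  unfolding aniso_increment_def
proof (rule pmf_shell_mixture(2)[where S=fine_shell, OF _ _ _ fine_shell_finite fine_shell_nonempty fine_shell_disjoint])
  show "fine_shell_prob CARD('p) b h j \<ge> 0" for j by (rule fine_shell_prob_nonneg[OF assms card_gt_1])
  show "fine_shell_prob CARD('p) b h sums 1" by (rule fine_shell_prob_sums[OF assms card_gt_1])
  show "(0, 0) \<notin> fine_shell j" for j by (simp add: fine_shell_def ball2_def zero_in_qp_ball)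
qed (simp add: fine_shell_prob_def)

lemma pmf_iso_increment_0:
  assumes "b > 0"
  shows "pmf (iso_increment b :: ('p::prime_card qp_mod_zp \<times> 'p qp_mod_zp) pmf) (0, 0) = 0"
  unfolding iso_increment_def
proof (rule pmf_shell_mixture(2)[where S=coarse_shell, OF _ _ _ coarse_shell_finite coarse_shell_nonempty coarse_shell_disjoint])
  show "coarse_shell_prob CARD('p) b k \<ge> 0" for k by (rule coarse_shell_prob_nonneg[OF assms card_gt_1])
  show "coarse_shell_prob CARD('p) b sums 1" by (rule coarse_shell_prob_sums[OF assms card_gt_1])
  show "(0, 0) \<notin> coarse_shell k" for k by (simp add: coarse_shell_def ball2_def zero_in_qp_ball)
qed (simp add: coarse_shell_prob_def)

end

theory Submission
  imports Defs
begin

text \<open>Each diffusion coefficient is read off from the time that the process spends in \<open>\<int>\<^sub>p\<close> before it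
  first leaves it. Let the increment of a walk on \<open>\<rat>\<^sub>p/\<int>\<^sub>p\<close> lie outside the finite subgroup
  \<open>p\<^bsup>-m\<^esup>\<int>\<^sub>p/\<int>\<^sub>p\<close> with probability \<open>c p\<^bsup>-mb\<^esup>\<close>, for every \<open>m\<close>. The rescaled position \<open>\<Gamma>\<^sub>m(S)\<close> lies
  in \<open>\<int>\<^sub>p\<close> exactly if \<open>S\<close> lies in this subgroup. Hence the rescaled walk leaves \<open>\<int>\<^sub>p\<close> with the first increment
  outside the subgroup, and it is still confined at time \<open>t\<close> with probability
  \<open>(1 - c p\<^bsup>-mb\<^esup>)\<close> to the power \<open>\<lfloor>D p\<^bsup>mb\<^esup> t\<rfloor>\<close>, which tends to \<open>exp (- D c t)\<close>.

  By right continuity the limit process is, almost surely, confined up to time \<open>t\<close> exactly if all its increments over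
  ever finer dyadic grids of \<open>[0, t]\<close> lie in \<open>\<int>\<^sub>p\<close>. The Fourier transform of the indicator of \<open>\<int>\<^sub>p\<close> is the same indicator, so an increment over a time
  span \<open>s\<close> lies in \<open>\<int>\<^sub>p\<close> with probability
  \<open>\<integral>\<^bsub>\<int>p\<^esub> exp (- \<sigma> s \<bar>y\<bar>\<^sup>b) dy = 1 - \<sigma> \<kappa> s + O(s\<^sup>2)\<close>, where \<open>\<kappa> = \<integral>\<^bsub>\<int>p\<^esub> \<bar>y\<bar>\<^sup>b dy \<le> 1\<close>. As increments are independent,
  the limit process is confined up to time \<open>t\<close> with probability \<open>exp (- \<sigma> \<kappa> t)\<close>.

  A perturbation of a path by less than \<open>1\<close> does not change whether it is in \<open>\<int>\<^sub>p\<close>, and a time change shifts the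
  exit time by no more than it shifts times. The exit time, cut off at a fixed bound, is therefore continuous in the \<open>J\<^sub>1\<close> topology, weak convergence
  identifies the two exponential laws, and \<open>\<sigma> \<kappa> = D c\<close> (lemma \<open>diffusion_coefficient_tail\<close>).

  It remains to compare the constants \<open>c\<close>, which are obtained by summing geometric series over the shells. Put
  \<open>q = p\<^bsup>-b\<^esup>\<close>, \<open>u = p\<^bsup>-hb\<^esup>\<close> and \<open>w = p (1 - q) / (p - q)\<close>. The two coordinates of the anisotropic walk have
  \<open>c\<^sub>1 = 1 - w u / (u + q)\<close> and \<open>c\<^sub>2 = 1 - (w / p) q / (u + q)\<close>, and the isotropic walk has \<open>c\<^sub>0 = 1 - w / (p + 1)\<close>
  in both coordinates. Since \<open>q < u\<close>, it follows that
  \<open>c\<^sub>1 \<le> 1 - w / 2 < c\<^sub>0 < 1 - w / (2 p) \<le> c\<^sub>2\<close>, where the two gaps do not depend on \<open>h\<close> (lemma \<open>tail_gap\<close>).\<close>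

section \<open>The confinement time as a continuous functional on Skorokhod space\<close>

text \<open>The condition concerns the half-open interval \<open>[0, u)\<close>, so that \<open>u = 0\<close> always qualifies. The cap \<open>t\<close> keeps the
  supremum finite and bounded.\<close>

definition confinement_time :: "'a set \<Rightarrow> real \<Rightarrow> (real \<Rightarrow> 'a) \<Rightarrow> real" where
  "confinement_time K t x = Sup {u\<in>{0..t}. \<forall>s\<in>{0..<u}. x s \<in> K}"

lemma confinement_time_bounds:
  assumes "0 \<le> t" shows "0 \<le> confinement_time K t x" "confinement_time K t x \<le> t"
proof -
  let ?A = "{u\<in>{0..t}. \<forall>s\<in>{0..<u}. x s \<in> K}"
  have "0 \<in> ?A" using assms by simp
  moreover have "bdd_above ?A" by (intro bdd_aboveI[of _ t]) auto
  ultimately show "0 \<le> confinement_time K t x"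
    unfolding confinement_time_def by (rule cSup_upper)
  show "confinement_time K t x \<le> t"
    unfolding confinement_time_def using \<open>0 \<in> ?A\<close> by (intro cSup_least) auto
qed

lemma confinement_time_shift:
  assumes "0 \<le> t" "0 \<le> e"
    and "\<And>u. u \<in> {0..t} \<Longrightarrow> \<forall>s\<in>{0..<u}. x s \<in> K \<Longrightarrow> \<forall>s\<in>{0..<u - e}. y s \<in> K"
  shows "confinement_time K t x - e \<le> confinement_time K t y"
proof -
  have "u \<le> confinement_time K t y + e" if u: "u \<in> {0..t}" "\<forall>s\<in>{0..<u}. x s \<in> K" for u
  proof (cases "u \<le> e")
    case True
    then show ?thesis using confinement_time_bounds(1)[OF assms(1), of K y] by linarith
  next
    case False
    have "u - e \<le> confinement_time K t y"
      unfolding confinement_time_def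
    proof (rule cSup_upper)
      show "u - e \<in> {u \<in> {0..t}. \<forall>s\<in>{0..<u}. y s \<in> K}" using assms(2) assms(3)[OF u] u False by auto
    qed (auto intro: bdd_aboveI[of _ t])
    then show ?thesis by simp
  qed
  moreover have "0 \<in> {u\<in>{0..t}. \<forall>s\<in>{0..<u}. x s \<in> K}" using assms(1) by simp
  ultimately have "confinement_time K t x \<le> confinement_time K t y + e"
    unfolding confinement_time_def[of K t x] by (intro cSup_least) auto
  then show ?thesis by simp
qed

text \<open>The positions of the two paths at corresponding times are closer than \<open>e\<close>, hence both or neither are in \<open>K\<close>, and
  corresponding times differ by less than \<open>e\<close>.\<close>

lemma confinement_time_J1_nbhd:
  fixes x y :: "real \<Rightarrow> 'a::metric_space"
  assumes t: "0 \<le> t" and e: "0 < e"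
    and K: "\<And>v w. dist v w < e \<Longrightarrow> v \<in> K \<longleftrightarrow> w \<in> K"
    and y: "y \<in> J1_nbhd x t e"
  shows "\<bar>confinement_time K t y - confinement_time K t x\<bar> \<le> e"
proof -
  obtain l where l: "strict_mono_on {0..} l" "l ` {0..} = {0..}" "\<And>s. s \<ge> 0 \<Longrightarrow> \<bar>l s - s\<bar> < e"
    and d: "\<And>s. s \<in> {0..t} \<Longrightarrow> dist (y (l s)) (x s) < e"
    using y unfolding J1_nbhd_def time_changes_def by blast
  have iff: "y (l s) \<in> K \<longleftrightarrow> x s \<in> K" if "s \<in> {0..t}" for s using K[OF d[OF that]] .
  have xy: "\<forall>s\<in>{0..<u - e}. y s \<in> K" if u: "u \<in> {0..t}" "\<forall>s\<in>{0..<u}. x s \<in> K" for u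
  proof
    fix s' assume s': "s' \<in> {0..<u - e}"
    then have "s' \<in> l ` {0..}" by (simp add: l(2))
    then obtain s where s: "s \<ge> 0" "s' = l s" by auto
    have "s < u" using l(3)[OF s(1)] s' s(2) by auto
    then show "y s' \<in> K" using iff[of s] s u by auto
  qed
  have yx: "\<forall>s\<in>{0..<u - e}. x s \<in> K" if u: "u \<in> {0..t}" "\<forall>s\<in>{0..<u}. y s \<in> K" for u
  proof
    fix s assume s: "s \<in> {0..<u - e}"
    then have "l s \<in> {0..<u}" using l(3)[of s] l(2) by auto
    then show "x s \<in> K" using iff[of s] s u e by auto
  qed
  have "confinement_time K t x - e \<le> confinement_time K t y"
    by (rule confinement_time_shift[OF t less_imp_le[OF e] xy])
  moreover have "confinement_time K t y - e \<le> confinement_time K t x"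
    by (rule confinement_time_shift[OF t less_imp_le[OF e] yx])
  ultimately show ?thesis by linarith
qed

lemma continuous_map_confinement_time:
  fixes K :: "'a::metric_space set"
  assumes t: "0 < t" and r: "0 < r" and K: "\<And>v w. dist v w < r \<Longrightarrow> v \<in> K \<longleftrightarrow> w \<in> K"
  shows "continuous_map skorokhod_J1 euclideanreal (confinement_time K t)"
  unfolding continuous_map_def
proof (intro conjI allI impI)
  fix U :: "real set" assume U: "openin euclideanreal U"
  show "openin skorokhod_J1 {x \<in> topspace skorokhod_J1. confinement_time K t x \<in> U}"
    unfolding openin_skorokhod_J1 topspace_skorokhod_J1
  proof (intro conjI ballI)
    fix x assume x: "x \<in> {x \<in> cadlag. confinement_time K t x \<in> U}"
    then obtain \<epsilon> where \<epsilon>: "\<epsilon> > 0" "ball (confinement_time K t x) \<epsilon> \<subseteq> U"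
      using U by (auto simp: open_contains_ball)
    define e where "e = min r (\<epsilon> / 2)"
    have e: "e > 0" "e \<le> r" "e < \<epsilon>" using \<epsilon> r by (auto simp: e_def)
    have "J1_nbhd x t e \<subseteq> {x \<in> cadlag. confinement_time K t x \<in> U}"
    proof
      fix y assume y: "y \<in> J1_nbhd x t e"
      have "\<bar>confinement_time K t y - confinement_time K t x\<bar> \<le> e"
        by (rule confinement_time_J1_nbhd[OF less_imp_le[OF t] e(1) K y]) (use e in simp)
      then have "confinement_time K t y \<in> ball (confinement_time K t x) \<epsilon>"
        using e by (simp add: dist_real_def)
      then show "y \<in> {x \<in> cadlag. confinement_time K t x \<in> U}"
        using \<epsilon>(2) y by (auto simp: J1_nbhd_def)
    qed
    then show "\<exists>T>0. \<exists>e>0. J1_nbhd x T e \<subseteq> {x \<in> cadlag. confinement_time K t x \<in> U}" using t e(1) by blast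
  qed auto
qed auto

text \<open>A continuous substitute for the indicator of confinement. It equals \<open>t - s\<close> on paths confined during \<open>[0, t)\<close> and
  vanishes on paths that leave \<open>K\<close> during \<open>[0, s]\<close>.\<close>

definition confinement_ramp :: "'a set \<Rightarrow> real \<Rightarrow> real \<Rightarrow> (real \<Rightarrow> 'a) \<Rightarrow> real" where
  "confinement_ramp K s t x = max s (confinement_time K t x) - s"

lemma confinement_ramp_bounds:
  assumes "0 \<le> s" "s \<le> t" shows "confinement_ramp K s t x \<in> {0..t - s}"
  using confinement_time_bounds(2)[of t K x] assms by (auto simp: confinement_ramp_def)

lemma confinement_ramp_eq_0:
  assumes "0 \<le> s" "s \<le> t" "u \<in> {0..s}" "x u \<notin> K" shows "confinement_ramp K s t x = 0"
proof -
  have "confinement_time K t x \<le> s"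
    unfolding confinement_time_def
  proof (rule cSup_least)
    fix v assume "v \<in> {u \<in> {0..t}. \<forall>s\<in>{0..<u}. x s \<in> K}"
    then show "v \<le> s" using assms by (metis (mono_tags, lifting) atLeastAtMost_iff atLeastLessThan_iff linorder_not_le mem_Collect_eq order_le_less_trans)
  qed (use assms in \<open>auto intro!: exI[of _ 0]\<close>)
  then show ?thesis by (simp add: confinement_ramp_def)
qed

lemma confinement_ramp_eq_top:
  assumes "0 \<le> s" "s \<le> t" "\<forall>u\<in>{0..<t}. x u \<in> K" shows "confinement_ramp K s t x = t - s"
proof -
  have "t \<le> confinement_time K t x"
    unfolding confinement_time_def using assms by (intro cSup_upper bdd_aboveI[of _ t]) auto
  then show ?thesis using confinement_time_bounds(2)[of t K x] assms by (simp add: confinement_ramp_def)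
qed

lemma continuous_map_confinement_ramp:
  fixes K :: "'a::metric_space set"
  assumes t: "0 < t" and r: "0 < r" and K: "\<And>v w. dist v w < r \<Longrightarrow> v \<in> K \<longleftrightarrow> w \<in> K"
  shows "continuous_map skorokhod_J1 euclideanreal (confinement_ramp K s t)"
proof -
  have "continuous_map euclideanreal euclideanreal (\<lambda>u. max s u - s)"
    by (simp, intro continuous_intros)
  from continuous_map_compose[OF continuous_map_confinement_time[OF assms] this]
  show ?thesis by (simp add: o_def confinement_ramp_def[abs_def])
qed

lemma continuous_map_measurable_borel_of:
  assumes f: "continuous_map X euclideanreal f" and M: "sets M = sets (borel_of X)"
  shows "f \<in> borel_measurable M"
proof (rule borel_measurableI)
  fix S :: "real set" assume "open S"
  then have "openin X {x \<in> topspace X. f x \<in> S}" using f by (auto simp: continuous_map_def)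
  moreover have "space M = topspace X"
    using sets_eq_imp_space_eq[OF M] openin_subset by (auto simp: borel_of_def space_measure_of_conv)
  moreover have "f -` S \<inter> topspace X = {x \<in> topspace X. f x \<in> S}" by auto
  ultimately show "f -` S \<inter> space M \<in> sets M"
    unfolding M borel_of_def by (subst sets_measure_of) (auto intro!: sigma_sets.Basic dest: openin_subset)
qed

lemma (in prob_space) expectation_between_events:
  assumes f: "f \<in> borel_measurable M" "\<And>x. x \<in> space M \<Longrightarrow> f x \<in> {0..h}"
    and A: "A \<in> events" and h: "0 \<le> h"
  shows "AE x in M. x \<in> A \<longrightarrow> f x = h \<Longrightarrow> h * prob A \<le> expectation f"
    and "(\<And>x. x \<in> space M \<Longrightarrow> x \<notin> A \<Longrightarrow> f x = 0) \<Longrightarrow> expectation f \<le> h * prob A"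
proof -
  have int: "integrable M f"
    by (rule integrable_const_bound[where B=h]) (use f in \<open>auto intro!: AE_I2 simp: abs_le_iff\<close>)
  have inth: "integrable M (\<lambda>x. h * indicator A x)" using A by (simp add: emeasure_eq_measure)
  have eq: "expectation (\<lambda>x. h * indicator A x) = h * prob A" using A by simp
  show "h * prob A \<le> expectation f" if "AE x in M. x \<in> A \<longrightarrow> f x = h"
    unfolding eq[symmetric]
  proof (rule integral_mono_AE[OF inth int])
    show "AE x in M. h * indicator A x \<le> f x"
      using that AE_space by eventually_elim (use f(2) in \<open>auto simp: indicator_def\<close>)
  qed
  show "expectation f \<le> h * prob A" if "\<And>x. x \<in> space M \<Longrightarrow> x \<notin> A \<Longrightarrow> f x = 0"
    unfolding eq[symmetric]
    by (rule integral_mono[OF int inth]) (use that f(2) in \<open>auto simp: indicator_def\<close>)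
qed

section \<open>Confinement of the walk\<close>

lemma step_path_cadlag:
  assumes c: "0 < c" shows "(\<lambda>t\<in>{0..}. F (nat \<lfloor>c * t\<rfloor>)) \<in> cadlag"
proof -
  let ?x = "\<lambda>t\<in>{0..}. F (nat \<lfloor>c * t\<rfloor>)"
  have "(?x \<longlongrightarrow> ?x t) (at_right t)" if t: "t \<ge> 0" for t
  proof (rule tendsto_eventually)
    have "t < (of_int \<lfloor>c * t\<rfloor> + 1) / c" using c by (simp add: field_simps) linarith
    then have "\<forall>\<^sub>F s in at_right t. s < (of_int \<lfloor>c * t\<rfloor> + 1) / c" "\<forall>\<^sub>F s in at_right t. t < s"
      by (auto intro: eventually_at_right_less simp: eventually_at_right_field)
    then show "\<forall>\<^sub>F s in at_right t. ?x s = ?x t"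
    proof eventually_elim
      case (elim s)
      have "c * s < of_int \<lfloor>c * t\<rfloor> + 1" using elim(1) c by (simp add: field_simps)
      moreover have "c * t \<le> c * s" using elim(2) c by simp
      ultimately have "\<lfloor>c * s\<rfloor> = \<lfloor>c * t\<rfloor>" by linarith
      then show ?case using elim(2) t by simp
    qed
  qed
  moreover have "\<exists>l. (?x \<longlongrightarrow> l) (at_left t)" if t: "t > 0" for t
  proof
    show "(?x \<longlongrightarrow> F (nat (\<lceil>c * t\<rceil> - 1))) (at_left t)"
    proof (rule tendsto_eventually)
      have "(of_int \<lceil>c * t\<rceil> - 1) / c < t" using c by (simp add: field_simps) linarith
      then have "\<forall>\<^sub>F s in at_left t. s > (of_int \<lceil>c * t\<rceil> - 1) / c" "\<forall>\<^sub>F s in at_left t. s > 0" "\<forall>\<^sub>F s in at_left t. s < t"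
        using t by (auto simp: eventually_at_left_field)
      then show "\<forall>\<^sub>F s in at_left t. ?x s = F (nat (\<lceil>c * t\<rceil> - 1))"
      proof eventually_elim
        case (elim s)
        have "c * s > of_int \<lceil>c * t\<rceil> - 1" using elim(1) c by (simp add: field_simps)
        moreover have "c * s < c * t" using elim(3) c by simp
        ultimately have "\<lfloor>c * s\<rfloor> = \<lceil>c * t\<rceil> - 1" by linarith
        then show ?case using elim(2) by simp
      qed
    qed
  qed
  ultimately show ?thesis by (simp add: cadlag_def)
qed

lemma walk_rate_pos: "0 < D \<Longrightarrow> 0 < D * real CARD('p::prime_card) powr (real m * b)"
  by simp

lemma walk_path_cadlag: "0 < D \<Longrightarrow> walk_path b D m \<omega> \<in> cadlag"
  unfolding walk_path_def by (rule step_path_cadlag) (rule walk_rate_pos)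

text \<open>Such a set is open for the product of the discrete topologies. As there are only countably many finite prefixes, it is a
  countable union of cylinders.\<close>

lemma prefix_open_in_PiM:
  fixes A :: "(nat \<Rightarrow> 'a::countable) set" and \<xi> :: "'a pmf"
  assumes A: "\<And>\<omega>. \<omega> \<in> A \<Longrightarrow> \<exists>N. \<forall>\<omega>'. (\<forall>i<N. \<omega>' i = \<omega> i) \<longrightarrow> \<omega>' \<in> A"
  shows "A \<in> sets (\<Pi>\<^sub>M i\<in>UNIV. measure_pmf \<xi>)"
proof -
  define cyl :: "'a list \<Rightarrow> (nat \<Rightarrow> 'a) set" where "cyl l = {\<omega>. \<forall>i<length l. \<omega> i = l ! i}" for l
  have meas: "cyl l \<in> sets (\<Pi>\<^sub>M i\<in>UNIV. measure_pmf \<xi>)" for l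
  proof -
    have "{\<omega> \<in> space (\<Pi>\<^sub>M i\<in>UNIV. measure_pmf \<xi>). \<forall>i\<in>{..<length l}. \<omega> i \<in> {l ! i}} \<in> sets (\<Pi>\<^sub>M i\<in>UNIV. measure_pmf \<xi>)"
      by (intro sets.sets_Collect_finite_All sets_PiM_I_countable measurable_sets_Collect[OF measurable_component_singleton]) auto
    then show ?thesis by (simp add: cyl_def space_PiM Ball_def)
  qed
  have "A = (\<Union>l\<in>{l. cyl l \<subseteq> A}. cyl l)"
  proof
    show "A \<subseteq> (\<Union>l\<in>{l. cyl l \<subseteq> A}. cyl l)"
    proof
      fix \<omega> assume "\<omega> \<in> A"
      then obtain N where "\<forall>\<omega>'. (\<forall>i<N. \<omega>' i = \<omega> i) \<longrightarrow> \<omega>' \<in> A" using A by blast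
      then have "cyl (map \<omega> [0..<N]) \<subseteq> A" "\<omega> \<in> cyl (map \<omega> [0..<N])" by (auto simp: cyl_def)
      then show "\<omega> \<in> (\<Union>l\<in>{l. cyl l \<subseteq> A}. cyl l)" by blast
    qed
  qed auto
  moreover have "(\<Union>l\<in>{l. cyl l \<subseteq> A}. cyl l) \<in> sets (\<Pi>\<^sub>M i\<in>UNIV. measure_pmf \<xi>)"
    by (rule sets.countable_UN') (auto intro: meas)
  ultimately show ?thesis by simp
qed

lemma space_walk_space: "space (\<Pi>\<^sub>M i\<in>UNIV. measure_pmf \<xi>) = UNIV"
  by (simp add: space_PiM)

text \<open>During a bounded time window the path depends on finitely many increments, and a \<open>J\<^sub>1\<close> neighbourhood only tests a bounded
  window.\<close>

lemma walk_path_measurable: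
  assumes D: "0 < D"
  shows "walk_path b D m \<in> measurable (\<Pi>\<^sub>M i\<in>UNIV. measure_pmf (\<xi> :: 'p::prime_card qp_mod_zp pmf)) (borel_of skorokhod_J1)"
  unfolding borel_of_def
proof (rule measurable_measure_of)
  fix U :: "(real \<Rightarrow> 'p padic) set" assume "U \<in> {U. openin skorokhod_J1 U}"
  then have U: "\<And>x. x \<in> U \<Longrightarrow> \<exists>T>0. \<exists>e>0. J1_nbhd x T e \<subseteq> U" by (auto simp: openin_skorokhod_J1)
  let ?r = "D * real CARD('p) powr (real m * b)"
  have "walk_path b D m -` U \<in> sets (\<Pi>\<^sub>M i\<in>UNIV. measure_pmf \<xi>)"
  proof (rule prefix_open_in_PiM)
    fix \<omega> :: "nat \<Rightarrow> 'p qp_mod_zp" assume "\<omega> \<in> walk_path b D m -` U"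
    then have "walk_path b D m \<omega> \<in> U" by simp
    then obtain T e where T: "T > 0" "e > 0" "J1_nbhd (walk_path b D m \<omega>) T e \<subseteq> U" using U by blast
    have "\<omega>' \<in> walk_path b D m -` U" if eq: "\<forall>i<nat \<lfloor>?r * T\<rfloor>. \<omega>' i = \<omega> i" for \<omega>'
    proof -
      have "walk_path b D m \<omega>' s = walk_path b D m \<omega> s" if s: "s \<in> {0..T}" for s
      proof -
        have "?r * s \<le> ?r * T" using s D by (intro mult_left_mono) auto
        then have "nat \<lfloor>?r * s\<rfloor> \<le> nat \<lfloor>?r * T\<rfloor>" by (intro nat_mono floor_mono)
        then have "(\<Sum>i<nat \<lfloor>?r * s\<rfloor>. \<omega>' i) = (\<Sum>i<nat \<lfloor>?r * s\<rfloor>. \<omega> i)" using eq by (intro sum.cong) auto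
        then show ?thesis unfolding walk_path_def by simp
      qed
      then have "walk_path b D m \<omega>' \<in> J1_nbhd (walk_path b D m \<omega>) T e"
        unfolding J1_nbhd_def using T D
        by (auto intro!: walk_path_cadlag bexI[of _ "\<lambda>s. s"] simp: time_changes_def strict_mono_on_def)
      then show ?thesis using T by blast
    qed
    then show "\<exists>N. \<forall>\<omega>'. (\<forall>i<N. \<omega>' i = \<omega> i) \<longrightarrow> \<omega>' \<in> walk_path b D m -` U" by blast
  qed
  then show "walk_path b D m -` U \<inter> space (\<Pi>\<^sub>M i\<in>UNIV. measure_pmf \<xi>) \<in> sets (\<Pi>\<^sub>M i\<in>UNIV. measure_pmf \<xi>)"
    by (simp add: space_walk_space)
qed (auto simp: topspace_skorokhod_J1 openin_skorokhod_J1 walk_path_cadlag D)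

lemma abs_qp_mod_zp_surj: obtains x where "g = abs_qp_mod_zp x"
  using qp_mod_zp.abs_induct[of "\<lambda>g. \<exists>x. g = abs_qp_mod_zp x" g] by blast

lemma qp_ball_add:
  assumes "g \<in> qp_ball k" "g' \<in> qp_ball k" shows "g + g' \<in> (qp_ball k :: 'p::prime_card qp_mod_zp set)"
proof -
  obtain x y where xy: "g = abs_qp_mod_zp x" "g' = abs_qp_mod_zp y" using abs_qp_mod_zp_surj by metis
  show ?thesis using assms norm_padic_add_le_max[of x y] unfolding xy plus_qp_mod_zp.abs_eq abs_in_qp_ball by simp
qed

lemma qp_ball_minus:
  assumes "g \<in> qp_ball k" shows "- g \<in> (qp_ball k :: 'p::prime_card qp_mod_zp set)"
proof -
  obtain x where x: "g = abs_qp_mod_zp x" using abs_qp_mod_zp_surj by metis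
  show ?thesis using assms unfolding x uminus_qp_mod_zp.abs_eq abs_in_qp_ball by simp
qed

text \<open>As \<open>qp_ball k\<close> is a subgroup, the walk leaves it with the first increment outside it.\<close>

lemma partial_sums_in_qp_ball:
  "(\<forall>j\<le>n. (\<Sum>i<(j::nat). \<omega> i) \<in> qp_ball k) \<longleftrightarrow> (\<forall>i<n. \<omega> i \<in> (qp_ball k :: 'p::prime_card qp_mod_zp set))"
proof (intro iffI allI impI)
  fix i assume S: "\<forall>j\<le>n. (\<Sum>i<j. \<omega> i) \<in> qp_ball k" and i: "i < n"
  then have "(\<Sum>i<Suc i. \<omega> i) + - (\<Sum>i<i. \<omega> i) \<in> qp_ball k"
    by (intro qp_ball_add qp_ball_minus; simp del: sum.lessThan_Suc)
  then show "\<omega> i \<in> qp_ball k" by simp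
next
  fix j assume \<omega>: "\<forall>i<n. \<omega> i \<in> qp_ball k" and "j \<le> n"
  then show "(\<Sum>i<j. \<omega> i) \<in> qp_ball k"
    by (induction j) (auto simp: zero_in_qp_ball intro: qp_ball_add)
qed

text \<open>\<open>\<Gamma>\<^sub>m\<close> drops the digits of \<open>p\<^sup>m x\<close> with index at least \<open>m\<close>, which changes \<open>p\<^sup>m x\<close> by an element of \<open>\<int>\<^sub>p\<close>.\<close>

lemma scaling_map_in_padic_ints:
  "scaling_map m g \<in> padic_ints \<longleftrightarrow> (g :: 'p::prime_card qp_mod_zp) \<in> qp_ball m"
proof -
  obtain x :: "'p padic" where x: "g = abs_qp_mod_zp x" using abs_qp_mod_zp_surj by metis
  have "(scaling_map m (abs_qp_mod_zp x) :: 'p padic) = trunc_sum (padic_digit (padic_p ^ m * x)) (int m)"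
    by (simp add: scaling_map.abs_eq trunc_sum_def)
  then have d: "padic_norm (padic_p ^ m * x - scaling_map m (abs_qp_mod_zp x)) \<le> real CARD('p) powi (- int m)"
    using padic_expansion_trunc[OF padic_expansion_digit, of "padic_p ^ m * x" "int m"] by simp
  have "real CARD('p) powi (- int m) \<le> real CARD('p) powi 0"
    by (subst powi_le_iff[OF real_card_gt_1]) simp
  then have d1: "padic_norm (padic_p ^ m * x - scaling_map m (abs_qp_mod_zp x)) \<le> 1" using d by simp
  have "scaling_map m (abs_qp_mod_zp x) \<in> padic_ints \<longleftrightarrow> padic_norm (padic_p ^ m * x) \<le> 1"
    using norm_padic_diff_le_max[of "padic_p ^ m * x" "padic_p ^ m * x - scaling_map m (abs_qp_mod_zp x)"]
      norm_padic_add_le_max[of "scaling_map m (abs_qp_mod_zp x)" "padic_p ^ m * x - scaling_map m (abs_qp_mod_zp x)"] d1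
    unfolding padic_ints_def by auto
  also have "\<dots> \<longleftrightarrow> padic_norm x \<le> real CARD('p) ^ m"
    unfolding norm_padic_mult norm_padic_power norm_padic_p by (simp add: power_one_over field_simps)
  finally show ?thesis unfolding x abs_in_qp_ball .
qed

lemma walk_path_in_padic_ints:
  "t \<ge> 0 \<Longrightarrow> walk_path b D m \<omega> t \<in> padic_ints \<longleftrightarrow>
     (\<Sum>i<nat \<lfloor>D * real CARD('p) powr (real m * b) * t\<rfloor>. \<omega> i) \<in> (qp_ball m :: 'p::prime_card qp_mod_zp set)"
  by (simp add: walk_path_def scaling_map_in_padic_ints)

lemma prob_increments_in:
  "measure (\<Pi>\<^sub>M i\<in>(UNIV::nat set). measure_pmf \<xi>) {\<omega>. \<forall>i<n. \<omega> i \<in> B} = measure_pmf.prob \<xi> B ^ n"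
    and increments_in_measurable: "{\<omega>. \<forall>i<n. \<omega> i \<in> B} \<in> sets (\<Pi>\<^sub>M i\<in>(UNIV::nat set). measure_pmf \<xi>)"
proof -
  interpret product_prob_space "\<lambda>_. measure_pmf \<xi>" "UNIV :: nat set" ..
  have eq: "{\<omega>. \<forall>i<n. \<omega> i \<in> B} = emb UNIV {..<n} (Pi\<^sub>E {..<n} (\<lambda>_. B))"
    by (rule set_eqI) (auto simp: prod_emb_def restrict_PiE_iff)
  show "measure (\<Pi>\<^sub>M i\<in>(UNIV::nat set). measure_pmf \<xi>) {\<omega>. \<forall>i<n. \<omega> i \<in> B} = measure_pmf.prob \<xi> B ^ n"
    unfolding eq by (subst measure_PiM_emb) auto
  show "{\<omega>. \<forall>i<n. \<omega> i \<in> B} \<in> sets (\<Pi>\<^sub>M i\<in>(UNIV::nat set). measure_pmf \<xi>)"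
    unfolding eq by (rule sets_PiM_I) auto
qed

lemma padic_ints_clopen: "dist v w < 1 \<Longrightarrow> v \<in> padic_ints \<longleftrightarrow> (w :: 'p::prime_card padic) \<in> padic_ints"
  unfolding padic_ints_def dist_padic_def
  using norm_padic_add_le_max[of "v - w" w] norm_padic_add_le_max[of "w - v" v] norm_padic_minus_commute[of v w] by auto

text \<open>The walk makes \<open>\<lfloor>rate * t\<rfloor>\<close> steps up to time \<open>t\<close>, and it stays in \<open>\<int>\<^sub>p\<close> exactly if the independent increments
  are all in the subgroup \<open>qp_ball m\<close>.\<close>

lemma walk_confinement_bounds:
  fixes \<xi> :: "'p::prime_card qp_mod_zp pmf" and b D s t :: real and m :: nat
  assumes D: "0 < D" and st: "0 \<le> s" "s < t"
  defines "rate \<equiv> D * real CARD('p) powr (real m * b)"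
  shows "(t - s) * measure_pmf.prob \<xi> (qp_ball m) ^ nat \<lfloor>rate * t\<rfloor>
           \<le> (\<integral>x. confinement_ramp padic_ints s t x \<partial>walk_law b D \<xi> m)" (is ?lower)
    and "(\<integral>x. confinement_ramp padic_ints s t x \<partial>walk_law b D \<xi> m)
           \<le> (t - s) * measure_pmf.prob \<xi> (qp_ball m) ^ nat \<lfloor>rate * s\<rfloor>" (is ?upper)
proof -
  let ?M = "\<Pi>\<^sub>M i\<in>(UNIV::nat set). measure_pmf \<xi>"
  interpret M: prob_space ?M by (rule prob_space_PiM) (rule prob_space_measure_pmf)
  let ?f = "confinement_ramp (padic_ints :: 'p padic set) s t"
  let ?E = "\<lambda>u. {\<omega>. \<forall>i<nat \<lfloor>rate * u\<rfloor>. \<omega> i \<in> (qp_ball m :: 'p qp_mod_zp set)}"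
  have rate: "rate > 0" unfolding rate_def by (rule walk_rate_pos[OF D])
  have f: "?f \<in> borel_measurable (borel_of skorokhod_J1)"
    by (rule continuous_map_measurable_borel_of[OF continuous_map_confinement_ramp[of _ 1]])
       (use st padic_ints_clopen in auto)
  have meas: "(\<lambda>\<omega>. ?f (walk_path b D m \<omega>)) \<in> borel_measurable ?M"
    by (rule measurable_compose[OF walk_path_measurable[OF D] f])
  have int: "(\<integral>x. ?f x \<partial>walk_law b D \<xi> m) = M.expectation (\<lambda>\<omega>. ?f (walk_path b D m \<omega>))"
    unfolding walk_law_def by (rule integral_distr[OF walk_path_measurable[OF D] f])
  have bd: "?f (walk_path b D m \<omega>) \<in> {0..t - s}" for \<omega>
    using st by (intro confinement_ramp_bounds) auto
  have mono: "nat \<lfloor>rate * u\<rfloor> \<le> nat \<lfloor>rate * v\<rfloor>" if "u \<le> v" for u v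
    using that rate by (intro nat_mono floor_mono) simp
  have "(t - s) * M.prob (?E t) \<le> M.expectation (\<lambda>\<omega>. ?f (walk_path b D m \<omega>))"
  proof (rule M.expectation_between_events(1)[OF meas bd increments_in_measurable])
    have "?f (walk_path b D m \<omega>) = t - s" if \<omega>: "\<omega> \<in> ?E t" for \<omega>
    proof (rule confinement_ramp_eq_top)
      show "\<forall>u\<in>{0..<t}. walk_path b D m \<omega> u \<in> padic_ints"
      proof
        fix u assume u: "u \<in> {0..<t}"
        have "\<forall>j\<le>nat \<lfloor>rate * t\<rfloor>. (\<Sum>i<j. \<omega> i) \<in> qp_ball m"
          unfolding partial_sums_in_qp_ball using \<omega> by simp
        then show "walk_path b D m \<omega> u \<in> padic_ints"
          using u mono[of u t] by (simp add: walk_path_in_padic_ints rate_def)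
      qed
    qed (use st in auto)
    then show "AE \<omega> in ?M. \<omega> \<in> ?E t \<longrightarrow> ?f (walk_path b D m \<omega>) = t - s" by simp
  qed (use st in auto)
  then show ?lower unfolding int prob_increments_in .
  have "M.expectation (\<lambda>\<omega>. ?f (walk_path b D m \<omega>)) \<le> (t - s) * M.prob (?E s)"
  proof (rule M.expectation_between_events(2)[OF meas bd increments_in_measurable])
    fix \<omega> assume "\<omega> \<notin> ?E s"
    then obtain j where j: "j \<le> nat \<lfloor>rate * s\<rfloor>" "(\<Sum>i<j. \<omega> i) \<notin> qp_ball m"
      using partial_sums_in_qp_ball[of "nat \<lfloor>rate * s\<rfloor>" \<omega> m] by auto
    \<comment> \<open>the walk is at its \<open>j\<close>-th position at time \<open>j / rate\<close>\<close>
    have js: "real j \<le> rate * s" using j(1) st rate by (simp add: le_nat_iff le_floor_iff)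
    have "rate * (real j / rate) = real j" using rate by simp
    then have "walk_path b D m \<omega> (real j / rate) \<notin> padic_ints"
      using j(2) rate by (subst walk_path_in_padic_ints) (simp_all add: rate_def[symmetric])
    then show "?f (walk_path b D m \<omega>) = 0"
      using st js rate by (intro confinement_ramp_eq_0[of _ _ "real j / rate"]) (auto simp: field_simps)
  qed (use st in auto)
  then show ?upper unfolding int prob_increments_in .
qed

section \<open>Powers tending to an exponential\<close>

lemma exp_minus_taylor:
  assumes "0 \<le> (z::real)" shows "1 - z \<le> exp (- z)" "exp (- z) \<le> 1 - z + z\<^sup>2 / 2"
proof -
  show "1 - z \<le> exp (- z)" using exp_ge_add_one_self[of "- z"] by simp
  have "1 + z + z\<^sup>2 / 2 \<le> exp z" by (rule exp_lower_Taylor_quadratic[OF assms])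
  moreover have "0 < 1 - z + z\<^sup>2 / 2"
    using zero_le_power2[of "z - 1"] by (simp add: power2_eq_square algebra_simps)
  ultimately have "(1 - z + z\<^sup>2 / 2) * (1 + z + z\<^sup>2 / 2) \<le> (1 - z + z\<^sup>2 / 2) * exp z"
    by (intro mult_left_mono) auto
  moreover have "(1 - z + z\<^sup>2 / 2) * (1 + z + z\<^sup>2 / 2) = 1 + (z\<^sup>2)\<^sup>2 / 4"
    by (simp add: power2_eq_square field_simps)
  ultimately have "1 \<le> (1 - z + z\<^sup>2 / 2) * exp z" using zero_le_power2[of "z\<^sup>2"] by linarith
  then show "exp (- z) \<le> 1 - z + z\<^sup>2 / 2" by (simp add: exp_minus field_simps)
qed

text \<open>The \<open>n\<close>-th powers of two numbers in \<open>[0, 1]\<close> differ by at most \<open>n\<close> times their distance, so it suffices that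
  \<open>w\<close> approximates \<open>exp (- \<epsilon>)\<close> up to an error that is small against \<open>1 / n\<close>.\<close>

lemma power_tendsto_exp:
  fixes w \<epsilon> :: "nat \<Rightarrow> real"
  assumes w: "\<And>m. 0 \<le> w m" "\<And>m. w m \<le> 1" and \<epsilon>: "\<And>m. 0 \<le> \<epsilon> m"
    and err: "(\<lambda>m. real (n m) * \<bar>w m - exp (- \<epsilon> m)\<bar>) \<longlonglongrightarrow> 0"
    and L: "(\<lambda>m. real (n m) * \<epsilon> m) \<longlonglongrightarrow> L"
  shows "(\<lambda>m. w m ^ n m) \<longlonglongrightarrow> exp (- L)"
proof -
  have "(\<lambda>m. w m ^ n m - exp (- \<epsilon> m) ^ n m) \<longlonglongrightarrow> 0"
  proof (rule Lim_null_comparison[OF always_eventually err], rule allI)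
    fix m
    show "norm (w m ^ n m - exp (- \<epsilon> m) ^ n m) \<le> real (n m) * \<bar>w m - exp (- \<epsilon> m)\<bar>"
      using norm_power_diff[of "w m" "exp (- \<epsilon> m)" "n m"] w[of m] \<epsilon>[of m] by simp
  qed
  moreover have "(\<lambda>m. exp (- \<epsilon> m) ^ n m) \<longlonglongrightarrow> exp (- L)"
    using tendsto_exp[OF tendsto_minus[OF L]] by (simp add: exp_of_nat_mult[symmetric])
  ultimately show ?thesis using tendsto_add by fastforce
qed

text \<open>The floor changes the exponent by at most \<open>1\<close>, which has no effect in the limit because the base tends to \<open>1\<close>.\<close>

lemma walk_survival_limit:
  fixes w :: "nat \<Rightarrow> real"
  assumes p: "1 < (p::real)" and b: "0 < b" and D: "0 < D" and a: "0 \<le> a" and c: "0 \<le> c"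
    and w: "\<And>m. w m = 1 - c * p powr (- real m * b)" "\<And>m. 0 \<le> w m"
  shows "(\<lambda>m. w m ^ nat \<lfloor>D * p powr (real m * b) * a\<rfloor>) \<longlonglongrightarrow> exp (- (a * (D * c)))"
proof -
  define \<epsilon> where "\<epsilon> m = c * p powr (- real m * b)" for m
  define n where "n m = nat \<lfloor>D * p powr (real m * b) * a\<rfloor>" for m
  have \<epsilon>0: "\<epsilon> m \<ge> 0" for m using c by (simp add: \<epsilon>_def)
  have "p powr (- b) < 1" using p b by (simp add: powr_less_one)
  then have "(\<lambda>m. c * (p powr (- b)) ^ m) \<longlonglongrightarrow> c * 0"
    by (intro tendsto_mult tendsto_const LIMSEQ_power_zero) simp
  moreover have "c * (p powr (- b)) ^ m = \<epsilon> m" for m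
    using p by (simp add: \<epsilon>_def powr_realpow[symmetric] powr_powr mult.commute)
  ultimately have \<epsilon>: "\<epsilon> \<longlonglongrightarrow> 0" by simp
  have main: "D * p powr (real m * b) * a * \<epsilon> m = a * (D * c)" for m
    using p by (simp add: \<epsilon>_def powr_minus field_simps)
  have n: "\<bar>real (n m) - D * p powr (real m * b) * a\<bar> \<le> 1" for m
  proof -
    have "0 \<le> D * p powr (real m * b) * a" using D a by simp
    then show ?thesis unfolding n_def by linarith
  qed
  have "(\<lambda>m. real (n m) * \<epsilon> m - a * (D * c)) \<longlonglongrightarrow> 0"
  proof (rule Lim_null_comparison[OF always_eventually \<epsilon>], rule allI)
    fix m
    have "real (n m) * \<epsilon> m - a * (D * c) = (real (n m) - D * p powr (real m * b) * a) * \<epsilon> m"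
      unfolding main[of m, symmetric] by (simp add: algebra_simps)
    then show "norm (real (n m) * \<epsilon> m - a * (D * c)) \<le> \<epsilon> m"
      using mult_right_mono[OF n[of m] \<epsilon>0[of m]] \<epsilon>0[of m] by (simp add: abs_mult)
  qed
  then have n\<epsilon>: "(\<lambda>m. real (n m) * \<epsilon> m) \<longlonglongrightarrow> a * (D * c)" by (rule LIM_zero_cancel)
  have "(\<lambda>m. w m ^ n m) \<longlonglongrightarrow> exp (- (a * (D * c)))"
  proof (rule power_tendsto_exp[OF w(2) _ \<epsilon>0 _ n\<epsilon>])
    show "w m \<le> 1" for m using \<epsilon>0[of m] by (simp add: w(1) \<epsilon>_def)
    have lim: "(\<lambda>m. real (n m) * \<epsilon> m * \<epsilon> m) \<longlonglongrightarrow> 0"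
      using tendsto_mult[OF n\<epsilon> \<epsilon>] by simp
    show "(\<lambda>m. real (n m) * \<bar>w m - exp (- \<epsilon> m)\<bar>) \<longlonglongrightarrow> 0"
    proof (rule Lim_null_comparison[OF always_eventually lim], rule allI)
      fix m
      have "w m = 1 - \<epsilon> m" by (simp add: w(1) \<epsilon>_def)
      then have "\<bar>w m - exp (- \<epsilon> m)\<bar> \<le> \<epsilon> m * \<epsilon> m"
        using exp_minus_taylor[OF \<epsilon>0[of m]] zero_le_power2[of "\<epsilon> m"] by (simp add: power2_eq_square abs_if)
      then show "norm (real (n m) * \<bar>w m - exp (- \<epsilon> m)\<bar>) \<le> real (n m) * \<epsilon> m * \<epsilon> m"
        by (simp add: mult.assoc mult_left_mono)
    qed
  qed
  then show ?thesis by (simp add: n_def)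
qed

section \<open>Haar measure of balls\<close>

lemma sets_haar [simp, measurable_cong]: "sets (haar :: 'p::prime_card padic measure) = sets borel"
  using is_haar_haar[where 'p='p] by (simp add: is_haar_def)

lemma space_haar [simp]: "space (haar :: 'p::prime_card padic measure) = UNIV"
  using sets_eq_imp_space_eq[OF sets_haar] by simp

lemma emeasure_haar_translate:
  "A \<in> sets borel \<Longrightarrow> emeasure haar ((+) a ` A) = emeasure haar (A :: 'p::prime_card padic set)"
  using is_haar_haar[where 'p='p] by (simp add: is_haar_def)

lemma pball_translate: "(+) a ` pball x n = pball (a + x :: 'p::prime_card padic) n"
proof
  show "pball (a + x) n \<subseteq> (+) a ` pball x n"
  proof
    fix y assume "y \<in> pball (a + x) n"
    then have "y - a \<in> pball x n" by (simp add: pball_def algebra_simps)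
    then show "y \<in> (+) a ` pball x n" by (intro image_eqI[of _ _ "y - a"]) auto
  qed
qed (auto simp: pball_def)

lemma pball_in_borel [measurable]: "pball (x :: 'p::prime_card padic) n \<in> sets borel"
  by (rule borel_open) (rule open_pball)

lemma padic_ints_eq_pball: "padic_ints = pball (0 :: 'p::prime_card padic) 0"
  by (simp add: padic_ints_def pball_def)

lemma padic_ints_in_borel [measurable]: "(padic_ints :: 'p::prime_card padic set) \<in> sets borel"
  unfolding padic_ints_eq_pball by (rule pball_in_borel)

lemma digits_congruent:
  assumes "c < CARD('p)" "d < CARD('p)" "padic_norm (of_nat c - of_nat d :: 'p::prime_card padic) < 1"
  shows "c = d"
proof (rule ccontr)
  assume "c \<noteq> d"
  then have "\<bar>int c - int d\<bar> < int CARD('p)" "int c - int d \<noteq> 0" using assms by auto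
  then have "\<not> int CARD('p) dvd (int c - int d)" by (metis dvd_imp_le_int abs_of_nat linorder_not_le)
  then have "padic_norm (of_int (int c - int d) :: 'p padic) = 1" by (rule norm_padic_of_int_eq_1)
  then show False using assms(3) by simp
qed

lemma pball_split:
  "pball (0 :: 'p::prime_card padic) n = (\<Union>c<CARD('p). pball (of_nat c * padic_p powi n) (n + 1))"
proof
  show "pball (0 :: 'p padic) n \<subseteq> (\<Union>c<CARD('p). pball (of_nat c * padic_p powi n) (n + 1))"
    using padic_next_digit[of _ n] by (force simp: pball_def)
  have "pball (of_nat c * padic_p powi n) (n + 1) \<subseteq> pball (0 :: 'p padic) n" for c
    by (rule pball_sub) (simp_all add: pball_def norm_digit_term_le)
  then show "(\<Union>c<CARD('p). pball (of_nat c * padic_p powi n) (n + 1)) \<subseteq> pball (0 :: 'p padic) n" by blast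
qed

lemma disjoint_pball_split:
  "disjoint_family_on (\<lambda>c. pball (of_nat c * padic_p powi n :: 'p::prime_card padic) (n + 1)) {..<CARD('p)}"
  unfolding disjoint_family_on_def
proof (intro ballI impI)
  let ?P = "real CARD('p)"
  fix c d assume cd: "c \<in> {..<CARD('p)}" "d \<in> {..<CARD('p)}" "c \<noteq> d"
  show "pball (of_nat c * padic_p powi n :: 'p padic) (n + 1) \<inter> pball (of_nat d * padic_p powi n) (n + 1) = {}"
  proof (rule ccontr)
    assume "\<not> ?thesis"
    then obtain y :: "'p padic" where y: "padic_norm (y - of_nat c * padic_p powi n) \<le> ?P powi (- (n + 1))"
        "padic_norm (y - of_nat d * padic_p powi n) \<le> ?P powi (- (n + 1))"
      by (auto simp: pball_def)
    have "(of_nat c - of_nat d) * padic_p powi n = (y - of_nat d * padic_p powi n) - (y - of_nat c * padic_p powi n)"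
      by (simp add: algebra_simps)
    then have "padic_norm ((of_nat c - of_nat d) * padic_p powi n :: 'p padic) \<le> ?P powi (- (n + 1))"
      using norm_padic_diff_le_max[of "y - of_nat d * padic_p powi n" "y - of_nat c * padic_p powi n"] y by simp
    also have "\<dots> < ?P powi (- n)" by (simp only: powi_less_iff[OF real_card_gt_1])
    finally have "padic_norm (of_nat c - of_nat d :: 'p padic) < 1"
      by (simp add: norm_padic_mult norm_padic_p_powi)
    then show False using digits_congruent cd by blast
  qed
qed

lemma card_neq_0: "CARD('p::prime_card) \<noteq> 0"
  using card_pos[where 'p='p] by simp

text \<open>A ball is the disjoint union of \<open>p\<close> translates of the next smaller ball. The values follow from that of \<open>\<int>\<^sub>p\<close> by
  induction in both directions.\<close>

lemma emeasure_haar_pball: "emeasure haar (pball (x :: 'p::prime_card padic) n) = ennreal (real CARD('p) powi (- n))"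
proof -
  let ?P = "real CARD('p)" and ?v = "\<lambda>n. emeasure haar (pball (0 :: 'p padic) n)"
  have tr: "emeasure haar (pball x n) = ?v n" for x :: "'p padic" and n
    using emeasure_haar_translate[OF pball_in_borel[of 0 n], of x] by (simp add: pball_translate)
  have step: "?v n = ennreal ?P * ?v (n + 1)" for n
  proof -
    have "?v n = (\<Sum>c<CARD('p). emeasure haar (pball (of_nat c * padic_p powi n :: 'p padic) (n + 1)))"
      unfolding pball_split[of n] by (rule sum_emeasure[symmetric, OF _ disjoint_pball_split]) auto
    also have "\<dots> = (\<Sum>c<CARD('p). ?v (n + 1))" by (intro sum.cong refl tr)
    finally show ?thesis by (simp add: ennreal_of_nat_eq_real_of_nat)
  qed
  have powi: "ennreal (?P powi (- n)) = ennreal ?P * ennreal (?P powi (- (n + 1)))" for n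
  proof -
    have "?P powi (1 + - (n + 1)) = ?P powi 1 * ?P powi (- (n + 1))" by (rule power_int_add) simp
    then show ?thesis by (simp add: ennreal_mult[symmetric])
  qed
  have "?v n = ennreal (?P powi (- n))" for n
  proof (induction n rule: int_induct[where k=0])
    case base
    show ?case using is_haar_haar[where 'p='p] by (simp add: is_haar_def padic_ints_eq_pball)
  next
    case (step1 i)
    then have "ennreal ?P * ?v (i + 1) = ennreal ?P * ennreal (?P powi (- (i + 1)))"
      using step[of i] powi[of i] by simp
    then show ?case by (simp add: ennreal_mult_cancel_left ennreal_eq_0_iff card_neq_0)
  next
    case (step2 i)
    then show ?case using step[of "i - 1"] powi[of "i - 1"] by simp
  qed
  then show ?thesis using tr[of x n] by simp
qed

lemma UN_pball: "(\<Union>i::nat. pball (0 :: 'p::prime_card padic) (- int i)) = UNIV"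
proof -
  have "\<exists>i. x \<in> pball 0 (- int i)" for x :: "'p padic"
  proof -
    obtain i where "padic_norm x < real CARD('p) ^ i" using real_arch_pow[OF real_card_gt_1] by blast
    then show ?thesis by (intro exI[of _ i]) (simp add: pball_def)
  qed
  then show ?thesis by blast
qed

interpretation haar: sigma_finite_measure "haar :: 'p::prime_card padic measure"
proof
  show "\<exists>A::'p padic set set. countable A \<and> A \<subseteq> sets haar \<and> \<Union>A = space haar \<and> (\<forall>a\<in>A. emeasure haar a \<noteq> \<infinity>)"
    by (rule exI[of _ "range (\<lambda>i::nat. pball 0 (- int i))"]) (auto simp: UN_pball emeasure_haar_pball)
qed

lemma distr_haar_translate: "distr haar haar (\<lambda>x. x + z) = (haar :: 'p::prime_card padic measure)"
proof (rule measure_eqI)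
  have m: "(\<lambda>x. x + z) \<in> measurable haar haar"
    unfolding measurable_cong_sets[OF sets_haar sets_haar]
    by (intro borel_measurable_continuous_onI continuous_intros)
  fix A assume "A \<in> sets (distr haar haar (\<lambda>x. x + z))"
  then have A: "A \<in> sets (borel :: 'p padic measure)" by simp
  have "(\<lambda>x. x + z) -` A = (+) (- z) ` A"
    by (force simp: image_iff intro: bexI[of _ "_ + z"])
  then show "emeasure (distr haar haar (\<lambda>x. x + z)) A = emeasure haar A"
    using A emeasure_haar_translate[OF A, of "- z"] by (simp add: emeasure_distr[OF m])
qed simp

lemma norm_padic_triangle: "padic_norm (x + y) \<le> padic_norm x + padic_norm (y :: 'p::prime_card padic)"
  using norm_padic_add_le_max[of x y] norm_padic_nonneg[of x] norm_padic_nonneg[of y] by linarith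

lemma tendsto_mult_padic:
  fixes f g :: "'a \<Rightarrow> 'p::prime_card padic"
  assumes f: "(f \<longlongrightarrow> u) F" and g: "(g \<longlongrightarrow> v) F"
  shows "((\<lambda>x. f x * g x) \<longlongrightarrow> u * v) F"
  unfolding tendsto_dist_iff[of _ "u * v"]
proof (rule Lim_null_comparison[OF always_eventually], rule allI)
  fix x
  have "f x * g x - u * v = ((f x - u) * (g x - v) + u * (g x - v)) + (f x - u) * v" by (simp add: algebra_simps)
  then have "padic_norm (f x * g x - u * v) \<le>
      padic_norm (f x - u) * padic_norm (g x - v) + padic_norm u * padic_norm (g x - v) + padic_norm (f x - u) * padic_norm v"
    using norm_padic_triangle[of "(f x - u) * (g x - v) + u * (g x - v)" "(f x - u) * v"]
      norm_padic_triangle[of "(f x - u) * (g x - v)" "u * (g x - v)"]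
    by (simp only: norm_padic_mult)
  then show "norm (dist (f x * g x) (u * v)) \<le>
      dist (f x) u * dist (g x) v + padic_norm u * dist (g x) v + dist (f x) u * padic_norm v"
    by (simp add: dist_padic_def)
next
  have "((\<lambda>x. dist (f x) u) \<longlongrightarrow> 0) F" "((\<lambda>x. dist (g x) v) \<longlongrightarrow> 0) F"
    using f g by (simp_all add: tendsto_dist_iff[symmetric])
  then have "((\<lambda>x. dist (f x) u * dist (g x) v + padic_norm u * dist (g x) v + dist (f x) u * padic_norm v)
      \<longlongrightarrow> 0 * 0 + padic_norm u * 0 + 0 * padic_norm v) F"
    by (intro tendsto_intros)
  then show "((\<lambda>x. dist (f x) u * dist (g x) v + padic_norm u * dist (g x) v + dist (f x) u * padic_norm v) \<longlongrightarrow> 0) F"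
    by simp
qed

lemma borel_measurable_padic_mult [measurable]:
  assumes [measurable]: "f \<in> borel_measurable M" "g \<in> borel_measurable M"
  shows "(\<lambda>x. f x * g x :: 'p::prime_card padic) \<in> borel_measurable M"
proof -
  have "continuous_on UNIV (\<lambda>z :: 'p padic \<times> 'p padic. fst z * snd z)"
    unfolding continuous_on_def
    by (intro ballI tendsto_mult_padic tendsto_fst[OF tendsto_ident_at] tendsto_snd[OF tendsto_ident_at])
  from borel_measurable_continuous_onI[OF this]
  have "(\<lambda>z :: 'p padic \<times> 'p padic. fst z * snd z) \<in> borel_measurable (borel \<Otimes>\<^sub>M borel)"
    by (simp add: borel_prod)
  from measurable_compose[OF _ this, of "\<lambda>x. (f x, g x)" M] show ?thesis by simp
qed

lemma borel_measurable_padic_norm [measurable]: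
  "(padic_norm :: 'p::prime_card padic \<Rightarrow> real) \<in> borel_measurable borel"
proof -
  have "continuous_on UNIV (\<lambda>x :: 'p padic. dist x 0)" by (intro continuous_intros)
  from borel_measurable_continuous_onI[OF this] show ?thesis by (simp add: dist_padic_def)
qed

section \<open>The additive character\<close>

lemma power_dvd_of_norm_padic_le:
  "padic_norm (of_int C :: 'p::prime_card padic) \<le> real CARD('p) powi (- int L) \<Longrightarrow> int CARD('p) ^ L dvd C"
proof (induction L arbitrary: C)
  case (Suc L)
  have "real CARD('p) powi (- int (Suc L)) < real CARD('p) powi 0"
    by (subst powi_less_iff[OF real_card_gt_1]) simp
  then have "padic_norm (of_int C :: 'p padic) \<noteq> 1" using Suc.prems by simp
  then have "int CARD('p) dvd C" using norm_padic_of_int_eq_1[of C, where 'p='p] by blast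
  then obtain C' where C: "C = int CARD('p) * C'" by blast
  then have "padic_norm (of_int C' :: 'p padic) = padic_norm (of_int C :: 'p padic) * real CARD('p)"
    by (simp add: norm_padic_mult norm_padic_p)
  also have "\<dots> \<le> real CARD('p) powi (- int (Suc L)) * real CARD('p)"
    using Suc.prems by (intro mult_right_mono) auto
  also have "\<dots> = real CARD('p) powi (- int L)"
    by (simp only: power_int_minus power_int_of_nat) simp
  finally show ?case using Suc.IH[of C'] C by simp
qed simp

lemma digit_sum_eq_fraction:
  assumes "p > 0"
  shows "(\<Sum>k\<in>{- int N..<0}. of_nat (a k) * of_nat p powi k) =
    (of_int (\<Sum>k\<in>{- int N..<0}. int (a k) * int p ^ nat (k + int N)) / of_nat p ^ N :: 'a::field_char_0)"
proof -
  have "of_nat p powi k = (of_nat p ^ nat (k + int N) / of_nat p ^ N :: 'a)" if "k \<in> {- int N..<0}" for k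
  proof -
    have "of_nat p ^ nat (k + int N) = (of_nat p powi (k + int N) :: 'a)" using that by (simp add: power_int_def)
    then show ?thesis using assms by (simp add: power_int_add)
  qed
  then show ?thesis by (simp add: sum_divide_distrib)
qed

text \<open>The digits with negative index form a fraction with a power of \<open>p\<close> as denominator. The same sum read in \<open>\<rat>\<^sub>p\<close> and in the
  reals relates \<open>x\<close> to its fractional part.\<close>

lemma padic_frac_fraction:
  "\<exists>A N. padic_norm (x - of_int A / padic_p ^ N :: 'p::prime_card padic) \<le> 1 \<and> padic_frac x = of_int A / real CARD('p) ^ N"
proof -
  obtain M where M: "\<forall>k<M. padic_digit x k = 0"
    using padic_expansion_digit[of x] unfolding padic_expansion_def by blast
  define N where "N = nat \<bar>M\<bar>"
  have N: "\<forall>k < - int N. padic_digit x k = 0" using M by (simp add: N_def)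
  let ?A = "\<Sum>k\<in>{- int N..<0}. int (padic_digit x k) * int CARD('p) ^ nat (k + int N)"
  have "trunc_sum (padic_digit x) 0 = (of_int ?A / padic_p ^ N :: 'p padic)"
    unfolding trunc_sum_interval[OF N] by (rule digit_sum_eq_fraction) simp
  then have "padic_norm (x - of_int ?A / padic_p ^ N) \<le> 1"
    using padic_expansion_trunc[OF padic_expansion_digit, of x 0] by simp
  moreover have "padic_frac x = (\<Sum>k\<in>{- int N..<0}. real (padic_digit x k) * real CARD('p) powi k)"
    unfolding padic_frac_def by (rule sum.mono_neutral_left) (use N in \<open>auto simp: not_less[symmetric]\<close>)
  then have "padic_frac x = of_int ?A / real CARD('p) ^ N"
    using digit_sum_eq_fraction[of "CARD('p)" "padic_digit x" N, where 'a=real] by simp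
  ultimately show ?thesis by blast
qed

text \<open>Two fractions with powers of \<open>p\<close> as denominators that agree modulo \<open>\<int>\<^sub>p\<close> differ by an integer. So the fractional part of
  \<open>x\<close> may be replaced by any such fraction congruent to \<open>x\<close>, and the additivity of the character becomes that of
  fractions.\<close>

lemma padic_char_fraction:
  assumes "padic_norm (x - of_int B / padic_p ^ M :: 'p::prime_card padic) \<le> 1"
  shows "padic_char x = exp (2 * of_real pi * \<i> * of_real (of_int B / real CARD('p) ^ M))"
proof -
  let ?P = "CARD('p)"
  obtain A N where A: "padic_norm (x - of_int A / padic_p ^ N) \<le> 1" "padic_frac x = of_int A / real ?P ^ N"
    using padic_frac_fraction by blast
  define C where "C = A * int ?P ^ M - B * int ?P ^ N"
  have "(of_int C :: 'p padic) = ((x - of_int B / padic_p ^ M) - (x - of_int A / padic_p ^ N)) * padic_p ^ (M + N)"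
    by (simp add: C_def field_simps power_add card_neq_0)
  then have "padic_norm (of_int C :: 'p padic) = padic_norm ((x - of_int B / padic_p ^ M) - (x - of_int A / padic_p ^ N)) * real ?P powi (- int (M + N))"
    by (simp only: norm_padic_mult norm_padic_power norm_padic_p) (simp add: power_one_over power_int_minus inverse_eq_divide del: of_nat_add)
  also have "\<dots> \<le> 1 * real ?P powi (- int (M + N))"
    using norm_padic_diff_le_max[of "x - of_int B / padic_p ^ M" "x - of_int A / padic_p ^ N"] A(1) assms
    by (intro mult_right_mono) auto
  finally have "int ?P ^ (M + N) dvd C" by (intro power_dvd_of_norm_padic_le) simp
  then obtain k where "C = int ?P ^ (M + N) * k" by blast
  then have "real_of_int (A * int ?P ^ M - B * int ?P ^ N) = real ?P ^ (M + N) * of_int k"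
    unfolding C_def by simp
  then have "of_int A / real ?P ^ N = of_int B / real ?P ^ M + of_int k"
    by (simp add: field_simps power_add)
  then have "padic_char x = exp (2 * of_real pi * \<i> * of_real (of_int B / real ?P ^ M) + 2 * of_int k * of_real pi * \<i>)"
    unfolding padic_char_def A(2) by (simp add: algebra_simps)
  moreover have "exp (2 * of_int k * of_real pi * \<i>) = (1 :: complex)" by (auto simp: exp_eq_1)
  ultimately show ?thesis by (simp add: exp_add)
qed

lemma fraction_add:
  assumes "p > 0"
  shows "of_int (A * int p ^ M + B * int p ^ N) / of_nat p ^ (N + M)
    = (of_int A / of_nat p ^ N + of_int B / of_nat p ^ M :: 'a::field_char_0)"
  using assms by (simp add: field_simps power_add)

lemma padic_char_add: "padic_char (x + y) = padic_char x * padic_char (y :: 'p::prime_card padic)"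
proof -
  obtain A N where A: "padic_norm (x - of_int A / padic_p ^ N) \<le> 1" using padic_frac_fraction by blast
  obtain B M where B: "padic_norm (y - of_int B / padic_p ^ M) \<le> 1" using padic_frac_fraction by blast
  define C where "C = A * int CARD('p) ^ M + B * int CARD('p) ^ N"
  have "padic_norm (x + y - of_int C / padic_p ^ (N + M)) \<le> 1"
    using norm_padic_add_le_max[of "x - of_int A / padic_p ^ N" "y - of_int B / padic_p ^ M"] A B
    unfolding C_def fraction_add[OF card_pos] by (simp add: algebra_simps)
  from padic_char_fraction[OF this]
  have "padic_char (x + y) = exp (2 * of_real pi * \<i> * of_real (of_int A / real CARD('p) ^ N + of_int B / real CARD('p) ^ M))"
    unfolding C_def by (simp only: fraction_add[OF card_pos])
  then show ?thesis
    unfolding padic_char_fraction[OF A] padic_char_fraction[OF B] by (simp add: exp_add[symmetric] algebra_simps)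
qed

lemma padic_char_ints: "x \<in> padic_ints \<Longrightarrow> padic_char (x :: 'p::prime_card padic) = 1"
  using padic_char_fraction[of x 0 0] by (simp add: padic_ints_def)

lemma norm_padic_char [simp]: "norm (padic_char x) = 1"
  by (simp add: padic_char_def norm_exp_eq_Re)

lemma padic_char_inverse_p: "padic_char (1 / padic_p :: 'p::prime_card padic) \<noteq> 1"
proof
  assume "padic_char (1 / padic_p :: 'p padic) = 1"
  moreover have "padic_char (1 / padic_p :: 'p padic) = exp (2 * of_real pi * \<i> * of_real (1 / real CARD('p)))"
    using padic_char_fraction[of "1 / padic_p :: 'p padic" 1 1] by simp
  ultimately obtain k :: int where "2 * pi / real CARD('p) = 2 * of_int k * pi"
    by (auto simp: exp_eq_1)
  then have "1 / real CARD('p) = of_int k" by (simp add: field_simps)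
  then have "of_int (k * int CARD('p)) = (1::real)" by (simp add: field_simps)
  then have "k * int CARD('p) = 1" by (simp only: of_int_eq_1_iff)
  then have "int CARD('p) dvd 1" by (metis dvd_triv_right)
  then show False using card_gt_1[where 'p='p] by simp
qed

lemma borel_measurable_padic_char [measurable]:
  "(padic_char :: 'p::prime_card padic \<Rightarrow> complex) \<in> borel_measurable borel"
proof (rule borel_measurable_continuous_onI)
  have "(padic_char \<longlongrightarrow> padic_char x) (at x)" for x :: "'p padic"
  proof (rule tendsto_eventually)
    have *: "padic_char y = padic_char x" if "dist y x < 1" for y
      using padic_char_add[of x "y - x"] that by (simp add: padic_char_ints padic_ints_def dist_padic_def)
    then show "\<forall>\<^sub>F y in at x. padic_char y = padic_char x"
      unfolding eventually_at by (intro exI[of _ 1] conjI ballI impI *) auto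
  qed
  then show "continuous_on UNIV (padic_char :: 'p padic \<Rightarrow> complex)"
    by (simp add: continuous_on_def)
qed

text \<open>The Fourier transform of the indicator of a ball. If \<open>\<lambda>y. \<chi>(y x)\<close> is not constant on the ball, then translation by an
  element \<open>z\<close> of the ball with \<open>\<chi>(z x) \<noteq> 1\<close> multiplies the integral by \<open>\<chi>(z x)\<close>, and the integral vanishes.\<close>

lemma integral_padic_char_pball:
  fixes x :: "'p::prime_card padic"
  shows "(LINT y|haar. indicator (pball 0 (- n)) y * padic_char (y * x))
    = of_real (real CARD('p) powi n) * indicator (pball 0 n) x" (is "?I = _")
proof (cases "x \<in> pball 0 n")
  let ?P = "real CARD('p)"
  case True
  have one: "padic_char (y * x) = 1" if "y \<in> pball 0 (- n)" for y
  proof -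
    have "padic_norm y * padic_norm x \<le> ?P powi n * ?P powi (- n)"
      using that True by (intro mult_mono) (auto simp: pball_def)
    then show ?thesis by (intro padic_char_ints) (simp add: padic_ints_def norm_padic_mult power_int_minus)
  qed
  have "?I = (LINT y|haar. complex_of_real (indicator (pball (0 :: 'p padic) (- n)) y))"
    by (rule Bochner_Integration.integral_cong) (simp_all add: indicator_def one)
  also have "\<dots> = of_real (LINT y|haar. indicator (pball (0 :: 'p padic) (- n)) y)"
    by (rule integral_of_real) (simp add: integrable_indicator_iff emeasure_haar_pball)
  also have "\<dots> = of_real (?P powi n)"
    by (simp add: measure_def emeasure_haar_pball)
  finally show ?thesis using True by simp
next
  let ?P = "real CARD('p)"
  case False
  then have x: "padic_norm x > ?P powi (- n)" by (simp add: pball_def)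
  have "0 \<le> ?P powi (- n)" by simp
  then have xpos: "padic_norm x > 0" using x by linarith
  then have x0: "x \<noteq> 0" by auto
  have "padic_norm x \<ge> ?P powi (- n + 1)"
    using norm_padic_less_iff[of x "- n + 1"] x by (auto simp: not_less[symmetric])
  moreover have "?P powi (- n + 1) = ?P powi (- n) * ?P powi 1" by (rule power_int_add) simp
  ultimately have nx: "padic_norm x \<ge> ?P * ?P powi (- n)" by (simp add: mult.commute)
  \<comment> \<open>a translation under which the integrand picks up the factor \<open>\<chi>(1/p) \<noteq> 1\<close>\<close>
  define z where "z = 1 / (padic_p * x)"
  have "padic_norm z = ?P / padic_norm x"
    by (simp add: z_def norm_padic_divide norm_padic_mult norm_padic_p)
  also have "\<dots> \<le> ?P powi n"
  proof -
    have "?P * ?P powi (- n) * ?P powi n \<le> padic_norm x * ?P powi n"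
      by (intro mult_right_mono nx) simp
    moreover have "?P powi (- n) * ?P powi n = 1" by (simp add: power_int_minus)
    ultimately have "?P \<le> padic_norm x * ?P powi n" by (simp only: mult.assoc mult_1_right)
    then show ?thesis using xpos by (simp only: pos_divide_le_eq mult.commute)
  qed
  finally have z: "padic_norm z \<le> ?P powi n" .
  have ball: "y + z \<in> pball 0 (- n) \<longleftrightarrow> y \<in> pball 0 (- n)" for y
    using z norm_padic_add_le_max[of y z] norm_padic_diff_le_max[of "y + z" z] by (auto simp: pball_def)
  have zx: "z * x = 1 / padic_p" using x0 by (simp add: z_def)
  have "?I = (LINT y|distr haar haar (\<lambda>y. y + z). indicator (pball 0 (- n)) y * padic_char (y * x))"
    by (simp only: distr_haar_translate)
  also have "\<dots> = (LINT y|haar. indicator (pball 0 (- n)) (y + z) * padic_char ((y + z) * x))"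
  proof (rule integral_distr)
    show "(\<lambda>x. x + z) \<in> measurable haar haar"
      unfolding measurable_cong_sets[OF sets_haar sets_haar]
      by (intro borel_measurable_continuous_onI continuous_intros)
  qed measurable
  also have "\<dots> = (LINT y|haar. padic_char (1 / padic_p :: 'p padic) * (indicator (pball 0 (- n)) y * padic_char (y * x)))"
    by (intro Bochner_Integration.integral_cong)
       (simp_all add: indicator_def ball distrib_right padic_char_add zx)
  also have "\<dots> = padic_char (1 / padic_p :: 'p padic) * ?I" by simp
  finally have "?I = 0 \<or> padic_char (1 / padic_p :: 'p padic) = 1" by (simp only: mult_cancel_right1)
  then have "?I = 0" using padic_char_inverse_p[where 'p='p] by blast
  then show ?thesis using False by simp
qed

section \<open>The increments of the limit process\<close>

text \<open>The function whose Fourier transform is the transition density at time \<open>t\<close>, with \<open>c = \<sigma> t\<close>.\<close>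

definition stable_cf :: "real \<Rightarrow> real \<Rightarrow> 'p::prime_card padic \<Rightarrow> real" where
  "stable_cf b c y = exp (- (c * padic_norm y powr b))"

lemma borel_measurable_stable_cf [measurable]: "stable_cf b c \<in> borel_measurable borel"
  unfolding stable_cf_def[abs_def] by measurable

lemma transition_density_stable_cf:
  "transition_density b \<sigma> t x = (LINT y|haar. padic_char (x * y) * of_real (stable_cf b (\<sigma> * t) y))"
  by (simp add: transition_density_def stable_cf_def)

lemma integrable_padic_char_stable_cf:
  fixes x :: "'p::prime_card padic"
  shows "integrable haar (\<lambda>y. padic_char (x * y) * of_real (stable_cf b c y)) \<longleftrightarrow>
     integrable haar (stable_cf b c :: 'p padic \<Rightarrow> real)"
proof -
  have "integrable haar (\<lambda>y. norm (padic_char (x * y) * complex_of_real (stable_cf b c y))) \<longleftrightarrow>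
      integrable haar (\<lambda>y. padic_char (x * y) * complex_of_real (stable_cf b c y))"
    by (rule integrable_norm_iff) measurable
  moreover have "norm (padic_char (x * y) * complex_of_real (stable_cf b c y)) = stable_cf b c y" for y
    by (simp add: norm_mult stable_cf_def)
  ultimately show ?thesis by simp
qed

text \<open>Fubini, applied to the defining integral of the density restricted to a set of finite measure.\<close>

lemma integral_transition_density:
  fixes A :: "'p::prime_card padic set"
  assumes g: "integrable haar (stable_cf b (\<sigma> * t) :: 'p padic \<Rightarrow> real)"
    and A: "A \<in> sets borel" "emeasure haar A < \<infinity>"
  shows "integrable haar (\<lambda>x. indicator A x * transition_density b \<sigma> t x)"
    and "(LINT x|haar. indicator A x * transition_density b \<sigma> t x)
       = (LINT y|haar. of_real (stable_cf b (\<sigma> * t) y) * (LINT x|haar. indicator A x * padic_char (x * y)))"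
proof -
  interpret pair_sigma_finite "haar :: 'p padic measure" "haar :: 'p padic measure" ..
  let ?g = "stable_cf b (\<sigma> * t) :: 'p padic \<Rightarrow> real"
  let ?f = "\<lambda>x y. indicator A x * (padic_char (x * y) * complex_of_real (?g y))"
  note A(1)[measurable]
  have norm: "norm (?f x y) = indicator A x * ?g y" for x y
    by (simp add: norm_mult stable_cf_def indicator_def)
  have f: "integrable (haar \<Otimes>\<^sub>M haar) (case_prod ?f)"
  proof (rule Fubini_integrable)
    show "case_prod ?f \<in> borel_measurable (haar \<Otimes>\<^sub>M haar)" by measurable
    have "integrable haar (\<lambda>x. indicator A x * (LINT y|haar. ?g y))"
      using A by (intro integrable_mult_left) (simp add: integrable_indicator_iff)
    then show "integrable haar (\<lambda>x. LINT y|haar. norm (case (x, y) of (x, y) \<Rightarrow> ?f x y))"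
      by (simp only: prod.case norm) simp
    show "AE x in haar. integrable haar (\<lambda>y. case (x, y) of (x, y) \<Rightarrow> ?f x y)"
      using g by (simp add: integrable_padic_char_stable_cf integrable_mult_right)
  qed
  have eq: "(LINT y|haar. ?f x y) = indicator A x * transition_density b \<sigma> t x" for x
    by (simp add: transition_density_stable_cf)
  show "integrable haar (\<lambda>x. indicator A x * transition_density b \<sigma> t x)"
    using integrable_fst'[OF f] by (simp only: prod.case eq)
  have "(LINT x|haar. indicator A x * transition_density b \<sigma> t x) = (LINT x|haar. LINT y|haar. ?f x y)"
    by (simp only: eq)
  also have "\<dots> = (LINT y|haar. LINT x|haar. ?f x y)" by (rule Fubini_integral[OF f, symmetric])
  also have "\<dots> = (LINT y|haar. of_real (?g y) * (LINT x|haar. indicator A x * padic_char (x * y)))"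
  proof (rule Bochner_Integration.integral_cong[OF refl])
    fix y
    have "(LINT x|haar. ?f x y) = (LINT x|haar. of_real (?g y) * (indicator A x * padic_char (x * y)))"
      by (rule Bochner_Integration.integral_cong) (simp_all add: mult_ac)
    then show "(LINT x|haar. ?f x y) = of_real (?g y) * (LINT x|haar. indicator A x * padic_char (x * y))"
      by simp
  qed
  finally show "(LINT x|haar. indicator A x * transition_density b \<sigma> t x)
       = (LINT y|haar. of_real (?g y) * (LINT x|haar. indicator A x * padic_char (x * y)))" .
qed

lemma integrable_indicator_haar:
  fixes f :: "'p::prime_card padic \<Rightarrow> real"
  assumes f: "f \<in> borel_measurable borel" "\<And>y. y \<in> pball x n \<Longrightarrow> \<bar>f y\<bar> \<le> B"
  shows "integrable haar (\<lambda>y. indicator (pball x n) y * f y)"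
proof (rule Bochner_Integration.integrable_bound)
  note f(1)[measurable]
  show "integrable haar (\<lambda>y. B * indicator (pball x n) y :: real)"
    by (intro integrable_mult_right) (simp add: integrable_indicator_iff emeasure_haar_pball)
  show "(\<lambda>y. indicator (pball x n) y * f y) \<in> borel_measurable haar" by measurable
  have "norm (indicator (pball x n) y * f y) \<le> norm (B * indicator (pball x n) y)" for y
    using f(2)[of y] by (auto simp: indicator_def)
  then show "AE y in haar. norm (indicator (pball x n) y * f y) \<le> norm (B * indicator (pball x n) y)" by simp
qed

lemma integral_Re_transition_density_pball:
  assumes g: "integrable haar (stable_cf b (\<sigma> * t) :: 'p::prime_card padic \<Rightarrow> real)"
  shows "integrable haar (\<lambda>x :: 'p padic. indicator (pball 0 (- n)) x * Re (transition_density b \<sigma> t x))"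
    and "(LINT x|haar. indicator (pball (0 :: 'p padic) (- n)) x * Re (transition_density b \<sigma> t x))
       = real CARD('p) powi n * (LINT y|haar. indicator (pball (0 :: 'p padic) n) y * stable_cf b (\<sigma> * t) y)"
proof -
  let ?g = "stable_cf b (\<sigma> * t) :: 'p padic \<Rightarrow> real"
  let ?B = "pball (0 :: 'p padic) (- n)"
  have fin: "emeasure haar ?B < \<infinity>" by (simp add: emeasure_haar_pball)
  have Re: "indicator ?B x * Re (transition_density b \<sigma> t x) = Re (indicator ?B x * transition_density b \<sigma> t x)" for x
    by (simp add: indicator_def)
  note int = integral_transition_density(1)[OF g pball_in_borel fin]
  show "integrable haar (\<lambda>x. indicator ?B x * Re (transition_density b \<sigma> t x))"
    unfolding Re by (rule integrable_Re[OF int])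
  have "(LINT x|haar. indicator ?B x * Re (transition_density b \<sigma> t x))
      = Re (LINT x|haar. indicator ?B x * transition_density b \<sigma> t x)"
    unfolding Re by (rule integral_Re[OF int])
  also have "(LINT x|haar. indicator ?B x * transition_density b \<sigma> t x)
      = (LINT y|haar. of_real (?g y) * (of_real (real CARD('p) powi n) * indicator (pball 0 n) y))"
    unfolding integral_transition_density(2)[OF g pball_in_borel fin] integral_padic_char_pball ..
  also have "\<dots> = (LINT y|haar. complex_of_real (real CARD('p) powi n * (indicator (pball 0 n) y * ?g y)))"
    by (rule Bochner_Integration.integral_cong) (simp_all add: indicator_def)
  also have "\<dots> = complex_of_real (LINT y|haar. real CARD('p) powi n * (indicator (pball 0 n) y * ?g y))"
    by (rule integral_complex_of_real)
  finally show "(LINT x|haar. indicator ?B x * Re (transition_density b \<sigma> t x))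
       = real CARD('p) powi n * (LINT y|haar. indicator (pball 0 n) y * ?g y)"
    by (simp only: Re_complex_of_real integral_mult_right_zero)
qed

text \<open>In general only an inequality, because \<open>ennreal\<close> replaces negative values of \<open>h\<close> by \<open>0\<close>.\<close>

lemma (in prob_space) prob_ge_integral_density:
  assumes X: "distributed M N X (\<lambda>z. ennreal (h z))" and A: "A \<in> sets N"
    and int: "integrable N (\<lambda>z. indicator A z * h z)"
  shows "(LINT z|N. indicator A z * h z) \<le> prob (X -` A \<inter> space M)"
proof -
  have int': "integrable N (\<lambda>z. max 0 (indicator A z * h z))" using int by simp
  have "ennreal (LINT z|N. indicator A z * h z) \<le> ennreal (LINT z|N. max 0 (indicator A z * h z))"
    by (intro ennreal_leI integral_mono int int') auto
  also have "\<dots> = (\<integral>\<^sup>+z. ennreal (max 0 (indicator A z * h z)) \<partial>N)"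
    by (rule nn_integral_eq_integral[symmetric, OF int']) simp
  also have "\<dots> = (\<integral>\<^sup>+z. ennreal (h z) * indicator A z \<partial>N)"
    by (rule nn_integral_cong) (auto simp: indicator_def max_def ennreal_neg)
  also have "\<dots> = emeasure M (X -` A \<inter> space M)"
    by (rule distributed_emeasure[symmetric, OF X A])
  finally show ?thesis by (simp add: emeasure_eq_measure)
qed

text \<open>If the integral defining the density did not converge, its value would be \<open>0\<close> at every point, and \<open>0\<close> is not a
  probability density.\<close>

lemma (in prob_space) integrable_stable_cf:
  fixes X :: "'a \<Rightarrow> 'p::prime_card padic"
  assumes X: "distributed M haar X (\<lambda>z. ennreal (Re (transition_density b \<sigma> t z)))"
  shows "integrable haar (stable_cf b (\<sigma> * t) :: 'p padic \<Rightarrow> real)"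
proof (rule ccontr)
  assume "\<not> ?thesis"
  then have "transition_density b \<sigma> t z = 0" for z :: "'p padic"
    unfolding transition_density_stable_cf
    by (intro not_integrable_integral_eq) (simp add: integrable_padic_char_stable_cf)
  then have "emeasure M (X -` UNIV \<inter> space M) = 0"
    by (subst distributed_emeasure[OF X]) simp_all
  then show False by (simp add: emeasure_space_1)
qed

lemma stable_cf_pball_bounds:
  fixes y :: "'p::prime_card padic"
  assumes "0 \<le> b" "0 \<le> c"
  shows "stable_cf b c y \<le> 1" "stable_cf b c y \<ge> 0"
    "y \<in> pball 0 n \<Longrightarrow> exp (- (c * (real CARD('p) powi (- n)) powr b)) \<le> stable_cf b c y"
proof -
  show "stable_cf b c y \<le> 1" "stable_cf b c y \<ge> 0" using assms by (simp_all add: stable_cf_def)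
  assume "y \<in> pball 0 n"
  then have "padic_norm y powr b \<le> (real CARD('p) powi (- n)) powr b"
    using assms by (intro powr_mono2) (auto simp: pball_def)
  then show "exp (- (c * (real CARD('p) powi (- n)) powr b)) \<le> stable_cf b c y"
    unfolding stable_cf_def using assms by (simp add: mult_left_mono)
qed

text \<open>Let \<open>q\<^sub>n\<close> be the integral of the density over the ball \<open>p\<^bsup>-n\<^esup>\<int>\<^sub>p\<close>. It is the mean of \<open>exp (- \<sigma> t \<bar>y\<bar>\<^sup>b)\<close> over
  \<open>p\<^sup>n\<int>\<^sub>p\<close> and tends to \<open>1\<close>. The increment lies in \<open>\<int>\<^sub>p\<close> with probability at least \<open>q\<^sub>0\<close>, and in
  \<open>p\<^bsup>-n\<^esup>\<int>\<^sub>p\<close> but not in \<open>\<int>\<^sub>p\<close> with probability at least \<open>q\<^sub>n - q\<^sub>0\<close>. As both events are disjoint, the first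
  bound must be an equality.\<close>

lemma (in prob_space) prob_increment_in_padic_ints:
  fixes X :: "'a \<Rightarrow> 'p::prime_card padic"
  assumes X: "distributed M haar X (\<lambda>z. ennreal (Re (transition_density b \<sigma> t z)))"
    and b: "0 < b" and c: "0 \<le> \<sigma> * t"
  shows "prob (X -` padic_ints \<inter> space M) = (LINT y|haar. indicator (padic_ints :: 'p padic set) y * stable_cf b (\<sigma> * t) y)"
proof -
  let ?g = "stable_cf b (\<sigma> * t) :: 'p padic \<Rightarrow> real" and ?P = "real CARD('p)"
  let ?h = "\<lambda>z :: 'p padic. Re (transition_density b \<sigma> t z)"
  let ?B = "\<lambda>n. pball (0 :: 'p padic) (- int n)"
  note g = integrable_stable_cf[OF X]
  define q where "q n = (LINT x|haar. indicator (?B n) x * ?h x)" for n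
  have int: "integrable haar (\<lambda>x. indicator (?B n) x * ?h x)" for n
    by (rule integral_Re_transition_density_pball(1)[OF g])
  have q: "q n = ?P powi int n * (LINT y|haar. indicator (pball 0 (int n)) y * ?g y)" for n
    unfolding q_def by (rule integral_Re_transition_density_pball(2)[OF g])
  have q_ge: "exp (- (\<sigma> * t * (?P powi (- int n)) powr b)) \<le> q n" (is "?e \<le> _") for n
  proof -
    have "?P powi (- int n) * ?e = (LINT y|haar. indicator (pball (0 :: 'p padic) (int n)) y * ?e)"
      by (simp add: measure_def emeasure_haar_pball)
    also have "\<dots> \<le> (LINT y|haar. indicator (pball (0 :: 'p padic) (int n)) y * ?g y)"
    proof (rule integral_mono)
      show "integrable haar (\<lambda>y. indicator (pball (0 :: 'p padic) (int n)) y * ?e)"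
        by (rule integrable_indicator_haar[of _ _ _ ?e]) auto
      show "integrable haar (\<lambda>y. indicator (pball (0 :: 'p padic) (int n)) y * ?g y)"
        by (rule integrable_indicator_haar[of _ _ _ 1])
           (use stable_cf_pball_bounds(1,2)[of b "\<sigma> * t", where 'p='p] b c in \<open>auto simp: abs_of_nonneg\<close>)
    qed (use stable_cf_pball_bounds(3)[of b "\<sigma> * t", where 'p='p] b c in \<open>auto simp: indicator_def\<close>)
    finally have "?P powi int n * (?P powi (- int n) * ?e) \<le> q n"
      unfolding q by (intro mult_left_mono) auto
    moreover have "?P powi int n * ?P powi (- int n) = 1" by (simp add: power_int_minus)
    ultimately show ?thesis by (simp only: mult.assoc[symmetric] mult_1_left)
  qed
  have rv: "X -` A \<inter> space M \<in> events" if "A \<in> sets borel" for A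
    using distributed_measurable[OF X] that by (auto intro: measurable_sets)
  have B0: "?B 0 = padic_ints" by (simp add: padic_ints_eq_pball)
  have low: "q 0 \<le> prob (X -` padic_ints \<inter> space M)"
    unfolding q_def B0[symmetric] by (rule prob_ge_integral_density[OF X _ int]) simp
  have up: "prob (X -` padic_ints \<inter> space M) \<le> 1 - q n + q 0" for n
  proof -
    have sub: "padic_ints \<subseteq> ?B n" unfolding B0[symmetric] by (rule pball_sub[OF pball_self]) simp
    have ind: "indicator (?B n - padic_ints) x * ?h x = indicator (?B n) x * ?h x - indicator (?B 0) x * ?h x" for x
      unfolding B0 using sub by (auto simp: indicator_def)
    have "(LINT x|haar. indicator (?B n - padic_ints) x * ?h x) \<le> prob (X -` (?B n - padic_ints) \<inter> space M)"
    proof (rule prob_ge_integral_density[OF X])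
      show "integrable haar (\<lambda>z. indicator (?B n - padic_ints) z * ?h z)"
        unfolding ind by (intro Bochner_Integration.integrable_diff int)
    qed (simp add: sets.Diff)
    then have "q n - q 0 \<le> prob (X -` (?B n - padic_ints) \<inter> space M)"
      unfolding ind q_def by (subst (asm) Bochner_Integration.integral_diff[OF int int])
    moreover have "prob (X -` padic_ints \<inter> space M) + prob (X -` (?B n - padic_ints) \<inter> space M)
        = prob ((X -` padic_ints \<inter> space M) \<union> (X -` (?B n - padic_ints) \<inter> space M))"
      by (rule finite_measure_Union[symmetric]) (auto intro!: rv)
    moreover have "prob ((X -` padic_ints \<inter> space M) \<union> (X -` (?B n - padic_ints) \<inter> space M)) \<le> 1"
      by (rule prob_le_1)
    ultimately show ?thesis by linarith
  qed
  have "(\<lambda>n. exp (- (\<sigma> * t * (?P powi (- int n)) powr b))) \<longlonglongrightarrow> exp (- (\<sigma> * t * 0))"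
    using tendsto_powr'[OF powi_LIMSEQ_0[where 'p='p] tendsto_const[of b]] b
    by (intro tendsto_intros) simp
  then have "(\<lambda>n. 1 - exp (- (\<sigma> * t * (?P powi (- int n)) powr b)) + q 0) \<longlonglongrightarrow> 1 - 1 + q 0"
    by (intro tendsto_intros) simp
  moreover have "prob (X -` padic_ints \<inter> space M) \<le> 1 - exp (- (\<sigma> * t * (?P powi (- int n)) powr b)) + q 0" for n
    using up[of n] q_ge[of n] by linarith
  ultimately have "prob (X -` padic_ints \<inter> space M) \<le> 1 - 1 + q 0"
    by (intro LIMSEQ_le_const) auto
  then have "prob (X -` padic_ints \<inter> space M) = q 0" using low by linarith
  then show ?thesis by (simp add: q padic_ints_eq_pball)
qed

text \<open>The constant \<open>\<kappa>\<close> for which the limit process with diffusion coefficient \<open>\<sigma>\<close> leaves \<open>\<int>\<^sub>p\<close> at rate \<open>\<sigma> \<kappa>\<close>.\<close>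

definition stable_rate :: "'p::prime_card itself \<Rightarrow> real \<Rightarrow> real" where
  "stable_rate _ b = (LINT y|haar. indicator (padic_ints :: 'p padic set) y * padic_norm y powr b)"

lemma padic_norm_powr_bounds:
  assumes "0 \<le> b" "y \<in> padic_ints"
  shows "0 \<le> padic_norm (y :: 'p::prime_card padic) powr b" "padic_norm y powr b \<le> 1"
  using assms powr_mono2[of b "padic_norm y" 1] by (auto simp: padic_ints_def)

lemma integrable_indicator_padic_ints:
  fixes f :: "'p::prime_card padic \<Rightarrow> real"
  assumes "f \<in> borel_measurable borel" "\<And>y. y \<in> padic_ints \<Longrightarrow> \<bar>f y\<bar> \<le> B"
  shows "integrable haar (\<lambda>y. indicator padic_ints y * f y)"
  using integrable_indicator_haar[of f 0 0 B] assms unfolding padic_ints_eq_pball by blast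

lemma integral_indicator_padic_ints_const:
  "(LINT y|haar. indicator (padic_ints :: 'p::prime_card padic set) y * c) = (c::real)"
  unfolding padic_ints_eq_pball by (simp add: measure_def emeasure_haar_pball)

lemma stable_rate_bounds:
  assumes "0 \<le> b" shows "0 \<le> stable_rate TYPE('p::prime_card) b" "stable_rate TYPE('p) b \<le> 1"
proof -
  note bounds = padic_norm_powr_bounds[OF assms, where 'p='p]
  have int: "integrable haar (\<lambda>y. indicator (padic_ints :: 'p padic set) y * padic_norm y powr b)"
    by (rule integrable_indicator_padic_ints[where B=1]) (use bounds in auto)
  have int1: "integrable haar (\<lambda>y. indicator (padic_ints :: 'p padic set) y * (1::real))"
    by (rule integrable_indicator_padic_ints[where B=1]) auto
  show "0 \<le> stable_rate TYPE('p) b"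
    unfolding stable_rate_def by (rule Bochner_Integration.integral_nonneg) (use bounds in \<open>auto simp: indicator_def\<close>)
  have "stable_rate TYPE('p) b \<le> (LINT y|haar. indicator (padic_ints :: 'p padic set) y * 1)"
    unfolding stable_rate_def by (rule integral_mono[OF int int1]) (use bounds in \<open>auto simp: indicator_def\<close>)
  then show "stable_rate TYPE('p) b \<le> 1" unfolding integral_indicator_padic_ints_const .
qed

lemma integral_stable_cf_padic_ints:
  assumes b: "0 \<le> b" and c: "0 \<le> c"
  defines "q \<equiv> (LINT y|haar. indicator (padic_ints :: 'p::prime_card padic set) y * stable_cf b c y)"
  shows "0 \<le> q" "q \<le> 1" "\<bar>q - exp (- (c * stable_rate TYPE('p) b))\<bar> \<le> c\<^sup>2"
proof -
  let ?\<kappa> = "stable_rate TYPE('p) b" and ?I = "indicator (padic_ints :: 'p padic set) :: 'p padic \<Rightarrow> real"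
  let ?g = "stable_cf b c :: 'p padic \<Rightarrow> real"
  note bounds = padic_norm_powr_bounds[OF b, where 'p='p]
  note gb = stable_cf_pball_bounds(1,2)[OF b c, where 'p='p]
  have ig: "integrable haar (\<lambda>y. ?I y * ?g y)"
    by (rule integrable_indicator_padic_ints[where B=1]) (use gb in auto)
  have in': "integrable haar (\<lambda>y. ?I y * padic_norm y powr b)"
    by (rule integrable_indicator_padic_ints[where B=1]) (use bounds in auto)
  have ic: "integrable haar (\<lambda>y. ?I y * B)" for B
    by (rule integrable_indicator_padic_ints[where B="\<bar>B\<bar>"]) auto
  show "0 \<le> q" unfolding q_def by (rule Bochner_Integration.integral_nonneg) (use gb in auto)
  have "q \<le> (LINT y|haar. ?I y * 1)"
    unfolding q_def by (rule integral_mono[OF ig ic]) (use gb in \<open>auto simp: indicator_def\<close>)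
  then show "q \<le> 1" unfolding integral_indicator_padic_ints_const .
  have lin: "(LINT y|haar. ?I y * B - c * (?I y * padic_norm y powr b)) = B - c * ?\<kappa>" for B
    unfolding stable_rate_def using ic[of B] in'
    by (simp only: Bochner_Integration.integral_diff integrable_mult_right integral_mult_right_zero integral_indicator_padic_ints_const)
  have taylor: "1 - c * padic_norm y powr b \<le> ?g y" "?g y \<le> 1 + c\<^sup>2 / 2 - c * padic_norm y powr b"
    if "y \<in> padic_ints" for y
  proof -
    let ?z = "c * padic_norm y powr b"
    have z: "0 \<le> ?z" "?z \<le> c" using bounds[OF that] c mult_left_mono[of "padic_norm y powr b" 1 c] by auto
    then have "?z\<^sup>2 \<le> c\<^sup>2" by (intro power_mono)
    then show "1 - ?z \<le> ?g y" "?g y \<le> 1 + c\<^sup>2 / 2 - ?z"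
      unfolding stable_cf_def using exp_minus_taylor[OF z(1)] by linarith+
  qed
  have il: "integrable haar (\<lambda>y. ?I y * B - c * (?I y * padic_norm y powr b))" for B
    by (intro Bochner_Integration.integrable_diff integrable_mult_right ic in')
  have "1 - c * ?\<kappa> \<le> q" unfolding lin[symmetric] q_def
    by (rule integral_mono[OF il ig]) (use taylor in \<open>auto simp: indicator_def\<close>)
  moreover have "q \<le> 1 + c\<^sup>2 / 2 - c * ?\<kappa>" unfolding lin[symmetric] q_def
    by (rule integral_mono[OF ig il]) (use taylor in \<open>auto simp: indicator_def\<close>)
  moreover have "0 \<le> c * ?\<kappa>" "c * ?\<kappa> \<le> c"
    using stable_rate_bounds[OF b, where 'p='p] c mult_left_mono[of ?\<kappa> 1 c] by auto
  moreover from this have "(c * ?\<kappa>)\<^sup>2 \<le> c\<^sup>2" by (intro power_mono)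
  ultimately show "\<bar>q - exp (- (c * ?\<kappa>))\<bar> \<le> c\<^sup>2"
    using exp_minus_taylor[of "c * ?\<kappa>"] zero_le_power2[of c] by linarith
qed

text \<open>The \<open>N\<close>-th power of the probability that an increment over the \<open>N\<close>-th part of the time span lies in \<open>\<int>\<^sub>p\<close>. This
  probability is \<open>exp (- c \<kappa> / N)\<close> up to an error of order \<open>1 / N\<^sup>2\<close>.\<close>

lemma stable_survival_limit:
  assumes b: "0 \<le> b" and c: "0 \<le> c"
  defines "q \<equiv> \<lambda>N. (LINT y|haar. indicator (padic_ints :: 'p::prime_card padic set) y * stable_cf b (c / real N) y)"
  assumes N: "filterlim N at_top sequentially"
  shows "(\<lambda>n. q (N n) ^ N n) \<longlonglongrightarrow> exp (- (c * stable_rate TYPE('p) b))"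
proof -
  let ?\<kappa> = "stable_rate TYPE('p) b"
  have cN: "0 \<le> c / real k" for k using c by simp
  have q: "0 \<le> q k" "q k \<le> 1" "\<bar>q k - exp (- (c / real k * ?\<kappa>))\<bar> \<le> (c / real k)\<^sup>2" for k
    unfolding q_def by (rule integral_stable_cf_padic_ints[OF b cN])+
  have Npos: "\<forall>\<^sub>F n in sequentially. N n > 0"
    using N by (auto simp: filterlim_at_top Suc_le_eq dest: spec[of _ 1])
  have inv: "(\<lambda>n. c\<^sup>2 / real (N n)) \<longlonglongrightarrow> 0"
    by (intro real_tendsto_divide_at_top[OF tendsto_const] filterlim_compose[OF filterlim_real_sequentially N])
  show ?thesis
  proof (rule power_tendsto_exp[where \<epsilon>="\<lambda>n. c / real (N n) * ?\<kappa>"])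
    show "0 \<le> q (N n)" "q (N n) \<le> 1" for n by (rule q)+
    show "0 \<le> c / real (N n) * ?\<kappa>" for n using cN stable_rate_bounds(1)[OF b] by (intro mult_nonneg_nonneg)
    show "(\<lambda>n. real (N n) * (c / real (N n) * ?\<kappa>)) \<longlonglongrightarrow> c * ?\<kappa>"
      by (rule tendsto_eventually) (use Npos in eventually_elim, simp)
    show "(\<lambda>n. real (N n) * \<bar>q (N n) - exp (- (c / real (N n) * ?\<kappa>))\<bar>) \<longlonglongrightarrow> 0"
    proof (rule Lim_null_comparison[OF _ inv])
      show "\<forall>\<^sub>F n in sequentially. norm (real (N n) * \<bar>q (N n) - exp (- (c / real (N n) * ?\<kappa>))\<bar>) \<le> c\<^sup>2 / real (N n)"
        using Npos
      proof eventually_elim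
        case (elim n)
        have "real (N n) * \<bar>q (N n) - exp (- (c / real (N n) * ?\<kappa>))\<bar> \<le> real (N n) * (c / real (N n))\<^sup>2"
          using q(3)[of "N n"] by (intro mult_left_mono) auto
        then show ?case using elim by (simp add: power2_eq_square abs_mult)
      qed
    qed
  qed
qed

section \<open>Confinement of the limit process\<close>

definition grid_confined :: "'p::prime_card padic set \<Rightarrow> real \<Rightarrow> nat \<Rightarrow> (real \<Rightarrow> 'p padic) set" where
  "grid_confined K t N = {x. \<forall>i<N. x (real (Suc i) * (t / real N)) - x (real i * (t / real N)) \<in> K}"

lemma grid_confined_from_start:
  assumes "x \<in> grid_confined padic_ints t N" "x 0 \<in> padic_ints" "j \<le> N"
  shows "x (real j * (t / real N)) \<in> (padic_ints :: 'p::prime_card padic set)"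
  using assms(3)
proof (induction j)
  case (Suc j)
  then have "x (real (Suc j) * (t / real N)) - x (real j * (t / real N)) \<in> padic_ints"
    using assms(1) by (auto simp: grid_confined_def)
  then show ?case using padic_ints_add[of "x (real (Suc j) * (t / real N)) - x (real j * (t / real N))" "x (real j * (t / real N))"] Suc
    by simp
qed (use assms in simp)

lemma confined_imp_grid_confined:
  assumes "0 < t" "\<forall>u\<in>{0..t}. x u \<in> (padic_ints :: 'p::prime_card padic set)"
  shows "x \<in> grid_confined padic_ints t N"
proof -
  have "x (real j * (t / real N)) \<in> padic_ints" if "j \<le> N" for j
  proof -
    have "real j * (t / real N) \<le> real N * (t / real N)" using that assms by (intro mult_right_mono) auto
    then have "real j * (t / real N) \<in> {0..t}" using assms(1) by (cases "N = 0") auto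
    then show ?thesis using assms(2) by blast
  qed
  then have "x (real (Suc i) * (t / real N)) + - x (real i * (t / real N)) \<in> padic_ints" if "i < N" for i
    using that by (intro padic_ints_add) (auto simp only: padic_ints_minus Suc_le_eq less_imp_le)
  then show ?thesis by (simp add: grid_confined_def)
qed

lemma grid_confined_double:
  "grid_confined padic_ints t (2 * N) \<subseteq> (grid_confined padic_ints t N :: (real \<Rightarrow> 'p::prime_card padic) set)"
proof
  fix x :: "real \<Rightarrow> 'p padic" assume x: "x \<in> grid_confined padic_ints t (2 * N)"
  have "x (real (Suc i) * (t / real N)) - x (real i * (t / real N)) \<in> padic_ints" if i: "i < N" for i
  proof -
    let ?y = "\<lambda>j. x (real j * (t / real (2 * N)))"
    have "?y (Suc (2 * i)) - ?y (2 * i) \<in> padic_ints" "?y (Suc (Suc (2 * i))) - ?y (Suc (2 * i)) \<in> padic_ints"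
      using x i by (auto simp only: grid_confined_def mem_Collect_eq)
    from padic_ints_add[OF this] have "?y (Suc (Suc (2 * i))) - ?y (2 * i) \<in> padic_ints" by simp
    moreover have "real (Suc (Suc (2 * i))) * (t / real (2 * N)) = real (Suc i) * (t / real N)"
      "real (2 * i) * (t / real (2 * N)) = real i * (t / real N)"
      using i by (simp_all add: field_simps)
    ultimately show ?thesis by simp
  qed
  then show "x \<in> grid_confined padic_ints t N" by (simp add: grid_confined_def)
qed

text \<open>Just after time \<open>u\<close> the path is within distance \<open>1\<close> of \<open>x u\<close>, by right continuity, and a sufficiently fine grid has a
  point there.\<close>

lemma dyadically_confined_imp_confined:
  fixes x :: "real \<Rightarrow> 'p::prime_card padic"
  assumes x: "x \<in> cadlag" "x 0 \<in> padic_ints" and t: "0 < t" and grid: "\<And>n. x \<in> grid_confined padic_ints t (2 ^ n)"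
    and u: "u \<in> {0..<t}"
  shows "x u \<in> padic_ints"
proof -
  have "(x \<longlongrightarrow> x u) (at_right u)" using x(1) u by (auto simp: cadlag_def)
  then have "\<forall>\<^sub>F v in at_right u. dist (x v) (x u) < 1" by (rule tendstoD) simp
  then obtain d where d: "d > u" "\<And>v. u < v \<Longrightarrow> v < d \<Longrightarrow> dist (x v) (x u) < 1"
    by (auto simp: eventually_at_right_field)
  obtain n where n: "(1 / 2) ^ n < (d - u) / t"
    using real_arch_pow_inv[of "(d - u) / t" "1 / 2"] d(1) t by auto
  \<comment> \<open>the first point of the grid to the right of \<open>u\<close>\<close>
  define j where "j = nat \<lfloor>u * 2 ^ n / t\<rfloor> + 1"
  define h where "h = t / real (2 ^ n)"
  have h: "h > 0" "h < d - u" using n t by (simp_all add: h_def field_simps power_divide)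
  have ut: "u * 2 ^ n / t = u / h" by (simp add: h_def)
  have j: "real j > u / h" "real j \<le> u / h + 1"
    using u h unfolding j_def ut by (simp_all add: of_nat_nat) linarith+
  have "u / h < 2 ^ n" using u t by (simp add: h_def field_simps)
  then have "real j < real (2 ^ n) + 1" using j by simp
  then have "j \<le> 2 ^ n" by linarith
  then have "x (real j * h) \<in> padic_ints"
    using grid_confined_from_start[OF grid x(2), of j n] by (simp add: h_def)
  moreover have "u < real j * h" using j(1) h by (simp add: field_simps)
  moreover have "real j * h < d"
  proof -
    have "real j * h \<le> (u / h + 1) * h" using j(2) h by (intro mult_right_mono) auto
    also have "\<dots> = u + h" using h by (simp add: field_simps)
    finally show ?thesis using h by linarith
  qed
  ultimately show ?thesis using padic_ints_clopen[of "x (real j * h)" "x u"] d(2) by blast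
qed

context
  fixes b \<sigma> :: real and P :: "(real \<Rightarrow> 'p::prime_card padic) measure"
  assumes law: "limit_process_law b \<sigma> P" and b: "0 < b" and \<sigma>: "0 < \<sigma>"
begin

lemma limit_law_prob_space: "prob_space P"
  using law by (simp add: limit_process_law_def)

lemma limit_law_space: "space P = cadlag"
proof -
  have "space P = space (borel_of (skorokhod_J1 :: (real \<Rightarrow> 'p padic) topology))"
    using law by (intro sets_eq_imp_space_eq) (simp add: limit_process_law_def)
  then show ?thesis by (simp add: borel_of_def space_measure_of_conv topspace_skorokhod_J1)
qed

text \<open>The increments over the cells of the grid are independent and identically distributed.\<close>

lemma limit_law_grid:
  assumes t: "0 < t" and N: "0 < N"
  shows "grid_confined padic_ints t N \<inter> space P \<in> sets P"
    and "measure P (grid_confined padic_ints t N \<inter> space P)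
       = (LINT y|haar. indicator (padic_ints :: 'p padic set) y * stable_cf b (\<sigma> * t / real N) y) ^ N"
proof -
  interpret prob_space P by (rule limit_law_prob_space)
  define \<tau> where "\<tau> i = real i * (t / real N)" for i
  let ?X = "\<lambda>i x. x (\<tau> (Suc i)) - x (\<tau> i) :: 'p padic"
  have \<tau>: "strict_mono \<tau>" "0 \<le> \<tau> 0" "\<tau> i \<ge> 0" "\<tau> (Suc i) > \<tau> i" "\<tau> (Suc i) - \<tau> i = t / real N" for i
    using t N by (auto simp: \<tau>_def strict_mono_def field_simps)
  have dist: "distributed P haar (?X i) (\<lambda>z. ennreal (Re (transition_density b \<sigma> (t / real N) z)))" for i
    using law \<tau>(3,4)[of i] unfolding limit_process_law_def \<tau>(5)[of i, symmetric] by blast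
  have indep: "indep_vars (\<lambda>_. borel) ?X {..<N}"
    using law \<tau>(1,2) unfolding limit_process_law_def by blast
  have eq: "grid_confined padic_ints t N \<inter> space P = (\<Inter>i\<in>{..<N}. ?X i -` padic_ints \<inter> space P)"
    using N by (auto simp: grid_confined_def \<tau>_def)
  have m: "?X i -` padic_ints \<inter> space P \<in> sets P" for i
    using distributed_measurable[OF dist] by (rule measurable_sets) simp
  show "grid_confined padic_ints t N \<inter> space P \<in> sets P"
    unfolding eq using N by (intro sets.finite_INT m) auto
  have "prob (grid_confined padic_ints t N \<inter> space P) = (\<Prod>i\<in>{..<N}. prob (?X i -` padic_ints \<inter> space P))"
    unfolding eq by (rule indep_varsD[OF indep]) (use N in auto)
  also have "\<dots> = (\<Prod>i\<in>{..<N}. LINT y|haar. indicator (padic_ints :: 'p padic set) y * stable_cf b (\<sigma> * (t / real N)) y)"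
    by (intro prod.cong refl prob_increment_in_padic_ints[OF dist b]) (use t \<sigma> in simp)
  finally show "prob (grid_confined padic_ints t N \<inter> space P)
       = (LINT y|haar. indicator (padic_ints :: 'p padic set) y * stable_cf b (\<sigma> * t / real N) y) ^ N"
    by simp
qed

lemma limit_law_grid_limit:
  assumes t: "0 < t"
  shows "(\<lambda>n. measure P (grid_confined padic_ints t (2 ^ n) \<inter> space P)) \<longlonglongrightarrow> exp (- (t * (\<sigma> * stable_rate TYPE('p) b)))"
proof -
  have "filterlim (\<lambda>n. 2 ^ n :: nat) at_top sequentially"
    by (rule filterlim_subseq) (simp add: strict_mono_def)
  from stable_survival_limit[OF less_imp_le[OF b] _ this, of "\<sigma> * t", where 'p='p]
  show ?thesis using t \<sigma> unfolding limit_law_grid(2)[OF t, of "2 ^ _", simplified]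
    by (simp add: mult_ac)
qed

text \<open>The upper bound tests confinement on finite grids only. For the lower bound the events of confinement on the dyadic grids decrease to
  an event on which, up to paths that do not start at \<open>0\<close>, the process is confined during \<open>[0, t)\<close>.\<close>

lemma limit_law_confinement_bounds:
  assumes st: "0 < s" "s < t"
  shows "(t - s) * exp (- (t * (\<sigma> * stable_rate TYPE('p) b))) \<le> (\<integral>x. confinement_ramp padic_ints s t x \<partial>P)" (is ?lower)
    and "(\<integral>x. confinement_ramp padic_ints s t x \<partial>P) \<le> (t - s) * exp (- (s * (\<sigma> * stable_rate TYPE('p) b)))" (is ?upper)
proof -
  interpret prob_space P by (rule limit_law_prob_space)
  let ?f = "confinement_ramp (padic_ints :: 'p padic set) s t"
  have f: "?f \<in> borel_measurable P"
    by (rule continuous_map_measurable_borel_of[OF continuous_map_confinement_ramp[of _ 1]])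
       (use st padic_ints_clopen law in \<open>auto simp: limit_process_law_def\<close>)
  have bd: "?f x \<in> {0..t - s}" for x using st by (intro confinement_ramp_bounds) auto
  have "expectation ?f \<le> (t - s) * prob (grid_confined padic_ints s (2 ^ n) \<inter> space P)" for n
  proof (rule expectation_between_events(2)[OF f bd limit_law_grid(1)])
    fix x assume "x \<in> space P" "x \<notin> grid_confined padic_ints s (2 ^ n) \<inter> space P"
    then obtain u where "u \<in> {0..s}" "x u \<notin> padic_ints" using confined_imp_grid_confined[OF st(1)] by blast
    then show "?f x = 0" using st by (intro confinement_ramp_eq_0) auto
  qed (use st in auto)
  moreover have "(\<lambda>n. (t - s) * prob (grid_confined padic_ints s (2 ^ n) \<inter> space P)) \<longlonglongrightarrow> (t - s) * exp (- (s * (\<sigma> * stable_rate TYPE('p) b)))"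
    by (intro tendsto_mult tendsto_const limit_law_grid_limit st)
  ultimately show ?upper by (intro LIMSEQ_le_const) auto
  have t: "0 < t" using st by simp
  let ?E = "\<lambda>n. grid_confined padic_ints t (2 ^ n) \<inter> space P"
  have E: "?E n \<in> events" for n by (rule limit_law_grid(1)[OF t]) simp
  have "decseq ?E"
    by (rule decseq_SucI) (use grid_confined_double[of t "2 ^ _", where 'p='p] in auto)
  then have "(\<lambda>n. prob (?E n)) \<longlonglongrightarrow> prob (\<Inter>n. ?E n)"
    using E by (intro finite_Lim_measure_decseq) auto
  then have pr: "prob (\<Inter>n. ?E n) = exp (- (t * (\<sigma> * stable_rate TYPE('p) b)))"
    using limit_law_grid_limit[OF t] by (rule LIMSEQ_unique)
  have "(t - s) * prob (\<Inter>n. ?E n) \<le> expectation ?f"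
  proof (rule expectation_between_events(1)[OF f bd])
    show "(\<Inter>n. ?E n) \<in> events" using E by blast
    have start: "AE x in P. x 0 = 0" using law by (simp add: limit_process_law_def)
    have top: "?f x = t - s" if x0: "x 0 = 0" and x: "x \<in> (\<Inter>n. ?E n)" for x
    proof -
      have "x 0 \<in> padic_ints" using x0 padic_ints_0 by simp
      moreover have "x \<in> cadlag" using x limit_law_space by blast
      moreover have "x \<in> grid_confined padic_ints t (2 ^ n)" for n using x by blast
      ultimately have "\<forall>u\<in>{0..<t}. x u \<in> padic_ints"
        using dyadically_confined_imp_confined[OF _ _ t] by blast
      then show ?thesis using st by (intro confinement_ramp_eq_top) auto
    qed
    show "AE x in P. x \<in> (\<Inter>n. ?E n) \<longrightarrow> ?f x = t - s"
      by (rule eventually_mono[OF start]) (intro impI top)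
  qed (use st in auto)
  then show ?lower unfolding pr .
qed

end

section \<open>The diffusion coefficient and the tail of the increments\<close>

text \<open>Weak convergence applied to the confinement ramps with \<open>s < t\<close> compares \<open>exp (- s \<sigma> \<kappa>)\<close> with \<open>exp (- t D c)\<close>, and
  conversely. Then \<open>t\<close> decreases to \<open>s\<close>.\<close>

lemma diffusion_coefficient_tail:
  fixes \<xi> :: "'p::prime_card qp_mod_zp pmf"
  assumes b: "0 < b" and D: "0 < D"
    and tail: "\<And>m. measure_pmf.prob \<xi> (qp_ball m) = 1 - c * real CARD('p) powr (- real m * b)"
    and \<sigma>: "diffusion_coefficient b D \<xi> \<sigma>"
  shows "\<sigma> * stable_rate TYPE('p) b = D * c"
proof -
  obtain P where P: "limit_process_law b \<sigma> P" "converges_weakly skorokhod_J1 (walk_law b D \<xi>) P" and \<sigma>0: "\<sigma> > 0"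
    using \<sigma> unfolding diffusion_coefficient_def by blast
  let ?\<kappa> = "stable_rate TYPE('p) b" and ?f = "confinement_ramp (padic_ints :: 'p padic set)"
  have c: "0 \<le> c" using measure_pmf.prob_le_1[of \<xi> "qp_ball 0"] tail[of 0] by (simp add: card_neq_0)
  note surv = walk_survival_limit[OF real_card_gt_1[where 'p='p] b D _ c tail measure_nonneg]
  have cmp: "s * (D * c) \<le> t * (\<sigma> * ?\<kappa>)" "s * (\<sigma> * ?\<kappa>) \<le> t * (D * c)" if st: "0 < s" "s < t" for s t
  proof -
    have cont: "continuous_map skorokhod_J1 euclideanreal (?f s t)"
      by (rule continuous_map_confinement_ramp[of _ 1]) (use st padic_ints_clopen in auto)
    have "?f s t ` topspace skorokhod_J1 \<subseteq> {0..t - s}" 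
      by (intro image_subsetI confinement_ramp_bounds) (use st in auto)
    then have "bounded (?f s t ` topspace skorokhod_J1)" by (rule bounded_subset[rotated]) simp
    then have lim: "(\<lambda>m. \<integral>x. ?f s t x \<partial>walk_law b D \<xi> m) \<longlonglongrightarrow> (\<integral>x. ?f s t x \<partial>P)"
      using P(2) cont unfolding converges_weakly_def by blast
    have s0: "0 \<le> s" "0 \<le> t" using st by auto
    note walk = walk_confinement_bounds[OF D s0(1) st(2), where \<xi>=\<xi> and b=b]
    have "(t - s) * exp (- (t * (D * c))) \<le> (\<integral>x. ?f s t x \<partial>P)"
      by (rule LIMSEQ_le[OF tendsto_mult[OF tendsto_const surv[OF s0(2)]] lim]) (use walk(1) in auto)
    moreover have "(\<integral>x. ?f s t x \<partial>P) \<le> (t - s) * exp (- (s * (D * c)))"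
      by (rule LIMSEQ_le[OF lim tendsto_mult[OF tendsto_const surv[OF s0(1)]]]) (use walk(2) in auto)
    ultimately have "(t - s) * exp (- (t * (D * c))) \<le> (t - s) * exp (- (s * (\<sigma> * ?\<kappa>)))"
      "(t - s) * exp (- (t * (\<sigma> * ?\<kappa>))) \<le> (t - s) * exp (- (s * (D * c)))"
      using limit_law_confinement_bounds[OF P(1) b \<sigma>0 st] by linarith+
    then show "s * (D * c) \<le> t * (\<sigma> * ?\<kappa>)" "s * (\<sigma> * ?\<kappa>) \<le> t * (D * c)" using st by simp_all
  qed
  have le: "u \<le> v" if "\<And>s t. 0 < s \<Longrightarrow> s < t \<Longrightarrow> s * u \<le> t * v" for u v :: real
  proof -
    have "((\<lambda>t. t * v) \<longlongrightarrow> 1 * v) (at_right 1)" by (intro tendsto_intros)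
    moreover have "\<forall>\<^sub>F t in at_right (1::real). u \<le> t * v"
      unfolding eventually_at_filter using that[of 1] by (intro always_eventually) simp
    ultimately have "u \<le> 1 * v" by (rule tendsto_lowerbound) simp
    then show ?thesis by simp
  qed
  show ?thesis using le[OF cmp(1)] le[OF cmp(2)] by (rule antisym[rotated])
qed

section \<open>Tails of the coordinate increments\<close>

text \<open>The cosets of \<open>qp_ball k\<close> in \<open>qp_ball (Suc k)\<close> are represented by the \<open>p\<close> values of the leading digit.\<close>

lemma card_qp_ball: "card (qp_ball k :: 'p::prime_card qp_mod_zp set) = CARD('p) ^ k"
proof (induction k)
  case 0
  have "qp_ball 0 = {0 :: 'p qp_mod_zp}"
    by (auto simp: qp_ball_def zero_qp_mod_zp.abs_eq qp_mod_zp.abs_eq_iff mod_zp_rel_def padic_ints_0 intro!: image_eqI[of _ _ 0])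
  then show ?case by simp
next
  case (Suc k)
  let ?e = "\<lambda>c. abs_qp_mod_zp (of_nat c / padic_p ^ Suc k) :: 'p qp_mod_zp"
  let ?f = "\<lambda>(c, g). ?e c + g"
  have e_in: "?e c \<in> qp_ball (Suc k)" for c
    using norm_of_nat_padic_le_1[of c, where 'p='p] mult_right_mono[of "padic_norm (of_nat c :: 'p padic)" 1 "real CARD('p) ^ Suc k"]
    unfolding abs_in_qp_ball norm_padic_divide norm_padic_power norm_padic_p by (simp add: power_one_over)
  have "inj_on ?f ({..<CARD('p)} \<times> qp_ball k)"
  proof (rule inj_onI, clarify)
    fix c d and g g' :: "'p qp_mod_zp"
    assume c: "c < CARD('p)" "d < CARD('p)" and g: "g \<in> qp_ball k" "g' \<in> qp_ball k" and eq: "?e c + g = ?e d + g'"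
    have "abs_qp_mod_zp (of_nat c / padic_p ^ Suc k - of_nat d / padic_p ^ Suc k) = ?e c - ?e d"
      by (simp only: minus_qp_mod_zp.abs_eq)
    also have "\<dots> = g' + - g" using eq by (simp add: algebra_simps)
    also have "\<dots> \<in> qp_ball k" using g by (intro qp_ball_add qp_ball_minus)
    finally have "padic_norm ((of_nat c - of_nat d) / padic_p ^ Suc k :: 'p padic) \<le> real CARD('p) ^ k"
      unfolding abs_in_qp_ball by (simp only: diff_divide_distrib)
    then have "padic_norm (of_nat c - of_nat d :: 'p padic) * real CARD('p) ^ Suc k \<le> real CARD('p) ^ k"
      unfolding norm_padic_divide norm_padic_power norm_padic_p by (simp add: power_one_over)
    also have "\<dots> < 1 * real CARD('p) ^ Suc k"
      using power_strict_increasing[OF lessI real_card_gt_1[where 'p='p], of k] by simp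
    finally have "padic_norm (of_nat c - of_nat d :: 'p padic) < 1" by (rule mult_right_less_imp_less) simp
    then have "c = d" by (rule digits_congruent[OF c])
    then show "c = d \<and> g = g'" using eq by simp
  qed
  moreover have "?f ` ({..<CARD('p)} \<times> qp_ball k) = qp_ball (Suc k)"
  proof
    show "?f ` ({..<CARD('p)} \<times> qp_ball k) \<subseteq> qp_ball (Suc k)"
      using qp_ball_mono[of k "Suc k", where 'p='p] e_in by (auto intro!: qp_ball_add)
    show "qp_ball (Suc k) \<subseteq> ?f ` ({..<CARD('p)} \<times> qp_ball k)"
    proof
      fix g :: "'p qp_mod_zp" assume "g \<in> qp_ball (Suc k)"
      then obtain z where z: "z \<in> padic_ints" "g = abs_qp_mod_zp (z / padic_p ^ Suc k)"
        unfolding qp_ball_def by blast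
      then obtain c where c: "c < CARD('p)" "padic_norm (z - of_nat c) \<le> 1 / real CARD('p)"
        using padic_first_digit[of z] unfolding padic_ints_def by blast
      have "padic_norm ((z - of_nat c) / padic_p ^ Suc k) = padic_norm (z - of_nat c) * real CARD('p) ^ Suc k"
        unfolding norm_padic_divide norm_padic_power norm_padic_p by (simp add: power_one_over)
      also have "\<dots> \<le> 1 / real CARD('p) * real CARD('p) ^ Suc k"
        using c(2) by (intro mult_right_mono) auto
      finally have "abs_qp_mod_zp ((z - of_nat c) / padic_p ^ Suc k) \<in> qp_ball k" unfolding abs_in_qp_ball by simp
      moreover have "g = ?e c + abs_qp_mod_zp ((z - of_nat c) / padic_p ^ Suc k)"
        unfolding z(2) plus_qp_mod_zp.abs_eq by (simp only: add_divide_distrib[symmetric]) simp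
      ultimately show "g \<in> ?f ` ({..<CARD('p)} \<times> qp_ball k)"
        using c(1) by (intro image_eqI[of _ _ "(c, abs_qp_mod_zp ((z - of_nat c) / padic_p ^ Suc k))"]) auto
    qed
  qed
  ultimately have "card (qp_ball (Suc k) :: 'p qp_mod_zp set) = card ({..<CARD('p)} \<times> (qp_ball k :: 'p qp_mod_zp set))"
    by (metis card_image)
  then show ?case using Suc by (simp add: card_cartesian_product)
qed

lemma card_qp_ball_Diff:
  "j \<le> k \<Longrightarrow> real (card (qp_ball k - qp_ball j :: 'p::prime_card qp_mod_zp set)) = real CARD('p) ^ k - real CARD('p) ^ j"
proof -
  assume jk: "j \<le> k"
  have "CARD('p) ^ j \<le> CARD('p) ^ k" by (rule power_increasing[OF jk]) (simp add: Suc_le_eq)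
  moreover have "card (qp_ball k - qp_ball j :: 'p qp_mod_zp set) = card (qp_ball k :: 'p qp_mod_zp set) - card (qp_ball j :: 'p qp_mod_zp set)"
    by (rule card_Diff_subset[OF finite_qp_ball qp_ball_mono[OF jk]])
  ultimately show ?thesis by (simp add: card_qp_ball of_nat_diff)
qed

text \<open>The proportion of \<open>p\<^bsup>-j\<^esup>\<int>\<^sub>p/\<int>\<^sub>p\<close> that lies outside \<open>p\<^bsup>-k\<^esup>\<int>\<^sub>p/\<int>\<^sub>p\<close>.\<close>

definition out_frac :: "real \<Rightarrow> nat \<Rightarrow> nat \<Rightarrow> real" where
  "out_frac p k j = (if j < k then 0 else 1 - p ^ k / p ^ j)"

lemma card_qp_ball_Diff_out_frac:
  "real (card (qp_ball j - qp_ball k :: 'p::prime_card qp_mod_zp set)) = out_frac (real CARD('p)) k j * real CARD('p) ^ j"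
proof (cases "j < k")
  case True
  then have "qp_ball j - qp_ball k = ({} :: 'p qp_mod_zp set)" using qp_ball_mono[of j k, where 'p='p] by auto
  then have "card (qp_ball j - qp_ball k :: 'p qp_mod_zp set) = 0" by (simp only: card.empty)
  then show ?thesis using True by (simp add: out_frac_def)
next
  case False
  then show ?thesis using card_qp_ball_Diff[of k j, where 'p='p] by (simp add: out_frac_def left_diff_distrib card_neq_0)
qed

lemma sums_shell_mixture:
  fixes f :: "nat \<Rightarrow> real"
  assumes f: "\<And>j. f j \<ge> 0" "f sums 1" "f 0 = 0"
    and S: "\<And>j. finite (S j)" "\<And>j. j > 0 \<Longrightarrow> S j \<noteq> {}"
  shows "(\<lambda>j. f j * (card (S j \<inter> A) / card (S j))) sums
    measure_pmf.prob (bind_pmf (embed_pmf f) (\<lambda>j. pmf_of_set (S j))) A"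
proof -
  let ?r = "\<lambda>j. real (card (S j \<inter> A)) / real (card (S j))"
  have r: "0 \<le> ?r j" "?r j \<le> 1" for j
    using card_mono[OF S(1), of "S j \<inter> A" j] by (auto simp: divide_le_eq_1)
  have meas: "ennreal (f j) * emeasure (pmf_of_set (S j)) A = ennreal (f j * ?r j)" for j
  proof (cases "j = 0")
    case False
    then have "emeasure (pmf_of_set (S j)) A = ennreal (?r j)"
      using S by (simp add: measure_pmf.emeasure_eq_measure measure_pmf_of_set)
    then show ?thesis by (simp only: ennreal_mult[OF f(1) r(1)])
  qed (simp add: f(3))
  have "summable f" using f(2) by (rule sums_summable)
  then have summ: "summable (\<lambda>j. f j * ?r j)"
    by (rule summable_comparison_test_ev[rotated])
       (use f(1) r mult_left_mono[OF r(2) f(1)] in \<open>auto intro!: always_eventually simp: abs_mult\<close>)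
  have "emeasure (bind_pmf (embed_pmf f) (\<lambda>j. pmf_of_set (S j))) A
      = (\<integral>\<^sup>+j. ennreal (f j) * emeasure (pmf_of_set (S j)) A \<partial>count_space UNIV)"
    by (simp add: nn_integral_measure_pmf pmf_embed_sums[OF f(1,2)])
  also have "\<dots> = (\<Sum>j. ennreal (f j * ?r j))"
    by (simp only: nn_integral_count_space_nat meas)
  also have "\<dots> = ennreal (\<Sum>j. f j * ?r j)"
    by (rule suminf_ennreal2[OF _ summ]) (use f(1) r in auto)
  finally have "measure_pmf.prob (bind_pmf (embed_pmf f) (\<lambda>j. pmf_of_set (S j))) A = (\<Sum>j. f j * ?r j)"
    using f(1) r suminf_nonneg[OF summ] by (simp add: measure_pmf.emeasure_eq_measure)
  then show ?thesis using summable_sums[OF summ] by simp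
qed

lemma geometric_tail_sums:
  assumes "0 < q" "q < (1::real)"
  shows "(\<lambda>i. if i < k then 0 else q ^ i) sums (q ^ k / (1 - q))"
proof -
  have "(\<lambda>i. q ^ k * q ^ i) sums (q ^ k * (1 / (1 - q)))"
    by (intro sums_mult geometric_sums) (use assms in auto)
  then have "(\<lambda>i. if i + k < k then 0 else q ^ (i + k)) sums (q ^ k / (1 - q))"
    by (simp add: power_add mult.commute)
  then show ?thesis by (subst (asm) sums_zero_iff_shift) auto
qed

lemma out_frac_sums:
  assumes q: "0 < q" "q < (1::real)" and p: "1 < p"
  shows "(\<lambda>i. q ^ i * out_frac p k i) sums (q ^ k * (1 / (1 - q) - p / (p - q)))"
proof -
  have qp: "q / p > 0" "q / p < 1" using q p by (simp_all add: field_simps)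
  have "(\<lambda>i. (if i < k then 0 else q ^ i) - p ^ k * (if i < k then 0 else (q / p) ^ i)) sums
      (q ^ k / (1 - q) - p ^ k * ((q / p) ^ k / (1 - q / p)))"
    by (intro sums_diff sums_mult geometric_tail_sums q qp)
  also have "(\<lambda>i. (if i < k then 0 else q ^ i) - p ^ k * (if i < k then 0 else (q / p) ^ i)) = (\<lambda>i. q ^ i * out_frac p k i)"
    by (auto simp: out_frac_def fun_eq_iff power_divide algebra_simps)
  also have "q ^ k / (1 - q) - p ^ k * ((q / p) ^ k / (1 - q / p)) = q ^ k * (1 / (1 - q) - p / (p - q))"
  proof -
    have "1 / (1 - q / p) = p / (p - q)" using p q by (simp add: field_simps)
    moreover have "p ^ k * (q / p) ^ k = q ^ k" using p by (simp add: power_divide)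
    ultimately show ?thesis by (simp add: algebra_simps) (metis (no_types, lifting) divide_inverse inverse_eq_divide mult.assoc mult.commute)
  qed
  finally show ?thesis .
qed

lemma sums_odd_even:
  fixes F :: "nat \<Rightarrow> real"
  assumes "F 0 = 0" "(\<lambda>i. F (2 * i + 1)) sums x" "(\<lambda>i. F (2 * i + 2)) sums y"
  shows "F sums (x + y)"
proof -
  have "(\<lambda>n. if even n then F (2 * (n div 2) + 1) else F (2 * ((n - 1) div 2) + 2)) sums (y + x)"
    by (rule sums_if[OF assms(3,2)])
  also have "(\<lambda>n. if even n then F (2 * (n div 2) + 1) else F (2 * ((n - 1) div 2) + 2)) = (\<lambda>n. F (Suc n))"
    by (auto simp: fun_eq_iff elim!: evenE oddE)
  finally show ?thesis using sums_Suc[of F "y + x"] assms(1) by (simp add: add.commute)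
qed

text \<open>Given the fine shell, the coordinates are independent, one uniform on a ball and the other one uniform on a sphere; the roles
  alternate with the parity of the index.\<close>

lemma fine_shell_odd: "fine_shell (2 * i + 1) = qp_ball i \<times> (qp_ball (Suc i) - qp_ball i)"
  and fine_shell_even: "fine_shell (2 * i + 2) = (qp_ball (Suc i) - qp_ball i) \<times> qp_ball (Suc i)"
proof -
  have e: "(2 * i + 1) div 2 = i" "(2 * i + 1) mod 2 = 1" "(2 * i + 2) div 2 = Suc i" "(2 * i + 2) mod 2 = 0"
    "2 * i + 1 - 1 = 2 * i" "2 * i + 2 - 1 = 2 * i + 1" "2 * i div 2 = i" "2 * i mod 2 = 0"
    by simp_all
  show "fine_shell (2 * i + 1) = qp_ball i \<times> (qp_ball (Suc i) - qp_ball i)"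
    unfolding fine_shell_def ball2_def e by auto
  show "fine_shell (2 * i + 2) = (qp_ball (Suc i) - qp_ball i) \<times> qp_ball (Suc i)"
    unfolding fine_shell_def ball2_def e by auto
qed

lemma powr_minus_mult_eq_power: "0 < p \<Longrightarrow> p powr (- real k * b) = (p powr (- b)) ^ k"
  by (simp add: powr_realpow[symmetric] powr_powr mult.commute)

lemma fine_shell_prob_odd:
  assumes "1 < p"
  shows "fine_shell_prob p b h (2 * i + 1) = aniso_const p b h * real p powr (- h * b) * (real p powr (- b)) ^ i"
proof -
  have "(2 * i + 1) div 2 = i" by simp
  then have "fine_shell_prob p b h (2 * i + 1) = aniso_const p b h * (real p powr (real i + h)) powr (- b)"
    by (simp add: fine_shell_prob_def fine_radius_def)
  also have "(real p powr (real i + h)) powr (- b) = real p powr (- h * b) * real p powr (- real i * b)"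
    by (simp add: powr_powr powr_add[symmetric] algebra_simps)
  finally show ?thesis using assms by (simp only: powr_minus_mult_eq_power of_nat_0_less_iff mult.assoc)
qed

lemma fine_shell_prob_even:
  assumes "1 < p"
  shows "fine_shell_prob p b h (2 * i + 2) = aniso_const p b h * (real p powr (- b)) ^ Suc i"
proof -
  have "(2 * i + 2) div 2 = Suc i" by simp
  then have "fine_shell_prob p b h (2 * i + 2) = aniso_const p b h * (real p powr real (Suc i)) powr (- b)"
    by (simp add: fine_shell_prob_def fine_radius_def)
  also have "(real p powr real (Suc i)) powr (- b) = real p powr (- real (Suc i) * b)"
    by (simp only: powr_powr) (simp add: algebra_simps)
  finally show ?thesis using assms by (simp only: powr_minus_mult_eq_power of_nat_0_less_iff)
qed

lemma aniso_const_eq: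
  assumes "1 < p"
  shows "aniso_const p b h = (1 - real p powr (- b)) / (real p powr (- h * b) + real p powr (- b))"
proof -
  have "(real p powr b - 1) / real p powr b = 1 - real p powr (- b)"
    using assms by (simp add: diff_divide_distrib powr_minus inverse_eq_divide)
  then show ?thesis unfolding aniso_const_def by (simp only: divide_inverse mult.commute)
qed

lemma aniso_increment_sums:
  fixes A :: "('p::prime_card qp_mod_zp \<times> 'p qp_mod_zp) set"
  assumes "0 < b"
  shows "(\<lambda>j. fine_shell_prob CARD('p) b h j * (card (fine_shell j \<inter> A) / card (fine_shell j :: ('p qp_mod_zp \<times> 'p qp_mod_zp) set)))
    sums measure_pmf.prob (aniso_increment b h) A"
  unfolding aniso_increment_def
proof (rule sums_shell_mixture)
  show "fine_shell_prob CARD('p) b h j \<ge> 0" for j by (rule fine_shell_prob_nonneg[OF assms card_gt_1])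
  show "fine_shell_prob CARD('p) b h sums 1" by (rule fine_shell_prob_sums[OF assms card_gt_1])
qed (simp_all add: fine_shell_prob_def fine_shell_finite fine_shell_nonempty)

lemma iso_increment_sums:
  fixes A :: "('p::prime_card qp_mod_zp \<times> 'p qp_mod_zp) set"
  assumes "0 < b"
  shows "(\<lambda>j. coarse_shell_prob CARD('p) b j * (card (coarse_shell j \<inter> A) / card (coarse_shell j :: ('p qp_mod_zp \<times> 'p qp_mod_zp) set)))
    sums measure_pmf.prob (iso_increment b) A"
  unfolding iso_increment_def
proof (rule sums_shell_mixture)
  show "coarse_shell_prob CARD('p) b j \<ge> 0" for j by (rule coarse_shell_prob_nonneg[OF assms card_gt_1])
  show "coarse_shell_prob CARD('p) b sums 1" by (rule coarse_shell_prob_sums[OF assms card_gt_1])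
qed (simp_all add: coarse_shell_prob_def coarse_shell_finite coarse_shell_nonempty)

text \<open>The probability that a uniform point of \<open>p\<^bsup>-N\<^esup>\<int>\<^sub>p/\<int>\<^sub>p\<close> is \<open>0\<close> when \<open>N\<close> is geometric with
  \<open>P(N = i) = (1 - q) q\<^sup>i\<close>.\<close>

definition return_weight :: "real \<Rightarrow> real \<Rightarrow> real" where
  "return_weight p q = p * (1 - q) / (p - q)"

text \<open>The constants \<open>c\<close> such that a coordinate of the increment is outside \<open>p\<^bsup>-m\<^esup>\<int>\<^sub>p/\<int>\<^sub>p\<close> with probability \<open>c q\<^sup>m\<close>, where
  \<open>q = p\<^bsup>-b\<^esup>\<close> and \<open>u = p\<^bsup>-hb\<^esup>\<close>.\<close>

definition aniso_tail_fst :: "real \<Rightarrow> real \<Rightarrow> real \<Rightarrow> real" where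
  "aniso_tail_fst p q u = 1 - return_weight p q * (u / (u + q))"

definition aniso_tail_snd :: "real \<Rightarrow> real \<Rightarrow> real \<Rightarrow> real" where
  "aniso_tail_snd p q u = 1 - return_weight p q / p * (q / (u + q))"

definition iso_tail :: "real \<Rightarrow> real \<Rightarrow> real" where
  "iso_tail p q = 1 - return_weight p q / (p + 1)"

lemma prob_map_qp_ball:
  "measure_pmf.prob (map_pmf f M) B = 1 - measure_pmf.prob M (f -` (- B))"
  using measure_pmf.prob_compl[of "f -` B" M] by (simp add: vimage_Compl Compl_eq_Diff_UNIV vimage_Diff)

lemma card_qp_ball_pos: "0 < card (qp_ball k :: 'p::prime_card qp_mod_zp set)"
  by (simp add: card_qp_ball)

lemma card_qp_sphere_pos: "0 < card (qp_ball (Suc k) - qp_ball k :: 'p::prime_card qp_mod_zp set)"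
  using qp_ball_strict[of k, where 'p='p] finite_qp_ball[of "Suc k", where 'p='p] by (intro card_gt_0_iff[THEN iffD2]) auto

lemma qp_ball_out_frac:
  "card (qp_ball j - qp_ball k :: 'p::prime_card qp_mod_zp set) / card (qp_ball j :: 'p qp_mod_zp set) = out_frac (real CARD('p)) k j"
  unfolding card_qp_ball_Diff_out_frac by (simp add: card_qp_ball card_neq_0)

lemma qp_sphere_out_frac:
  "card ((qp_ball (Suc j) - qp_ball j) - qp_ball k :: 'p::prime_card qp_mod_zp set) / card (qp_ball (Suc j) - qp_ball j :: 'p qp_mod_zp set)
     = (if j < k then 0 else 1)"
proof (cases "j < k")
  case True
  then have "(qp_ball (Suc j) - qp_ball j) - qp_ball k = ({} :: 'p qp_mod_zp set)"
    using qp_ball_mono[of "Suc j" k, where 'p='p] by auto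
  then have "card ((qp_ball (Suc j) - qp_ball j) - qp_ball k :: 'p qp_mod_zp set) = 0" by (simp only: card.empty)
  then show ?thesis using True by simp
next
  case False
  then have "(qp_ball (Suc j) - qp_ball j) - qp_ball k = (qp_ball (Suc j) - qp_ball j :: 'p qp_mod_zp set)"
    using qp_ball_mono[of k j, where 'p='p] by auto
  then show ?thesis using False card_qp_sphere_pos[of j, where 'p='p] by simp
qed

lemma aniso_tail_const:
  assumes p: "1 < (p::real)" and q: "0 < q" "q < 1" and u: "0 < u"
  defines "C \<equiv> (1 - q) / (u + q)"
  shows "C * u * (q ^ k * (1 / (1 - q) - p / (p - q))) + C * q * (q ^ k / (1 - q)) = aniso_tail_fst p q u * q ^ k"
    and "C * u * (q ^ k / (1 - q)) + C * (q ^ k * (1 / (1 - q) - p / (p - q))) = aniso_tail_snd p q u * q ^ k"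
proof -
  let ?w = "return_weight p q"
  have uq: "u + q \<noteq> 0" "u + q > 0" using u q by auto
  have C1: "C / (1 - q) = 1 / (u + q)" using q by (simp add: C_def)
  have "C * (1 / (1 - q) - p / (p - q)) = C / (1 - q) - C * (p / (p - q))" by (simp add: right_diff_distrib)
  moreover have "C * (p / (p - q)) = ?w / (u + q)" by (simp add: C_def return_weight_def mult_ac)
  ultimately have C2: "C * (1 / (1 - q) - p / (p - q)) = (1 - ?w) / (u + q)"
    unfolding C1 by (simp add: diff_divide_distrib)
  have "C * u * (q ^ k * (1 / (1 - q) - p / (p - q))) + C * q * (q ^ k / (1 - q))
      = (u * (C * (1 / (1 - q) - p / (p - q))) + q * (C / (1 - q))) * q ^ k"
    by (simp add: algebra_simps)
  also have "u * (C * (1 / (1 - q) - p / (p - q))) + q * (C / (1 - q)) = ((u + q) - ?w * u) / (u + q)"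
    unfolding C1 C2 by (simp add: add_divide_distrib[symmetric] algebra_simps)
  also have "\<dots> = aniso_tail_fst p q u"
    unfolding aniso_tail_fst_def using uq by (simp add: diff_divide_distrib)
  finally show "C * u * (q ^ k * (1 / (1 - q) - p / (p - q))) + C * q * (q ^ k / (1 - q)) = aniso_tail_fst p q u * q ^ k" .
  have w: "1 - ?w = q - ?w / p * q"
  proof -
    have "?w * (p - q) = p * (1 - q)" using p q by (simp add: return_weight_def)
    then have "p * (1 - ?w) = p * (q - ?w / p * q)" using p by (simp add: algebra_simps)
    then show ?thesis using p by simp
  qed
  have "C * u * (q ^ k / (1 - q)) + C * (q ^ k * (1 / (1 - q) - p / (p - q)))
      = (u * (C / (1 - q)) + C * (1 / (1 - q) - p / (p - q))) * q ^ k"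
    by (simp add: algebra_simps)
  also have "u * (C / (1 - q)) + C * (1 / (1 - q) - p / (p - q)) = ((u + q) - ?w / p * q) / (u + q)"
    unfolding C1 C2 w by (simp add: add_divide_distrib[symmetric] algebra_simps)
  also have "\<dots> = aniso_tail_snd p q u"
    unfolding aniso_tail_snd_def using uq by (simp add: diff_divide_distrib)
  finally show "C * u * (q ^ k / (1 - q)) + C * (q ^ k * (1 / (1 - q) - p / (p - q))) = aniso_tail_snd p q u * q ^ k" .
qed

lemma prob_aniso_fst:
  assumes b: "0 < b"
  shows "measure_pmf.prob (map_pmf fst (aniso_increment b h :: ('p::prime_card qp_mod_zp \<times> 'p qp_mod_zp) pmf)) (qp_ball k)
    = 1 - aniso_tail_fst (real CARD('p)) (real CARD('p) powr (- b)) (real CARD('p) powr (- h * b)) * real CARD('p) powr (- real k * b)"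
proof -
  let ?p = "real CARD('p)"
  define q u C where "q = ?p powr (- b)" and "u = ?p powr (- h * b)" and "C = aniso_const CARD('p) b h"
  have q: "0 < q" "q < 1" using powr_less_one[OF real_card_gt_1[where 'p='p], of "- b"] b by (simp_all add: q_def)
  have u: "0 < u" by (simp add: u_def)
  have C: "C = (1 - q) / (u + q)" unfolding C_def q_def u_def by (rule aniso_const_eq) (rule card_gt_1)
  let ?A = "fst -` (- qp_ball k) :: ('p qp_mod_zp \<times> 'p qp_mod_zp) set"
  let ?F = "\<lambda>j. fine_shell_prob CARD('p) b h j * (card (fine_shell j \<inter> ?A) / card (fine_shell j :: ('p qp_mod_zp \<times> 'p qp_mod_zp) set))"
  have odd: "?F (2 * i + 1) = C * u * (q ^ i * out_frac ?p k i)" for i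
  proof -
    have "fine_shell (2 * i + 1) \<inter> ?A = (qp_ball i - qp_ball k) \<times> (qp_ball (Suc i) - qp_ball i)"
      unfolding fine_shell_odd by auto
    then show ?thesis
      using card_qp_sphere_pos[of i, where 'p='p]
      unfolding fine_shell_prob_odd[OF card_gt_1] fine_shell_odd qp_ball_out_frac[symmetric] q_def u_def C_def
      by (simp add: card_cartesian_product)
  qed
  have even: "?F (2 * i + 2) = C * q * (if i < k then 0 else q ^ i)" for i
  proof -
    have "fine_shell (2 * i + 2) \<inter> ?A = ((qp_ball (Suc i) - qp_ball i) - qp_ball k) \<times> qp_ball (Suc i)"
      unfolding fine_shell_even by auto
    then have "?F (2 * i + 2) = C * q ^ Suc i * (if i < k then 0 else 1)"
      using card_qp_ball_pos[of "Suc i", where 'p='p]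
      unfolding fine_shell_prob_even[OF card_gt_1] fine_shell_even qp_sphere_out_frac[of i k, where 'p='p, symmetric] q_def C_def
      by (simp add: card_cartesian_product)
    then show ?thesis by simp
  qed
  have "?F sums (C * u * (q ^ k * (1 / (1 - q) - ?p / (?p - q))) + C * q * (q ^ k / (1 - q)))"
  proof (rule sums_odd_even)
    show "(\<lambda>i. ?F (2 * i + 1)) sums (C * u * (q ^ k * (1 / (1 - q) - ?p / (?p - q))))"
      unfolding odd by (intro sums_mult out_frac_sums q real_card_gt_1)
    show "(\<lambda>i. ?F (2 * i + 2)) sums (C * q * (q ^ k / (1 - q)))"
      unfolding even by (intro sums_mult geometric_tail_sums q)
  qed (simp add: fine_shell_prob_def)
  from sums_unique2[OF aniso_increment_sums[OF b] this]
  have "measure_pmf.prob (aniso_increment b h) ?A = aniso_tail_fst ?p q u * q ^ k"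
    unfolding C aniso_tail_const(1)[OF real_card_gt_1 q u] .
  then show ?thesis
    unfolding prob_map_qp_ball using real_card_gt_1[where 'p='p]
    by (simp only: powr_minus_mult_eq_power q_def[symmetric] u_def[symmetric])
qed

lemma prob_aniso_snd:
  assumes b: "0 < b"
  shows "measure_pmf.prob (map_pmf snd (aniso_increment b h :: ('p::prime_card qp_mod_zp \<times> 'p qp_mod_zp) pmf)) (qp_ball k)
    = 1 - aniso_tail_snd (real CARD('p)) (real CARD('p) powr (- b)) (real CARD('p) powr (- h * b)) * real CARD('p) powr (- real k * b)"
proof -
  let ?p = "real CARD('p)"
  define q u C where "q = ?p powr (- b)" and "u = ?p powr (- h * b)" and "C = aniso_const CARD('p) b h"
  have q: "0 < q" "q < 1" using powr_less_one[OF real_card_gt_1[where 'p='p], of "- b"] b by (simp_all add: q_def)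
  have u: "0 < u" by (simp add: u_def)
  have C: "C = (1 - q) / (u + q)" unfolding C_def q_def u_def by (rule aniso_const_eq) (rule card_gt_1)
  let ?A = "snd -` (- qp_ball k) :: ('p qp_mod_zp \<times> 'p qp_mod_zp) set"
  let ?F = "\<lambda>j. fine_shell_prob CARD('p) b h j * (card (fine_shell j \<inter> ?A) / card (fine_shell j :: ('p qp_mod_zp \<times> 'p qp_mod_zp) set))"
  have odd: "?F (2 * i + 1) = C * u * (if i < k then 0 else q ^ i)" for i
  proof -
    have "fine_shell (2 * i + 1) \<inter> ?A = qp_ball i \<times> ((qp_ball (Suc i) - qp_ball i) - qp_ball k)"
      unfolding fine_shell_odd by auto
    then have "?F (2 * i + 1) = C * u * q ^ i * (if i < k then 0 else 1)"
      using card_qp_ball_pos[of i, where 'p='p]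
      unfolding fine_shell_prob_odd[OF card_gt_1] fine_shell_odd qp_sphere_out_frac[of i k, where 'p='p, symmetric] q_def u_def C_def
      by (simp add: card_cartesian_product)
    then show ?thesis by simp
  qed
  have even: "?F (2 * i + 2) = C * (q ^ Suc i * out_frac ?p k (Suc i))" for i
  proof -
    have "fine_shell (2 * i + 2) \<inter> ?A = (qp_ball (Suc i) - qp_ball i) \<times> (qp_ball (Suc i) - qp_ball k)"
      unfolding fine_shell_even by auto
    then show ?thesis
      using card_qp_sphere_pos[of i, where 'p='p]
      unfolding fine_shell_prob_even[OF card_gt_1] fine_shell_even qp_ball_out_frac[symmetric] q_def C_def
      by (simp add: card_cartesian_product)
  qed
  have "?F sums (C * u * (q ^ k / (1 - q)) + C * (q ^ k * (1 / (1 - q) - ?p / (?p - q))))"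
  proof (rule sums_odd_even)
    show "(\<lambda>i. ?F (2 * i + 1)) sums (C * u * (q ^ k / (1 - q)))"
      unfolding odd by (intro sums_mult geometric_tail_sums q)
    have "(\<lambda>i. q ^ Suc i * out_frac ?p k (Suc i)) sums (q ^ k * (1 / (1 - q) - ?p / (?p - q)))"
    proof (subst sums_Suc_iff)
      have "out_frac ?p k 0 = 0" by (simp add: out_frac_def)
      then show "(\<lambda>i. q ^ i * out_frac ?p k i) sums (q ^ k * (1 / (1 - q) - ?p / (?p - q)) + q ^ 0 * out_frac ?p k 0)"
        using out_frac_sums[OF q real_card_gt_1[where 'p='p], of k] by simp
    qed
    then show "(\<lambda>i. ?F (2 * i + 2)) sums (C * (q ^ k * (1 / (1 - q) - ?p / (?p - q))))"
      unfolding even by (rule sums_mult)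
  qed (simp add: fine_shell_prob_def)
  from sums_unique2[OF aniso_increment_sums[OF b] this]
  have "measure_pmf.prob (aniso_increment b h) ?A = aniso_tail_snd ?p q u * q ^ k"
    unfolding C aniso_tail_const(2)[OF real_card_gt_1 q u] .
  then show ?thesis
    unfolding prob_map_qp_ball using real_card_gt_1[where 'p='p]
    by (simp only: powr_minus_mult_eq_power q_def[symmetric] u_def[symmetric])
qed

lemma coarse_shell_eq:
  "coarse_shell (Suc j) = qp_ball (Suc j) \<times> qp_ball (Suc j) - qp_ball j \<times> (qp_ball j :: 'p::prime_card qp_mod_zp set)"
proof -
  have e: "2 * Suc j - 2 = 2 * j" "2 * i div 2 = i" "2 * i mod 2 = 0" for i :: nat by simp_all
  show ?thesis unfolding coarse_shell_def ball2_def e by simp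
qed

lemma coarse_shell_fraction:
  assumes "1 < (p::real)" "0 < X"
  shows "(X * X * ((p + 1) * (p - 1)) - Y * X * (p - 1)) / (X * X * ((p + 1) * (p - 1))) = 1 - p / (p + 1) * (Y / (p * X))"
proof -
  have "(X * X * ((p + 1) * (p - 1)) - Y * X * (p - 1)) / (X * X * ((p + 1) * (p - 1)))
      = 1 - (Y * (X * (p - 1))) / (X * (p + 1) * (X * (p - 1)))"
    using assms by (simp add: diff_divide_distrib mult_ac)
  also have "(Y * (X * (p - 1))) / (X * (p + 1) * (X * (p - 1))) = Y / (X * (p + 1))"
    using assms by simp
  also have "\<dots> = p / (p + 1) * (Y / (p * X))" using assms by simp
  finally show ?thesis .
qed

lemma iso_tail_const:
  assumes "1 < (p::real)" "0 < q" "q < 1"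
  shows "(1 - q) * (1 - 1 / (p + 1)) * (Q / (1 - q)) + (1 - q) / (p + 1) * (Q * (1 / (1 - q) - p / (p - q))) = iso_tail p q * Q"
proof -
  have "(1 - q) * (1 - 1 / (p + 1)) * (Q / (1 - q)) + (1 - q) / (p + 1) * (Q * (1 / (1 - q) - p / (p - q)))
      = (1 - 1 / (p + 1)) * Q + (1 / (p + 1)) * Q * ((1 - q) * (1 / (1 - q) - p / (p - q)))"
    using assms by simp
  also have "(1 - q) * (1 / (1 - q) - p / (p - q)) = 1 - p * (1 - q) / (p - q)"
    using assms by (simp add: right_diff_distrib mult.commute)
  also have "(1 - 1 / (p + 1)) * Q + (1 / (p + 1)) * Q * (1 - p * (1 - q) / (p - q)) = (1 - (1 / (p + 1)) * (p * (1 - q) / (p - q))) * Q"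
    by (simp add: algebra_simps)
  finally show ?thesis by (simp add: iso_tail_def return_weight_def)
qed

lemma card_coarse_shell_Diff:
  fixes f :: "'p::prime_card qp_mod_zp \<times> 'p qp_mod_zp \<Rightarrow> 'p qp_mod_zp"
  assumes f: "f = fst \<or> f = snd"
  shows "card (coarse_shell (Suc j) \<inter> f -` (- qp_ball k)) / card (coarse_shell (Suc j) :: ('p qp_mod_zp \<times> 'p qp_mod_zp) set)
    = (if j < k then 0 else 1 - real CARD('p) / (real CARD('p) + 1) * (real CARD('p) ^ k / real CARD('p) ^ Suc j))"
proof (cases "j < k")
  case True
  then have "coarse_shell (Suc j) \<inter> f -` (- qp_ball k) = ({} :: ('p qp_mod_zp \<times> 'p qp_mod_zp) set)"
    using f qp_ball_mono[of "Suc j" k, where 'p='p] by (auto simp: coarse_shell_eq)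
  then show ?thesis using True by simp
next
  case False
  let ?p = "real CARD('p)" and ?S = "coarse_shell (Suc j) :: ('p qp_mod_zp \<times> 'p qp_mod_zp) set"
  have p: "?p > 1" by (rule real_card_gt_1)
  have kj: "qp_ball k \<subseteq> (qp_ball j :: 'p qp_mod_zp set)" "qp_ball j \<subseteq> (qp_ball (Suc j) :: 'p qp_mod_zp set)"
    using False by (intro qp_ball_mono; simp)+
  have "card ?S = card (qp_ball (Suc j) \<times> qp_ball (Suc j) :: ('p qp_mod_zp \<times> 'p qp_mod_zp) set) - card (qp_ball j \<times> qp_ball j :: ('p qp_mod_zp \<times> 'p qp_mod_zp) set)"
    unfolding coarse_shell_eq by (rule card_Diff_subset) (use kj finite_qp_ball in auto)
  moreover have "CARD('p) ^ j * CARD('p) ^ j \<le> CARD('p) ^ Suc j * CARD('p) ^ Suc j"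
    by (intro mult_mono power_increasing) (auto simp: Suc_le_eq)
  ultimately have S: "real (card ?S) = ?p ^ Suc j * ?p ^ Suc j - ?p ^ j * ?p ^ j"
    by (simp add: card_cartesian_product card_qp_ball of_nat_diff del: power_Suc)
  \<comment> \<open>inside \<open>qp_ball k\<close> in one coordinate, a point of the shell must leave \<open>qp_ball j\<close> in the other one\<close>
  have "?S \<inter> f -` qp_ball k = (if f = fst then qp_ball k \<times> (qp_ball (Suc j) - qp_ball j) else (qp_ball (Suc j) - qp_ball j) \<times> qp_ball k)"
    using f kj by (auto simp: coarse_shell_eq)
  then have I: "real (card (?S \<inter> f -` qp_ball k)) = ?p ^ k * (?p ^ Suc j - ?p ^ j)"
    using card_qp_ball_Diff[of j "Suc j", where 'p='p] by (simp add: card_cartesian_product card_qp_ball del: power_Suc)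
  have "card ?S = card (?S \<inter> f -` (- qp_ball k)) + card (?S \<inter> f -` qp_ball k)"
    by (subst card_Un_disjoint[symmetric]) (auto intro!: arg_cong[of _ _ card] simp: coarse_shell_finite)
  then have n1: "real (card (?S \<inter> f -` (- qp_ball k))) = real (card ?S) - ?p ^ k * (?p ^ Suc j - ?p ^ j)"
    using I by linarith
  have n2: "real (card ?S) = ?p ^ j * ?p ^ j * ((?p + 1) * (?p - 1))"
    unfolding S by (simp add: algebra_simps)
  have n3: "?p ^ k * (?p ^ Suc j - ?p ^ j) = ?p ^ k * ?p ^ j * (?p - 1)" by (simp add: algebra_simps)
  have "0 < ?p ^ j" using p by simp
  from coarse_shell_fraction[OF p this, of "?p ^ k"] show ?thesis
    unfolding n1 n2 n3 by (simp only: False if_False power_Suc)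
qed

lemma prob_iso:
  fixes f :: "'p::prime_card qp_mod_zp \<times> 'p qp_mod_zp \<Rightarrow> 'p qp_mod_zp"
  assumes b: "0 < b" and f: "f = fst \<or> f = snd"
  shows "measure_pmf.prob (map_pmf f (iso_increment b)) (qp_ball k)
    = 1 - iso_tail (real CARD('p)) (real CARD('p) powr (- b)) * real CARD('p) powr (- real k * b)"
proof -
  let ?p = "real CARD('p)"
  define q where "q = ?p powr (- b)"
  have q: "0 < q" "q < 1" using powr_less_one[OF real_card_gt_1[where 'p='p], of "- b"] b by (simp_all add: q_def)
  have p: "?p > 1" by (rule real_card_gt_1)
  let ?A = "f -` (- qp_ball k)"
  let ?F = "\<lambda>j. coarse_shell_prob CARD('p) b j * (card (coarse_shell j \<inter> ?A) / card (coarse_shell j :: ('p qp_mod_zp \<times> 'p qp_mod_zp) set))"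
  have prob: "coarse_shell_prob CARD('p) b (Suc j) = (1 - q) * q ^ j" for j
  proof -
    have "coarse_shell_prob CARD('p) b (Suc j) = (?p powr b - 1) * q ^ Suc j"
      unfolding coarse_shell_prob_def q_def using p by (simp only: powr_minus_mult_eq_power) simp
    moreover have "?p powr b = 1 / q" by (simp add: q_def powr_minus inverse_eq_divide)
    ultimately show ?thesis using q by (simp add: left_diff_distrib)
  qed
  \<comment> \<open>split so that the two series that occur for the anisotropic walk can be used\<close>
  have F: "?F (Suc j) = (1 - q) * (1 - 1 / (?p + 1)) * (if j < k then 0 else q ^ j) + (1 - q) / (?p + 1) * (q ^ j * out_frac ?p k j)" for j
  proof (cases "j < k")
    case False
    have "?p / (?p + 1) * (?p ^ k / ?p ^ Suc j) = 1 / (?p + 1) * (?p ^ k / ?p ^ j)" using p by simp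
    then show ?thesis
      unfolding prob card_coarse_shell_Diff[OF f] out_frac_def using False by (simp add: algebra_simps)
  qed (simp add: prob card_coarse_shell_Diff[OF f] out_frac_def)
  have "(\<lambda>j. ?F (Suc j)) sums ((1 - q) * (1 - 1 / (?p + 1)) * (q ^ k / (1 - q)) + (1 - q) / (?p + 1) * (q ^ k * (1 / (1 - q) - ?p / (?p - q))))"
    unfolding F by (intro sums_add sums_mult geometric_tail_sums out_frac_sums q p)
  then have "?F sums ((1 - q) * (1 - 1 / (?p + 1)) * (q ^ k / (1 - q)) + (1 - q) / (?p + 1) * (q ^ k * (1 / (1 - q) - ?p / (?p - q))))"
    by (subst (asm) sums_Suc_iff) (simp add: coarse_shell_prob_def)
  from sums_unique2[OF iso_increment_sums[OF b] this]
  have "measure_pmf.prob (iso_increment b) ?A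
      = (1 - q) * (1 - 1 / (?p + 1)) * (q ^ k / (1 - q)) + (1 - q) / (?p + 1) * (q ^ k * (1 / (1 - q) - ?p / (?p - q)))" .
  also have "\<dots> = iso_tail ?p q * q ^ k"
    by (rule iso_tail_const[OF p q])
  finally show ?thesis
    unfolding prob_map_qp_ball using p by (simp only: powr_minus_mult_eq_power q_def[symmetric])
qed

section \<open>Comparison of the diffusion coefficients\<close>

text \<open>For \<open>q \<le> u\<close> the fraction \<open>u / (u + q)\<close> is at least \<open>1 / 2\<close> and \<open>q / (u + q)\<close> is at most \<open>1 / 2\<close>, while
  \<open>1 / (p + 1)\<close> is strictly between \<open>1 / (2 p)\<close> and \<open>1 / 2\<close>.\<close>

lemma tail_gap:
  assumes p: "1 < (p::real)" and q: "0 < q" "q < 1" and u: "q \<le> u"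
  defines "g \<equiv> return_weight p q * (p - 1) / (2 * p * (p + 1))"
  shows "0 < g" "g \<le> iso_tail p q - aniso_tail_fst p q u" "g \<le> aniso_tail_snd p q u - iso_tail p q"
proof -
  let ?w = "return_weight p q"
  have w: "0 < ?w" using p q by (simp add: return_weight_def)
  show "0 < g" using w p by (simp add: g_def)
  have uq: "0 < u + q" using q u by simp
  have "1 / 2 \<le> u / (u + q)" using uq u by (simp add: field_simps)
  then have "?w * (1 / 2) \<le> ?w * (u / (u + q))" using w by (intro mult_left_mono) auto
  moreover have "?w * (1 / 2) - ?w / (p + 1) = p * g"
    using p by (simp add: g_def divide_simps) (simp add: algebra_simps)
  moreover have "g \<le> p * g" using p \<open>0 < g\<close> by simp
  ultimately show "g \<le> iso_tail p q - aniso_tail_fst p q u"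
    unfolding iso_tail_def aniso_tail_fst_def by linarith
  have "q / (u + q) \<le> 1 / 2" using uq u by (simp add: field_simps)
  then have "?w / p * (q / (u + q)) \<le> ?w / p * (1 / 2)" using w p by (intro mult_left_mono) auto
  moreover have "?w / (p + 1) - ?w / p * (1 / 2) = g"
    using p by (simp add: g_def divide_simps) (simp add: algebra_simps)
  ultimately show "g \<le> aniso_tail_snd p q u - iso_tail p q"
    unfolding iso_tail_def aniso_tail_snd_def by linarith
qed

text \<open>The division by \<open>\<kappa> \<le> 1\<close> can only widen the gap.\<close>

lemma diffusion_coefficient_gap:
  fixes \<kappa> :: real
  assumes "0 \<le> \<kappa>" "\<kappa> \<le> 1" "0 < D" "\<sigma> * \<kappa> = D * c" "\<sigma>' * \<kappa> = D * c'" "g \<le> \<bar>c - c'\<bar>"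
  shows "D * g \<le> \<bar>\<sigma> - \<sigma>'\<bar>"
proof -
  have "D * g \<le> D * \<bar>c - c'\<bar>" using assms by (intro mult_left_mono) auto
  also have "\<dots> = \<bar>D * c - D * c'\<bar>" using assms(3) by (simp add: right_diff_distrib[symmetric] abs_mult)
  also have "\<dots> = \<bar>\<sigma> - \<sigma>'\<bar> * \<kappa>"
    unfolding assms(4,5)[symmetric] using assms(1) by (simp add: left_diff_distrib[symmetric] abs_mult)
  also have "\<dots> \<le> \<bar>\<sigma> - \<sigma>'\<bar> * 1" using assms(2) by (intro mult_left_mono) auto
  finally show ?thesis by simp
qed

theorem theorem6p1:
  fixes b D :: real
  assumes "0 < b" and "0 < D"
  shows "\<exists>\<delta>>0. \<forall>h\<in>{0<..<1}. \<forall>\<sigma>1 \<sigma>2 \<sigma>max.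
    diffusion_coefficient b D (map_pmf fst (aniso_increment b h :: ('p::prime_card qp_mod_zp \<times> 'p qp_mod_zp) pmf)) \<sigma>1 \<and>
    diffusion_coefficient b D (map_pmf snd (aniso_increment b h :: ('p qp_mod_zp \<times> 'p qp_mod_zp) pmf)) \<sigma>2 \<and>
    (diffusion_coefficient b D (map_pmf fst (iso_increment b :: ('p qp_mod_zp \<times> 'p qp_mod_zp) pmf)) \<sigma>max \<or>
     diffusion_coefficient b D (map_pmf snd (iso_increment b :: ('p qp_mod_zp \<times> 'p qp_mod_zp) pmf)) \<sigma>max) \<longrightarrow>
    \<bar>\<sigma>1 - \<sigma>max\<bar> \<ge> \<delta> \<and> \<bar>\<sigma>2 - \<sigma>max\<bar> \<ge> \<delta>"
proof -
  let ?p = "real CARD('p)"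
  define q where "q = ?p powr (- b)"
  define g where "g = return_weight ?p q * (?p - 1) / (2 * ?p * (?p + 1))"
  note p = real_card_gt_1[where 'p='p]
  have q: "0 < q" "q < 1" using powr_less_one[OF p, of "- b"] assms(1) by (simp_all add: q_def)
  have g: "0 < g" using tail_gap(1)[OF p q, of q] by (simp add: g_def)
  note \<kappa> = stable_rate_bounds[OF less_imp_le[OF assms(1)], where 'p='p]
  show ?thesis
  proof (intro exI[of _ "D * g"] conjI ballI allI impI)
    show "0 < D * g" using g assms(2) by simp
    fix h \<sigma>1 \<sigma>2 \<sigma>max :: real
    assume h: "h \<in> {0<..<1}"
    assume \<sigma>: "diffusion_coefficient b D (map_pmf fst (aniso_increment b h :: ('p qp_mod_zp \<times> 'p qp_mod_zp) pmf)) \<sigma>1 \<and>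
      diffusion_coefficient b D (map_pmf snd (aniso_increment b h :: ('p qp_mod_zp \<times> 'p qp_mod_zp) pmf)) \<sigma>2 \<and>
      (diffusion_coefficient b D (map_pmf fst (iso_increment b :: ('p qp_mod_zp \<times> 'p qp_mod_zp) pmf)) \<sigma>max \<or>
       diffusion_coefficient b D (map_pmf snd (iso_increment b :: ('p qp_mod_zp \<times> 'p qp_mod_zp) pmf)) \<sigma>max)"
    define u where "u = ?p powr (- h * b)"
    have u: "q \<le> u" unfolding q_def u_def using p assms(1) h by (intro powr_mono) auto
    let ?\<kappa> = "stable_rate TYPE('p) b"
    have 1: "\<sigma>1 * ?\<kappa> = D * aniso_tail_fst ?p q u"
      by (rule diffusion_coefficient_tail[OF assms prob_aniso_fst[OF assms(1), where h=h and 'p='p, folded q_def u_def]]) (use \<sigma> in blast)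
    have 2: "\<sigma>2 * ?\<kappa> = D * aniso_tail_snd ?p q u"
      by (rule diffusion_coefficient_tail[OF assms prob_aniso_snd[OF assms(1), where h=h and 'p='p, folded q_def u_def]]) (use \<sigma> in blast)
    have "\<sigma>max * ?\<kappa> = D * iso_tail ?p q"
      if "f = fst \<or> f = snd" "diffusion_coefficient b D (map_pmf f (iso_increment b :: ('p qp_mod_zp \<times> 'p qp_mod_zp) pmf)) \<sigma>max" for f
      by (rule diffusion_coefficient_tail[OF assms prob_iso[OF assms(1) that(1), folded q_def] that(2)])
    then have 3: "\<sigma>max * ?\<kappa> = D * iso_tail ?p q" using \<sigma> by blast
    note gap = tail_gap(2,3)[OF p q u, folded g_def]
    show "D * g \<le> \<bar>\<sigma>1 - \<sigma>max\<bar>"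
      by (rule diffusion_coefficient_gap[OF \<kappa> assms(2) 1 3]) (use gap in linarith)
    show "D * g \<le> \<bar>\<sigma>2 - \<sigma>max\<bar>"
      by (rule diffusion_coefficient_gap[OF \<kappa> assms(2) 2 3]) (use gap in linarith)
  qed
qed

end
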